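(* Let $G$ be a simply connected six-dimensional unimodular almost abelian Lie group and let $(J,\omega_0)$ be a left-invariant balanced Hermitian structure on $G$, with associated bracket $\mu(0,0,A_0)$, $\operatorname{tr}A_0=0$. Then the maximal definition interval of the (left-invariant) solution of the balanced flow starting from $(J,\omega_0)$ is of the form $(T_{\min},\infty)$ for some $T_{\min}\in\mathbb{R}_{<0}\cup\{-\infty\}$. Moreover, $\omega_0$ is a fixed (constant) solution of the balanced flow if and only if it is Kähler.
   Context: A Lie group is almost abelian if its Lie algebra $\mathfrak{g}$ contains an abelian ideal $\mathfrak{n}$ of codimension one; unimodular means $\operatorname{tr}\operatorname{ad}_X=0$ for all $X\in\mathfrak g$. A left-invariant Hermitian structure $(J,g)$, with fundamental form $\omega=g(J\cdot,\cdot)$ (identified with $g$), is balanced if $d\omega^{n-1}=0$ and Kähler if $d\omega=0$, where $2n=\dim_{\mathbb R} G$ (here $n=3$). Algebraic data: set $\mathfrak{n}_1=\mathfrak{n}\cap J\mathfrak{n}$ and choose an adapted unitary basis, i.e. a $g$-orthonormal basis $\{e_1,\ldots,e_{2n}\}$ of $\mathfrak{g}$ with $\mathfrak{n}=\mathrm{span}\langle e_1,\ldots,e_{2n-1}\rangle$, $\mathfrak{n}_1=\mathrm{span}\langle e_2,\ldots,e_{2n-1}\rangle$, $Je_i=e_{2n+1-i}$ for $i\le n$. Then $\operatorname{ad}_{e_{2n}}|_{\mathfrak n}$ has matrix $\begin{pmatrix} a & 0 \\ v & A \end{pmatrix}$, $a\in\mathbb{R}$, $v\in\mathfrak{n}_1$,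 $A\in\mathfrak{gl}(\mathfrak{n}_1)$ commuting with $J|_{\mathfrak{n}_1}$; the corresponding Lie bracket is denoted $\mu(a,v,A)$. In the unimodular balanced case $a=0$, $v=0$, $\operatorname{tr}A=0$. Balanced flow: for balanced $\omega_0$, $$\tfrac{\partial}{\partial t}\omega(t)=q(\omega(t)),\quad \omega(0)=\omega_0,\qquad q(\omega)=(n-2)!\,\iota_{\omega^{n-2}}\big(i\partial\overline\partial*(\rho^C\wedge\omega)\big)+\tfrac{1}{n-1}\,\iota_{\omega^{n-2}}\Delta_{BC}\,\omega^{n-1},$$ where $*$ is the Hodge star of $\omega$ (for the orientation induced by $J$), $\rho^C$ its Chern-Ricci form, i.e. $\rho^C(X,Y)=-\frac12\sum_i g(R^C(X,Y)e_i,Je_i)$ with $R^C$ the curvature of the Chern connection, $\iota_{\omega^{n-2}}$ maps a $(2n-2)$-form $\beta$ to the unique 2-form $\gamma$ with $\gamma\wedge\omega^{n-2}=\beta$, and $$\Delta_{BC}=\partial\overline\partial\,\overline\partial^*\partial^*+\overline\partial^*\partial^*\partial\overline\partial+\overline\partial^*\partial\partial^*\overline\partial+\partial^*\overline\partial\,\overline\partial^*\partial+\overline\partial^*\overline\partial+\partial^*\partial .$$ For left-invariant initial data the solution is left-invariant and the flow is an ODE on the Lie algebra; the maximal definition interval is that of the solution of this ODE. *)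

theory Defs
  imports "HOL-Analysis.Analysis"
begin

text \<open>
  The Lie algebra of a simply connected Lie group is a finite-dimensional real vector space
  \<^typ>\<open>'g::euclidean_space\<close> with a bracket \<open>\<mu>\<close>; left-invariant tensors are tensors on it.  The inner
  product that the type class puts on \<^typ>\<open>'g\<close> has no geometric meaning here: the Hermitian metrics
  are bilinear maps \<open>g\<close> on \<^typ>\<open>'g\<close>.
\<close>


section \<open>Lie algebras\<close>

definition lie_bracket :: "('g::euclidean_space \<Rightarrow> 'g \<Rightarrow> 'g) \<Rightarrow> bool" where
  "lie_bracket \<mu> \<longleftrightarrow> bilinear \<mu> \<and> (\<forall>X. \<mu> X X = 0) \<and>
     (\<forall>X Y Z. \<mu> X (\<mu> Y Z) + \<mu> Y (\<mu> Z X) + \<mu> Z (\<mu> X Y) = 0)"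

definition lin_trace :: "('g::euclidean_space \<Rightarrow> 'g) \<Rightarrow> real" where
  "lin_trace f = (\<Sum>b\<in>Basis. f b \<bullet> b)"

definition unimodular :: "('g::euclidean_space \<Rightarrow> 'g \<Rightarrow> 'g) \<Rightarrow> bool" where
  "unimodular \<mu> \<longleftrightarrow> (\<forall>X. lin_trace (\<mu> X) = 0)"

text \<open>A Lie algebra is almost abelian if there is some \<open>\<nn>\<close> with the following property.\<close>

definition codim_one_abelian_ideal :: "('g::euclidean_space \<Rightarrow> 'g \<Rightarrow> 'g) \<Rightarrow> 'g set \<Rightarrow> bool" where
  "codim_one_abelian_ideal \<mu> \<nn> \<longleftrightarrow> subspace \<nn> \<and> dim \<nn> + 1 = DIM('g) \<and>
     (\<forall>X. \<forall>Y\<in>\<nn>. \<mu> X Y \<in> \<nn>) \<and> (\<forall>X\<in>\<nn>. \<forall>Y\<in>\<nn>. \<mu> X Y = 0)"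


section \<open>Exterior algebra of complex-valued left-invariant forms\<close>

text \<open>
  An element of the (complexified) exterior algebra is a function on lists of vectors; its degree
  \<open>k\<close> component is its restriction to lists of length \<open>k\<close>.  All operators below act on arbitrary,
  possibly inhomogeneous, forms, and the degrees are read off from the lengths of the lists.
\<close>

type_synonym 'g form = "'g list \<Rightarrow> complex"

definition is_form :: "nat \<Rightarrow> 'g::euclidean_space form \<Rightarrow> bool" where
  "is_form k \<alpha> \<longleftrightarrow>
     (\<forall>xs. length xs \<noteq> k \<longrightarrow> \<alpha> xs = 0) \<and>
     (\<forall>xs. length xs = k \<longrightarrow> (\<forall>i<k. linear (\<lambda>x. \<alpha> (xs[i := x])))) \<and>
     (\<forall>xs. length xs = k \<longrightarrow> \<not> distinct xs \<longrightarrow> \<alpha> xs = 0)"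

text \<open>
  The wedge product as a sum over shuffles, so that \<open>e\<^sup>1 \<and> e\<^sup>2\<close> takes the value 1 on \<open>[e\<^sub>1, e\<^sub>2]\<close>; the sign
  is that of the permutation listing first \<open>S\<close>, then its complement, in increasing order.
\<close>

definition shuffle_sign :: "nat \<Rightarrow> nat set \<Rightarrow> complex" where
  "shuffle_sign m S = (- 1) ^ card {(i, j). i \<in> S \<and> j \<in> {..<m} - S \<and> j < i}"

definition wedge :: "'g form \<Rightarrow> 'g form \<Rightarrow> 'g form"  (infixr "\<^bold>\<and>" 70) where
  "\<alpha> \<^bold>\<and> \<beta> = (\<lambda>xs. \<Sum>S\<in>Pow {..<length xs}.
     shuffle_sign (length xs) S * \<alpha> (nths xs S) * \<beta> (nths xs ({..<length xs} - S)))"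

primrec wedge_power :: "'g form \<Rightarrow> nat \<Rightarrow> 'g form" where
  "wedge_power \<alpha> 0 = (\<lambda>xs. if xs = [] then 1 else 0)"
| "wedge_power \<alpha> (Suc k) = \<alpha> \<^bold>\<and> wedge_power \<alpha> k"

text \<open>
  Exterior derivative of left-invariant forms (Chevalley--Eilenberg):
  \<open>d\<alpha>(X\<^sub>0, \<dots>, X\<^sub>k) = \<Sum>\<^bsub>i<j\<^esub> (-1)\<^bsup>i+j\<^esup> \<alpha>([X\<^sub>i, X\<^sub>j], X\<^sub>0, \<dots>, X\<^sub>k)\<close>, with \<open>X\<^sub>i\<close> and \<open>X\<^sub>j\<close> omitted from
  the remaining arguments.
\<close>

definition ext_d :: "('g \<Rightarrow> 'g \<Rightarrow> 'g) \<Rightarrow> 'g form \<Rightarrow> 'g form" where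
  "ext_d \<mu> \<alpha> = (\<lambda>xs. \<Sum>(i, j)\<in>{(i, j). i < j \<and> j < length xs}.
     (- 1) ^ (i + j) * \<alpha> (\<mu> (xs ! i) (xs ! j) # nths xs (- {i, j})))"


section \<open>Complex structures, bidegree, \<open>\<partial>\<close> and \<open>\<partial>\<close>-bar\<close>

definition complex_structure :: "('g::euclidean_space \<Rightarrow> 'g \<Rightarrow> 'g) \<Rightarrow> ('g \<Rightarrow> 'g) \<Rightarrow> bool" where
  "complex_structure \<mu> J \<longleftrightarrow> linear J \<and> (\<forall>X. J (J X) = - X) \<and>
     (\<forall>X Y. \<mu> (J X) (J Y) - J (\<mu> (J X) Y) - J (\<mu> X (J Y)) - \<mu> X Y = 0)"

text \<open>
  A vector \<open>u + \<i>v\<close> of the complexified Lie algebra is represented by the pair \<open>(u, v)\<close>;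
  \<open>form_cx \<alpha>\<close> is the complex multilinear extension of \<open>\<alpha>\<close> to such vectors.
\<close>

definition form_cx :: "'g form \<Rightarrow> ('g \<times> 'g) list \<Rightarrow> complex" where
  "form_cx \<alpha> zs = (\<Sum>T\<in>Pow {..<length zs}.
     \<i> ^ card T * \<alpha> (map (\<lambda>k. if k \<in> T then snd (zs ! k) else fst (zs ! k)) [0..<length zs]))"

text \<open>The components of \<open>X\<close> of type (1,0), \<open>(X - \<i>JX)/2\<close>, and of type (0,1), \<open>(X + \<i>JX)/2\<close>.\<close>

definition part10 :: "('g::real_vector \<Rightarrow> 'g) \<Rightarrow> 'g \<Rightarrow> 'g \<times> 'g" where
  "part10 J X = ((1/2) *\<^sub>R X, - ((1/2) *\<^sub>R J X))"

definition part01 :: "('g::real_vector \<Rightarrow> 'g) \<Rightarrow> 'g \<Rightarrow> 'g \<times> 'g" where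
  "part01 J X = ((1/2) *\<^sub>R X, (1/2) *\<^sub>R J X)"

text \<open>The component of type \<open>(p, q)\<close>.\<close>

definition bidegree :: "('g::real_vector \<Rightarrow> 'g) \<Rightarrow> nat \<Rightarrow> nat \<Rightarrow> 'g form \<Rightarrow> 'g form" where
  "bidegree J p q \<alpha> = (\<lambda>xs. if length xs = p + q
     then \<Sum>S\<in>{S. S \<subseteq> {..<p + q} \<and> card S = p}.
       form_cx \<alpha> (map (\<lambda>k. if k \<in> S then part10 J (xs ! k) else part01 J (xs ! k)) [0..<p + q])
     else 0)"

text \<open>
  \<open>\<partial>\<close> is the component of \<open>d\<close> from type \<open>(p, q)\<close> to type \<open>(p + 1, q)\<close>, summed over all \<open>(p, q)\<close> with
  \<open>p + q + 1\<close> equal to the number of arguments; similarly for \<open>\<partial>\<close>-bar.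
\<close>

definition del :: "('g::real_vector \<Rightarrow> 'g \<Rightarrow> 'g) \<Rightarrow> ('g \<Rightarrow> 'g) \<Rightarrow> 'g form \<Rightarrow> 'g form" where
  "del \<mu> J \<alpha> = (\<lambda>xs. \<Sum>(p, q)\<in>{(p, q). p + q + 1 = length xs}.
     bidegree J (p + 1) q (ext_d \<mu> (bidegree J p q \<alpha>)) xs)"

definition delbar :: "('g::real_vector \<Rightarrow> 'g \<Rightarrow> 'g) \<Rightarrow> ('g \<Rightarrow> 'g) \<Rightarrow> 'g form \<Rightarrow> 'g form" where
  "delbar \<mu> J \<alpha> = (\<lambda>xs. \<Sum>(p, q)\<in>{(p, q). p + q + 1 = length xs}.
     bidegree J p (q + 1) (ext_d \<mu> (bidegree J p q \<alpha>)) xs)"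


section \<open>Hermitian metrics\<close>

definition hermitian_metric ::
    "('g::euclidean_space \<Rightarrow> 'g) \<Rightarrow> ('g \<Rightarrow> 'g \<Rightarrow> real) \<Rightarrow> bool" where
  "hermitian_metric J g \<longleftrightarrow> bilinear g \<and> (\<forall>X Y. g X Y = g Y X) \<and>
     (\<forall>X. X \<noteq> 0 \<longrightarrow> g X X > 0) \<and> (\<forall>X Y. g (J X) (J Y) = g X Y)"

definition fundamental_form :: "('g \<Rightarrow> 'g) \<Rightarrow> ('g \<Rightarrow> 'g \<Rightarrow> real) \<Rightarrow> 'g form" where
  "fundamental_form J g = (\<lambda>xs. case xs of [X, Y] \<Rightarrow> complex_of_real (g (J X) Y) | _ \<Rightarrow> 0)"

text \<open>The metric is recovered from its fundamental form by \<open>g(X, Y) = \<omega>(X, JY)\<close>.\<close>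

definition metric_of :: "('g \<Rightarrow> 'g) \<Rightarrow> 'g form \<Rightarrow> 'g \<Rightarrow> 'g \<Rightarrow> real" where
  "metric_of J \<omega> X Y = Re (\<omega> [X, J Y])"

definition balanced :: "('g::euclidean_space \<Rightarrow> 'g \<Rightarrow> 'g) \<Rightarrow> 'g form \<Rightarrow> bool" where
  "balanced \<mu> \<omega> \<longleftrightarrow> ext_d \<mu> (wedge_power \<omega> (DIM('g) div 2 - 1)) = (\<lambda>_. 0)"

definition kaehler :: "('g \<Rightarrow> 'g \<Rightarrow> 'g) \<Rightarrow> 'g form \<Rightarrow> bool" where
  "kaehler \<mu> \<omega> \<longleftrightarrow> ext_d \<mu> \<omega> = (\<lambda>_. 0)"

text \<open>Orthonormal bases are indexed by \<open>1, \<dots>, DIM('g)\<close>.\<close>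

definition orthonormal_basis :: "('g::euclidean_space \<Rightarrow> 'g \<Rightarrow> real) \<Rightarrow> (nat \<Rightarrow> 'g) \<Rightarrow> bool" where
  "orthonormal_basis g e \<longleftrightarrow>
     (\<forall>i\<in>{1..DIM('g)}. \<forall>j\<in>{1..DIM('g)}. g (e i) (e j) = (if i = j then 1 else 0))"

definition some_onb :: "('g::euclidean_space \<Rightarrow> 'g \<Rightarrow> real) \<Rightarrow> nat \<Rightarrow> 'g" where
  "some_onb g = (SOME e. orthonormal_basis g e)"

text \<open>
  The Riemannian volume form for the orientation induced by \<open>J\<close>, which equals 1 on \<open>g\<close>-orthonormal
  bases of the form \<open>e\<^sub>1, Je\<^sub>1, \<dots>, e\<^sub>n, Je\<^sub>n\<close>, is \<open>\<omega>\<^sup>n/n!\<close>.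
\<close>

definition volume_form :: "'g::euclidean_space form \<Rightarrow> 'g form" where
  "volume_form \<omega> = (\<lambda>xs. wedge_power \<omega> (DIM('g) div 2) xs / fact (DIM('g) div 2))"

text \<open>
  The complex linear Hodge star, normalised by \<open>\<alpha> \<and> *\<beta> = g(\<alpha>, \<beta>) vol\<close> (with \<open>g\<close> extended complex
  bilinearly): \<open>*\<beta>\<close> is the sum over all \<open>i\<^sub>1 < \<dots> < i\<^sub>k\<close> of
  \<open>\<beta>(e\<^bsub>i\<^sub>1\<^esub>, \<dots>, e\<^bsub>i\<^sub>k\<^esub>) vol(e\<^bsub>i\<^sub>1\<^esub>, \<dots>, e\<^bsub>i\<^sub>k\<^esub>, \<cdot>)\<close>, for any orthonormal basis.
\<close>

definition hodge :: "('g::euclidean_space \<Rightarrow> 'g) \<Rightarrow> 'g form \<Rightarrow> 'g form \<Rightarrow> 'g form" where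
  "hodge J \<omega> \<beta> = (let es = map (some_onb (metric_of J \<omega>)) [1..<DIM('g) + 1] in
     (\<lambda>xs. \<Sum>S\<in>Pow {..<DIM('g)}. \<beta> (nths es S) * volume_form \<omega> (nths es S @ xs)))"

text \<open>The formal adjoints, \<open>\<partial>\<^sup>* = - * \<partial>\<close>-bar \<open>*\<close> and \<open>\<partial>\<close>-bar\<open>\<^sup>* = - * \<partial> *\<close>.\<close>

definition del_adj :: "('g::euclidean_space \<Rightarrow> 'g \<Rightarrow> 'g) \<Rightarrow> ('g \<Rightarrow> 'g) \<Rightarrow> 'g form \<Rightarrow> 'g form \<Rightarrow> 'g form"
  where "del_adj \<mu> J \<omega> \<alpha> = (\<lambda>xs. - hodge J \<omega> (delbar \<mu> J (hodge J \<omega> \<alpha>)) xs)"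

definition delbar_adj :: "('g::euclidean_space \<Rightarrow> 'g \<Rightarrow> 'g) \<Rightarrow> ('g \<Rightarrow> 'g) \<Rightarrow> 'g form \<Rightarrow> 'g form \<Rightarrow> 'g form"
  where "delbar_adj \<mu> J \<omega> \<alpha> = (\<lambda>xs. - hodge J \<omega> (del \<mu> J (hodge J \<omega> \<alpha>)) xs)"

definition bott_chern_laplacian ::
    "('g::euclidean_space \<Rightarrow> 'g \<Rightarrow> 'g) \<Rightarrow> ('g \<Rightarrow> 'g) \<Rightarrow> 'g form \<Rightarrow> 'g form \<Rightarrow> 'g form" where
  "bott_chern_laplacian \<mu> J \<omega> \<alpha> =
    (let D = del \<mu> J; B = delbar \<mu> J; D' = del_adj \<mu> J \<omega>; B' = delbar_adj \<mu> J \<omega> in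
     (\<lambda>xs. D (B (B' (D' \<alpha>))) xs + B' (D' (D (B \<alpha>))) xs + B' (D (D' (B \<alpha>))) xs
         + D' (B (B' (D \<alpha>))) xs + B' (B \<alpha>) xs + D' (D \<alpha>) xs))"


section \<open>Chern connection and Chern--Ricci form\<close>

text \<open>
  The Chern connection is the unique connection that preserves \<open>g\<close> and \<open>J\<close> and whose torsion has
  vanishing (1,1)-part, i.e. \<open>T(JX, JY) = - T(X, Y)\<close>.  Being left-invariant, it is a bilinear map
  \<open>(X, Y) \<mapsto> \<nabla>\<^sub>X Y\<close>.
\<close>

definition torsion :: "('g \<Rightarrow> 'g \<Rightarrow> 'g) \<Rightarrow> ('g \<Rightarrow> 'g \<Rightarrow> 'g) \<Rightarrow> 'g \<Rightarrow> 'g \<Rightarrow> 'g::euclidean_space" where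
  "torsion \<mu> N X Y = N X Y - N Y X - \<mu> X Y"

definition is_chern_connection ::
    "('g::euclidean_space \<Rightarrow> 'g \<Rightarrow> 'g) \<Rightarrow> ('g \<Rightarrow> 'g) \<Rightarrow> ('g \<Rightarrow> 'g \<Rightarrow> real) \<Rightarrow> ('g \<Rightarrow> 'g \<Rightarrow> 'g) \<Rightarrow> bool" where
  "is_chern_connection \<mu> J g N \<longleftrightarrow> bilinear N \<and>
     (\<forall>X Y Z. g (N X Y) Z + g Y (N X Z) = 0) \<and>
     (\<forall>X Y. N X (J Y) = J (N X Y)) \<and>
     (\<forall>X Y. torsion \<mu> N (J X) (J Y) = - torsion \<mu> N X Y)"

definition chern_connection ::
    "('g::euclidean_space \<Rightarrow> 'g \<Rightarrow> 'g) \<Rightarrow> ('g \<Rightarrow> 'g) \<Rightarrow> ('g \<Rightarrow> 'g \<Rightarrow> real) \<Rightarrow> 'g \<Rightarrow> 'g \<Rightarrow> 'g" where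
  "chern_connection \<mu> J g = (THE N. is_chern_connection \<mu> J g N)"

definition chern_curvature ::
    "('g::euclidean_space \<Rightarrow> 'g \<Rightarrow> 'g) \<Rightarrow> ('g \<Rightarrow> 'g) \<Rightarrow> ('g \<Rightarrow> 'g \<Rightarrow> real) \<Rightarrow> 'g \<Rightarrow> 'g \<Rightarrow> 'g \<Rightarrow> 'g" where
  "chern_curvature \<mu> J g X Y Z =
     (let N = chern_connection \<mu> J g in N X (N Y Z) - N Y (N X Z) - N (\<mu> X Y) Z)"

definition chern_ricci_form ::
    "('g::euclidean_space \<Rightarrow> 'g \<Rightarrow> 'g) \<Rightarrow> ('g \<Rightarrow> 'g) \<Rightarrow> 'g form \<Rightarrow> 'g form" where
  "chern_ricci_form \<mu> J \<omega> = (let g = metric_of J \<omega>; e = some_onb g in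
     (\<lambda>xs. case xs of
        [X, Y] \<Rightarrow> complex_of_real
          (- (1/2) * (\<Sum>i = 1..DIM('g). g (chern_curvature \<mu> J g X Y (e i)) (J (e i))))
      | _ \<Rightarrow> 0))"


section \<open>The balanced flow\<close>

text \<open>\<open>iota \<eta> \<beta>\<close> is \<open>\<iota>\<^sub>\<eta> \<beta>\<close>, for \<open>\<eta> = \<omega>\<^bsup>n-2\<^esup>\<close> and \<open>\<beta>\<close> of degree \<open>2n - 2\<close>.\<close>

definition iota :: "'g::euclidean_space form \<Rightarrow> 'g form \<Rightarrow> 'g form" where
  "iota \<eta> \<beta> = (THE \<gamma>. is_form 2 \<gamma> \<and> \<gamma> \<^bold>\<and> \<eta> = \<beta>)"

definition balanced_flow_rhs ::
    "('g::euclidean_space \<Rightarrow> 'g \<Rightarrow> 'g) \<Rightarrow> ('g \<Rightarrow> 'g) \<Rightarrow> 'g form \<Rightarrow> 'g form" where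
  "balanced_flow_rhs \<mu> J \<omega> =
    (let n = DIM('g) div 2;
         \<eta> = wedge_power \<omega> (n - 2);
         \<phi> = hodge J \<omega> (chern_ricci_form \<mu> J \<omega> \<^bold>\<and> \<omega>)
     in (\<lambda>xs. fact (n - 2) * iota \<eta> (\<lambda>ys. \<i> * del \<mu> J (delbar \<mu> J \<phi>) ys) xs
            + 1 / (of_nat n - 1) * iota \<eta> (bott_chern_laplacian \<mu> J \<omega> (wedge_power \<omega> (n - 1))) xs))"

text \<open>
  The time derivative is taken in the finite-dimensional space of 2-forms, hence may be computed
  pointwise on lists of arguments.
\<close>

definition balanced_flow_solution ::
    "('g::euclidean_space \<Rightarrow> 'g \<Rightarrow> 'g) \<Rightarrow> ('g \<Rightarrow> 'g) \<Rightarrow> 'g form \<Rightarrow> real set \<Rightarrow> (real \<Rightarrow> 'g form) \<Rightarrow> bool"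
  where
  "balanced_flow_solution \<mu> J \<omega>\<^sub>0 I \<omega> \<longleftrightarrow>
     open I \<and> is_interval I \<and> 0 \<in> I \<and> \<omega> 0 = \<omega>\<^sub>0 \<and>
     (\<forall>t\<in>I. (\<exists>g. hermitian_metric J g \<and> \<omega> t = fundamental_form J g) \<and>
        (\<forall>xs. ((\<lambda>s. \<omega> s xs) has_vector_derivative balanced_flow_rhs \<mu> J (\<omega> t) xs) (at t)))"

definition maximal_balanced_flow_solution ::
    "('g::euclidean_space \<Rightarrow> 'g \<Rightarrow> 'g) \<Rightarrow> ('g \<Rightarrow> 'g) \<Rightarrow> 'g form \<Rightarrow> real set \<Rightarrow> (real \<Rightarrow> 'g form) \<Rightarrow> bool"
  where
  "maximal_balanced_flow_solution \<mu> J \<omega>\<^sub>0 I \<omega> \<longleftrightarrow>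
     balanced_flow_solution \<mu> J \<omega>\<^sub>0 I \<omega> \<and>
     (\<forall>I' \<omega>'. balanced_flow_solution \<mu> J \<omega>\<^sub>0 I' \<omega>' \<longrightarrow> I' \<subseteq> I \<and> (\<forall>t\<in>I'. \<omega>' t = \<omega> t))"


section \<open>Algebraic data of almost abelian Hermitian Lie algebras\<close>

definition adapted_unitary_basis ::
    "('g::euclidean_space \<Rightarrow> 'g) \<Rightarrow> ('g \<Rightarrow> 'g \<Rightarrow> real) \<Rightarrow> 'g set \<Rightarrow> (nat \<Rightarrow> 'g) \<Rightarrow> bool" where
  "adapted_unitary_basis J g \<nn> e \<longleftrightarrow> orthonormal_basis g e \<and>
     \<nn> = span (e ` {1..DIM('g) - 1}) \<and>
     \<nn> \<inter> J ` \<nn> = span (e ` {2..DIM('g) - 1}) \<and>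
     (\<forall>i\<in>{1..DIM('g) div 2}. J (e i) = e (DIM('g) + 1 - i))"

text \<open>
  The bracket is \<open>\<mu>(a, v, A)\<close> with respect to the adapted basis \<open>e\<close>: the restriction of
  \<open>ad e\<^bsub>2n\<^esub>\<close> to the abelian ideal \<open>\<nn>\<close> is given by \<open>(a, v, A)\<close>.  Only the values of
  \<open>A\<close> on \<open>\<nn>\<^sub>1\<close> matter.
\<close>

definition bracket_data ::
    "('g::euclidean_space \<Rightarrow> 'g \<Rightarrow> 'g) \<Rightarrow> ('g \<Rightarrow> 'g) \<Rightarrow> 'g set \<Rightarrow> (nat \<Rightarrow> 'g) \<Rightarrow>
      real \<Rightarrow> 'g \<Rightarrow> ('g \<Rightarrow> 'g) \<Rightarrow> bool" where
  "bracket_data \<mu> J \<nn> e a v A \<longleftrightarrow> (let \<nn>\<^sub>1 = \<nn> \<inter> J ` \<nn>; ad = \<mu> (e DIM('g)) in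
     v \<in> \<nn>\<^sub>1 \<and> ad (e 1) = a *\<^sub>R e 1 + v \<and>
     (\<forall>X\<in>\<nn>\<^sub>1. ad X = A X \<and> A X \<in> \<nn>\<^sub>1 \<and> A (J X) = J (A X)))"

definition trace_n1 :: "('g::euclidean_space \<Rightarrow> 'g \<Rightarrow> real) \<Rightarrow> (nat \<Rightarrow> 'g) \<Rightarrow> ('g \<Rightarrow> 'g) \<Rightarrow> real" where
  "trace_n1 g e A = (\<Sum>i = 2..DIM('g) - 1. g (A (e i)) (e i))"

end

(*
  Write D for ad e_6.  Then mu(x, y) = eps(x) D y - eps(y) D x, with D commuting with J and eps
  the e_6-coordinate.  Hence d, del and del-bar are wedge products of fixed 1-forms with the
  derivation of the exterior algebra induced by D, and the Chern-Ricci form of every Hermitian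
  metric vanishes.  The flow becomes w' = (1/2) iota_w Delta_BC(w^2), whose right-hand side is
  locally Lipschitz in the metric, so that solutions are unique by Gronwall's inequality.

  For existence take a unitary frame x1 = e_1, x2, x3 in which the complex matrix of D is upper
  triangular, with x1 in its kernel, eigenvalues l1, l2 with Re(l1 + l2) = 0, and off-diagonal
  entry b.  The metrics with unitary frame x1 / sqrt c, x2 / p, p (x3 - s x2) form a family that is
  invariant under the flow, which reduces to an ODE for c, p, s.  If b is nonzero, it is solved by
  quadratures in terms of z = |b|^2 + 2 k with k = |l1 - l2|^2 / 4, where b refers to the evolving
  frame: z tends to 2 k only as t tends to infinity, and p tends to infinity with z at the other
  end.  If b = 0, then c^2 = 1 + 8 (Re l1)^4 t while p and s are constant.  In both cases a finite
  lower end of the interval is a degeneration of the metric, hence the interval is maximal.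

  The derivative of c vanishes only if Re l1 = 0 and b = 0, which is also the Kaehler condition.
*)

theory Submission
  imports Defs "HOL-Library.Function_Algebras"
begin

section \<open>The algebra of forms\<close>

text \<open>Only one right-hand side is computed: that of a metric with a unitary frame in which D
  is triangular. Each metric of the invariant family has such a frame with the same eigenvalues, so
  the computation is instantiated again at every time. The parameter \<delta> = \<epsilon>(J x1)
  exists for this: dividing x1 by sqrt c turns it from 1 into 1 / sqrt c, and the right-hand side
  scales with \<delta>^4.

  Why three unknowns suffice: on the plane of x2 and x3 the right-hand side is trace-free, so the
  determinant of the metric there stays 1, which leaves p and a complex shift. With a = (l1 - l2) /
  2 the shift keeps the direction of conj(a) b, and b is only multiplied by real factors. Thus the
  shift has one real unknown s, and |b|^2 determines the course of the others.

  The obstacle in the uniqueness proof is that the flow is defined through an arbitrary choice (the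
  orthonormal basis in the Hodge star) and a definite description (\<open>iota\<close>), neither
  visibly continuous in the metric. Both are first replaced by formulas in the inverse
  metric.\<close>

definition contr :: "'g \<Rightarrow> 'g form \<Rightarrow> 'g form" where
  "contr x \<alpha> = (\<lambda>xs. \<alpha> (x # xs))"

definition fscale :: "complex \<Rightarrow> 'g form \<Rightarrow> 'g form" (infixr "\<cdot>" 72) where
  "c \<cdot> \<alpha> = (\<lambda>xs. c * \<alpha> xs)"

text \<open>The grading involution. It carries the Leibniz sign, so that product rules hold for
  inhomogeneous forms without degree hypotheses.\<close>

definition gsgn :: "'g form \<Rightarrow> 'g form" where
  "gsgn \<alpha> = (\<lambda>xs. (- 1) ^ length xs * \<alpha> xs)"

definition unit_form :: "'g form" where
  "unit_form = (\<lambda>xs. if xs = [] then 1 else 0)"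

definition one_form :: "('g \<Rightarrow> complex) \<Rightarrow> 'g form" where
  "one_form \<theta> = (\<lambda>xs. case xs of [x] \<Rightarrow> \<theta> x | _ \<Rightarrow> 0)"

lemma contr_apply: "contr x \<alpha> xs = \<alpha> (x # xs)"
  by (simp add: contr_def)

lemma fscale_simps [simp]:
  "c \<cdot> (\<alpha> + \<beta>) = c \<cdot> \<alpha> + c \<cdot> \<beta>" "c \<cdot> (\<alpha> - \<beta>) = c \<cdot> \<alpha> - c \<cdot> \<beta>" "c \<cdot> (- \<alpha>) = - (c \<cdot> \<alpha>)"
  "c \<cdot> 0 = (0 :: 'g form)" "0 \<cdot> \<alpha> = 0" "1 \<cdot> \<alpha> = \<alpha>" "c \<cdot> d \<cdot> \<alpha> = (c * d) \<cdot> \<alpha>"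
  "(- c) \<cdot> \<alpha> = - (c \<cdot> \<alpha>)"
  by (auto simp: fscale_def fun_eq_iff algebra_simps)

lemma fscale_add_left: "(c + d) \<cdot> \<alpha> = c \<cdot> \<alpha> + d \<cdot> \<alpha>"
  by (auto simp: fscale_def fun_eq_iff algebra_simps)

lemma fscale_apply: "(c \<cdot> \<alpha>) xs = c * \<alpha> xs"
  by (simp add: fscale_def)

lemma contr_simps [simp]:
  "contr x (\<alpha> + \<beta>) = contr x \<alpha> + contr x \<beta>" "contr x (\<alpha> - \<beta>) = contr x \<alpha> - contr x \<beta>"
  "contr x (- \<alpha>) = - contr x \<alpha>" "contr x 0 = 0" "contr x (c \<cdot> \<alpha>) = c \<cdot> contr x \<alpha>"
  "contr x unit_form = 0" "contr x (one_form \<theta>) = \<theta> x \<cdot> unit_form"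
  "contr x (gsgn \<alpha>) = - gsgn (contr x \<alpha>)"
  by (auto simp: contr_def fun_eq_iff unit_form_def one_form_def gsgn_def fscale_def split: list.split)

lemma gsgn_simps [simp]:
  "gsgn (\<alpha> + \<beta>) = gsgn \<alpha> + gsgn \<beta>" "gsgn (\<alpha> - \<beta>) = gsgn \<alpha> - gsgn \<beta>" "gsgn (- \<alpha>) = - gsgn \<alpha>"
  "gsgn 0 = (0 :: 'g form)" "gsgn (c \<cdot> \<alpha>) = c \<cdot> gsgn \<alpha>" "gsgn (gsgn \<alpha>) = \<alpha>"
  "gsgn unit_form = unit_form" "gsgn (one_form \<theta>) = - one_form \<theta>"
  by (auto simp: fun_eq_iff gsgn_def fscale_def algebra_simps unit_form_def one_form_def
      simp flip: power_mult_distrib split: list.split)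

text \<open>The subsets split by whether they contain index 0, that is, by where the first argument
  goes. The recursions in the argument list below (\<open>contr_wedge\<close>,
  \<open>form_cx_Cons\<close>, \<open>bidegree_Cons\<close>, \<open>hsum_Cons\<close>) rest on
  this.\<close>

lemma sum_Pow_lessThan_Suc:
  fixes f :: "nat set \<Rightarrow> 'b::comm_monoid_add"
  shows "(\<Sum>S\<in>Pow {..<Suc n}. f S) =
    (\<Sum>S\<in>Pow {..<n}. f (insert 0 (Suc ` S))) + (\<Sum>S\<in>Pow {..<n}. f (Suc ` S))"
proof -
  have "Pow {..<Suc n} = (\<lambda>S. insert 0 (Suc ` S)) ` Pow {..<n} \<union> (`) Suc ` Pow {..<n}"
    by (simp only: lessThan_Suc_eq_insert_0 Pow_insert image_Pow_surj[OF refl, of Suc, symmetric]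
        image_image Un_commute)
  moreover have "inj_on (\<lambda>S. insert 0 (Suc ` S)) (Pow {..<n})"
    by (rule inj_onI) (metis Diff_insert_absorb imageE inj_Suc inj_image_eq_iff nat.distinct(1))
  moreover have "inj_on ((`) Suc) (Pow {..<n})"
    by (simp add: inj_image_eq_iff inj_on_def)
  ultimately show ?thesis
    by (simp only:) (subst sum.union_disjoint, auto simp: sum.reindex)
qed

text \<open>Index 0 in the first block is out of order with nothing, so the inversions are the old
  ones shifted.\<close>

lemma shuffle_sign_insert:
  assumes "S \<subseteq> {..<n}"
  shows "shuffle_sign (Suc n) (insert 0 (Suc ` S)) = shuffle_sign n S"
proof -
  have "{(i, j). i \<in> insert 0 (Suc ` S) \<and> j \<in> {..<Suc n} - insert 0 (Suc ` S) \<and> j < i}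
    = map_prod Suc Suc ` {(i, j). i \<in> S \<and> j \<in> {..<n} - S \<and> j < i}"
    by (auto simp: image_iff less_Suc_eq_0_disj)
  then show ?thesis
    unfolding shuffle_sign_def by (simp add: card_image inj_on_def map_prod_def split_beta)
qed

text \<open>Index 0 in the second block is inverted with each element of \<open>S\<close>, which
  costs \<open>card S\<close> sign changes.\<close>

lemma shuffle_sign_Suc:
  assumes "S \<subseteq> {..<n}"
  shows "shuffle_sign (Suc n) (Suc ` S) = (- 1) ^ card S * shuffle_sign n S"
proof -
  let ?A = "{(i, j). i \<in> S \<and> j \<in> {..<n} - S \<and> j < i}"
  have fin: "finite S" using assms finite_subset by blast
  have "{(i, j). i \<in> Suc ` S \<and> j \<in> {..<Suc n} - Suc ` S \<and> j < i}
    = map_prod Suc Suc ` ?A \<union> (\<lambda>i. (Suc i, 0)) ` S"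
    by (auto simp: image_iff less_Suc_eq_0_disj)
  moreover have "finite ?A"
    by (rule finite_subset[of _ "S \<times> {..<n}"]) (use fin in auto)
  ultimately have "card {(i, j). i \<in> Suc ` S \<and> j \<in> {..<Suc n} - Suc ` S \<and> j < i} = card ?A + card S"
    by (simp only:) (subst card_Un_disjoint, use fin in \<open>auto simp: card_image inj_on_def map_prod_def\<close>)
  then show ?thesis
    unfolding shuffle_sign_def by (simp add: power_add)
qed

lemma length_nths_subset: "S \<subseteq> {..<length xs} \<Longrightarrow> length (nths xs S) = card S"
  by (simp add: length_nths) (metis (no_types, lifting) Collect_mem_eq Int_absorb2 Int_def lessThan_iff mem_Collect_eq subset_eq Collect_cong)

lemma wedge_Nil [simp]: "(\<alpha> \<^bold>\<and> \<beta>) [] = \<alpha> [] * \<beta> []"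
  by (simp add: wedge_def shuffle_sign_def)

lemma Diff_Suc_image:
  "{j. Suc j \<in> {..<Suc n} - insert 0 (Suc ` S)} = {..<n} - S"
  "{j. Suc j \<in> {..<Suc n} - Suc ` S} = {..<n} - S"
  "{j. Suc j \<in> insert 0 (Suc ` S)} = S"
  by auto

text \<open>Contraction is an antiderivation. From here on this replaces the shuffle definition: an
  identity between forms is proved by induction on the argument list, for all forms at once, by
  contracting with the head.\<close>

lemma contr_wedge [simp]: "contr x (\<alpha> \<^bold>\<and> \<beta>) = contr x \<alpha> \<^bold>\<and> \<beta> + gsgn \<alpha> \<^bold>\<and> contr x \<beta>"
proof (rule ext)
  fix xs :: "'a list"
  let ?n = "length xs"
  have "(\<Sum>S\<in>Pow {..<?n}. shuffle_sign (Suc ?n) (insert 0 (Suc ` S)) * \<alpha> (nths (x # xs) (insert 0 (Suc ` S)))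
      * \<beta> (nths (x # xs) ({..<Suc ?n} - insert 0 (Suc ` S)))) = (contr x \<alpha> \<^bold>\<and> \<beta>) xs"
    unfolding wedge_def
    by (rule sum.cong) (auto simp: shuffle_sign_insert nths_Cons contr_def Diff_Suc_image simp del: Diff_iff insert_iff)
  moreover have "(\<Sum>S\<in>Pow {..<?n}. shuffle_sign (Suc ?n) (Suc ` S) * \<alpha> (nths (x # xs) (Suc ` S))
      * \<beta> (nths (x # xs) ({..<Suc ?n} - Suc ` S))) = (gsgn \<alpha> \<^bold>\<and> contr x \<beta>) xs"
    unfolding wedge_def
    by (rule sum.cong) (auto simp: shuffle_sign_Suc nths_Cons contr_def gsgn_def length_nths_subset Diff_Suc_image inj_image_mem_iff simp del: Diff_iff insert_iff)
  ultimately show "contr x (\<alpha> \<^bold>\<and> \<beta>) xs = (contr x \<alpha> \<^bold>\<and> \<beta> + gsgn \<alpha> \<^bold>\<and> contr x \<beta>) xs"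
    by (simp add: contr_def wedge_def sum_Pow_lessThan_Suc plus_fun_def)
qed

lemma wedge_Cons: "(\<alpha> \<^bold>\<and> \<beta>) (x # xs) = (contr x \<alpha> \<^bold>\<and> \<beta>) xs + (gsgn \<alpha> \<^bold>\<and> contr x \<beta>) xs"
  using contr_wedge[of x \<alpha> \<beta>] by (metis contr_apply plus_fun_apply)

lemma wedge_linear [simp]:
  "(\<alpha> + \<alpha>') \<^bold>\<and> \<beta> = \<alpha> \<^bold>\<and> \<beta> + \<alpha>' \<^bold>\<and> \<beta>" "(\<alpha> - \<alpha>') \<^bold>\<and> \<beta> = \<alpha> \<^bold>\<and> \<beta> - \<alpha>' \<^bold>\<and> \<beta>" "(- \<alpha>) \<^bold>\<and> \<beta> = - (\<alpha> \<^bold>\<and> \<beta>)"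
  "(c \<cdot> \<alpha>) \<^bold>\<and> \<beta> = c \<cdot> (\<alpha> \<^bold>\<and> \<beta>)" "(0 :: 'g form) \<^bold>\<and> \<beta> = 0"
  "\<alpha> \<^bold>\<and> (\<beta> + \<beta>') = \<alpha> \<^bold>\<and> \<beta> + \<alpha> \<^bold>\<and> \<beta>'" "\<alpha> \<^bold>\<and> (\<beta> - \<beta>') = \<alpha> \<^bold>\<and> \<beta> - \<alpha> \<^bold>\<and> \<beta>'" "\<alpha> \<^bold>\<and> (- \<beta>) = - (\<alpha> \<^bold>\<and> \<beta>)"
  "\<alpha> \<^bold>\<and> (c \<cdot> \<beta>) = c \<cdot> (\<alpha> \<^bold>\<and> \<beta>)" "\<alpha> \<^bold>\<and> (0 :: 'g form) = 0"
  by (auto simp: wedge_def fun_eq_iff fscale_def algebra_simps sum.distrib sum_subtractf sum_negf sum_distrib_left)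

lemma wedge_unit [simp]: "unit_form \<^bold>\<and> \<beta> = \<beta>" "\<alpha> \<^bold>\<and> unit_form = \<alpha>"
proof -
  have "(unit_form \<^bold>\<and> \<beta>) xs = \<beta> xs" for xs
    by (induction xs arbitrary: \<beta>) (simp_all add: wedge_Cons, simp_all add: unit_form_def contr_apply)
  moreover have "(\<alpha> \<^bold>\<and> unit_form) xs = \<alpha> xs" for xs
    by (induction xs arbitrary: \<alpha>) (simp_all add: wedge_Cons, simp_all add: unit_form_def contr_apply)
  ultimately show "unit_form \<^bold>\<and> \<beta> = \<beta>" "\<alpha> \<^bold>\<and> unit_form = \<alpha>" by auto
qed

lemma gsgn_wedge [simp]: "gsgn (\<alpha> \<^bold>\<and> \<beta>) = gsgn \<alpha> \<^bold>\<and> gsgn \<beta>"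
proof -
  have "gsgn (\<alpha> \<^bold>\<and> \<beta>) xs = (gsgn \<alpha> \<^bold>\<and> gsgn \<beta>) xs" for xs
  proof (induction xs arbitrary: \<alpha> \<beta>)
    case (Cons x xs)
    have "gsgn (\<alpha> \<^bold>\<and> \<beta>) (x # xs) = - gsgn (contr x (\<alpha> \<^bold>\<and> \<beta>)) xs"
      by (simp only: gsgn_def contr_apply) simp
    also have "\<dots> = contr x (gsgn \<alpha> \<^bold>\<and> gsgn \<beta>) xs"
      using Cons by simp
    finally show ?case by (simp only: contr_apply)
  qed (simp add: gsgn_def)
  then show ?thesis by auto
qed

lemma wedge_assoc [simp]: "(\<alpha> \<^bold>\<and> \<beta>) \<^bold>\<and> \<gamma> = \<alpha> \<^bold>\<and> \<beta> \<^bold>\<and> \<gamma>"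
proof -
  have "((\<alpha> \<^bold>\<and> \<beta>) \<^bold>\<and> \<gamma>) xs = (\<alpha> \<^bold>\<and> \<beta> \<^bold>\<and> \<gamma>) xs" for xs
    by (induction xs arbitrary: \<alpha> \<beta> \<gamma>) (simp_all add: wedge_Cons)
  then show ?thesis by auto
qed

text \<open>Graded commutativity with a 1-form is enough, because later one of the factors to be
  moved is always a polynomial in 1-forms.\<close>

lemma wedge_one_form_commute: "\<beta> \<^bold>\<and> one_form \<theta> = one_form \<theta> \<^bold>\<and> gsgn \<beta>"
proof -
  have "(\<beta> \<^bold>\<and> one_form \<theta>) xs = (one_form \<theta> \<^bold>\<and> gsgn \<beta>) xs" for xs
  proof (induction xs arbitrary: \<beta>)
    case (Cons x xs)
    then show ?case by (simp add: wedge_Cons)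
  qed (simp add: gsgn_def one_form_def)
  then show ?thesis by auto
qed

lemma one_form_swap: "one_form \<phi> \<^bold>\<and> one_form \<theta> = - (one_form \<theta> \<^bold>\<and> one_form \<phi>)"
  using wedge_one_form_commute[of "one_form \<phi>" \<theta>] by simp

lemma one_form_swap': "one_form \<phi> \<^bold>\<and> one_form \<theta> \<^bold>\<and> \<beta> = - (one_form \<theta> \<^bold>\<and> one_form \<phi> \<^bold>\<and> \<beta>)"
  using one_form_swap[of \<phi> \<theta>] by (metis wedge_assoc wedge_linear(3))

lemma neg_eq_self_form: "(\<alpha> :: 'g form) = - \<alpha> \<longleftrightarrow> \<alpha> = 0"
  by (auto simp: fun_eq_iff)

lemma one_form_square [simp]: "one_form \<theta> \<^bold>\<and> one_form \<theta> = 0" "one_form \<theta> \<^bold>\<and> one_form \<theta> \<^bold>\<and> \<beta> = 0"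
  using one_form_swap[of \<theta> \<theta>] one_form_swap'[of \<theta> \<theta> \<beta>] by (simp_all add: neg_eq_self_form)

lemma one_form_linear:
  "one_form (\<lambda>x. \<theta> x + \<phi> x) = one_form \<theta> + one_form \<phi>"
  "one_form (\<lambda>x. \<theta> x - \<phi> x) = one_form \<theta> - one_form \<phi>"
  "one_form (\<lambda>x. c * \<theta> x) = c \<cdot> one_form \<theta>" "one_form (\<lambda>x. - \<theta> x) = - one_form \<theta>"
  "one_form (\<lambda>x. 0) = 0"
  by (auto simp: one_form_def fun_eq_iff fscale_def split: list.split)


section \<open>Alternating multilinear forms\<close>

text \<open>Alternating and multilinear in all degrees at once, phrased at arbitrary positions of
  the list. With no degree attached it passes through all operators without bookkeeping.\<close>

definition altm :: "'g::real_vector form \<Rightarrow> bool" where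
  "altm \<alpha> \<longleftrightarrow> (\<forall>xs x y ys. \<alpha> (xs @ x # y # ys) = - \<alpha> (xs @ y # x # ys)) \<and>
     (\<forall>xs ys. linear (\<lambda>x. \<alpha> (xs @ x # ys)))"

lemma altmI:
  assumes "\<And>xs x y ys. \<alpha> (xs @ x # y # ys) = - \<alpha> (xs @ y # x # ys)"
    and "\<And>xs ys. linear (\<lambda>x. \<alpha> (xs @ x # ys))"
  shows "altm \<alpha>"
  unfolding altm_def using assms by blast

lemma altm_swap_at: "altm \<alpha> \<Longrightarrow> \<alpha> (xs @ x # y # ys) = - \<alpha> (xs @ y # x # ys)"
  unfolding altm_def by blast

lemma altm_linear_at: "altm \<alpha> \<Longrightarrow> linear (\<lambda>x. \<alpha> (xs @ x # ys))"
  unfolding altm_def by blast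

lemma altm_swap: "altm \<alpha> \<Longrightarrow> \<alpha> (x # y # ys) = - \<alpha> (y # x # ys)"
  by (rule altm_swap_at[of _ "[]", unfolded append_Nil])

lemma altm_linear: "altm \<alpha> \<Longrightarrow> linear (\<lambda>x. \<alpha> (x # ys))"
  by (rule altm_linear_at[of _ "[]", unfolded append_Nil])

lemma altm_contr [simp, intro]: "altm \<alpha> \<Longrightarrow> altm (contr z \<alpha>)"
  unfolding contr_def
  by (rule altmI) (erule altm_swap_at[of _ "z # xs" for xs, unfolded append_Cons]
    altm_linear_at[of _ "z # xs" for xs, unfolded append_Cons])+

lemma altm_contr_swap: "altm \<alpha> \<Longrightarrow> contr x (contr y \<alpha>) = - contr y (contr x \<alpha>)"
  by (auto simp: contr_def fun_eq_iff intro: altm_swap)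

lemma altm_contr_same: "altm \<alpha> \<Longrightarrow> contr x (contr x \<alpha>) = 0"
  using altm_contr_swap[of \<alpha> x x] by (simp add: neg_eq_self_form)

lemma altm_contr_linear:
  assumes "altm \<alpha>"
  shows "contr (x + y) \<alpha> = contr x \<alpha> + contr y \<alpha>" "contr (x - y) \<alpha> = contr x \<alpha> - contr y \<alpha>"
    "contr (- x) \<alpha> = - contr x \<alpha>" "contr 0 \<alpha> = 0" "contr (r *\<^sub>R x) \<alpha> = complex_of_real r \<cdot> contr x \<alpha>"
  using linear_add[OF altm_linear[OF assms]] linear_diff[OF altm_linear[OF assms]]
    linear_neg[OF altm_linear[OF assms]] linear_0[OF altm_linear[OF assms]]
    linear_cmul[OF altm_linear[OF assms]]
  by (simp_all add: contr_def fun_eq_iff fscale_def scaleR_conv_of_real)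

lemma linear_complex_mult: "linear f \<Longrightarrow> linear (\<lambda>x. (c::complex) * f x)"
  by (auto simp: linear_iff algebra_simps)

lemma altm_add [simp, intro]:
  assumes "altm \<alpha>" "altm \<beta>" shows "altm (\<alpha> + \<beta>)"
proof (rule altmI)
  show "(\<alpha> + \<beta>) (xs @ x # y # ys) = - (\<alpha> + \<beta>) (xs @ y # x # ys)" for xs x y ys
    using altm_swap_at[OF assms(1), of xs x y ys] altm_swap_at[OF assms(2), of xs x y ys] by simp
  show "linear (\<lambda>x. (\<alpha> + \<beta>) (xs @ x # ys))" for xs ys
    using assms[THEN altm_linear_at] by (simp add: linear_compose_add)
qed

lemma altm_weighted:
  assumes "altm \<alpha>" shows "altm (\<lambda>xs. (c (length xs) :: complex) * \<alpha> xs)"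
proof (rule altmI)
  show "c (length (xs @ x # y # ys)) * \<alpha> (xs @ x # y # ys)
    = - (c (length (xs @ y # x # ys)) * \<alpha> (xs @ y # x # ys))" for xs x y ys
    using altm_swap_at[OF assms, of xs x y ys] by simp
  show "linear (\<lambda>x. c (length (xs @ x # ys)) * \<alpha> (xs @ x # ys))" for xs ys
    using linear_complex_mult[OF altm_linear_at[OF assms]] by simp
qed

lemma altm_scale [simp, intro]: "altm \<alpha> \<Longrightarrow> altm (c \<cdot> \<alpha>)"
  unfolding fscale_def by (rule altm_weighted)

lemma altm_gsgn [simp, intro]: "altm \<alpha> \<Longrightarrow> altm (gsgn \<alpha>)"
  unfolding gsgn_def by (rule altm_weighted)

lemma altm_uminus [simp, intro]: "altm \<alpha> \<Longrightarrow> altm (- \<alpha>)"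
  using altm_scale[of \<alpha> "- 1"] by simp

lemma altm_diff [simp, intro]: "altm \<alpha> \<Longrightarrow> altm \<beta> \<Longrightarrow> altm (\<alpha> - \<beta>)"
  using altm_add[of \<alpha> "- \<beta>"] by simp

lemma altm_unit [simp]: "altm unit_form"
  by (rule altmI) (simp_all add: unit_form_def linear_iff)

lemma altm_zero [simp]: "altm 0"
  by (rule altmI) (simp_all add: linear_iff)

lemma altm_one_form [simp, intro]: 
  assumes "linear \<theta>" shows "altm (one_form \<theta>)"
proof -
  have "linear (\<lambda>x. one_form \<theta> (xs @ x # ys))" for xs ys
    using assms by (cases xs; cases ys) (auto simp: one_form_def linear_iff split: list.split)
  then show ?thesis
    by (intro altmI) (auto simp: one_form_def split: list.split)
qed

lemma altm_wedge [simp, intro]: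
  assumes "altm \<alpha>" "altm \<beta>" shows "altm (\<alpha> \<^bold>\<and> \<beta>)"
proof -
  have "(\<alpha> \<^bold>\<and> \<beta>) (xs @ x # y # ys) = - (\<alpha> \<^bold>\<and> \<beta>) (xs @ y # x # ys)" for xs x y ys
    using assms
  proof (induction xs arbitrary: \<alpha> \<beta>)
    case Nil
    then show ?case
      by (simp add: wedge_Cons altm_contr_swap[of _ y x])
  next
    case (Cons z xs)
    then show ?case by (simp add: wedge_Cons)
  qed
  moreover have "linear (\<lambda>x. (\<alpha> \<^bold>\<and> \<beta>) (xs @ x # ys))" for xs ys
    using assms
  proof (induction xs arbitrary: \<alpha> \<beta>)
    case Nil
    then show ?case
      by (simp add: wedge_Cons linear_iff altm_contr_linear fscale_apply scaleR_conv_of_real algebra_simps)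
  next
    case (Cons z xs)
    then have "linear (\<lambda>x. (contr z \<alpha> \<^bold>\<and> \<beta>) (xs @ x # ys))" "linear (\<lambda>x. (gsgn \<alpha> \<^bold>\<and> contr z \<beta>) (xs @ x # ys))"
      by auto
    then show ?case by (simp add: wedge_Cons linear_compose_add)
  qed
  ultimately show ?thesis by (rule altmI)
qed


section \<open>Derivations and the exterior derivative\<close>

text \<open>The form is the last argument because the recursion changes it: what remains for the
  tail is the same sum for the contracted form.\<close>

primrec dactl :: "('g \<Rightarrow> 'g) \<Rightarrow> 'g list \<Rightarrow> 'g form \<Rightarrow> complex" where
  "dactl D [] \<alpha> = 0"
| "dactl D (x # xs) \<alpha> = \<alpha> (D x # xs) + dactl D xs (contr x \<alpha>)"

definition dact :: "('g \<Rightarrow> 'g) \<Rightarrow> 'g form \<Rightarrow> 'g form" where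
  "dact D \<alpha> = (\<lambda>xs. dactl D xs \<alpha>)"

lemma dact_Nil [simp]: "dact D \<alpha> [] = 0"
  by (simp add: dact_def)

lemma contr_dact [simp]: "contr x (dact D \<alpha>) = contr (D x) \<alpha> + dact D (contr x \<alpha>)"
  by (auto simp: dact_def contr_def fun_eq_iff)

lemma dact_Cons: "dact D \<alpha> (x # xs) = \<alpha> (D x # xs) + dact D (contr x \<alpha>) xs"
  by (simp add: dact_def)

lemma gsgn_apply: "gsgn \<alpha> xs = (- 1) ^ length xs * \<alpha> xs"
  by (simp add: gsgn_def)

lemma unit_form_apply: "unit_form xs = (if xs = [] then 1 else 0)"
  by (simp add: unit_form_def)

lemma dact_linear [simp]:
  "dact D (\<alpha> + \<beta>) = dact D \<alpha> + dact D \<beta>" "dact D (c \<cdot> \<alpha>) = c \<cdot> dact D \<alpha>"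
  "dact D (- \<alpha>) = - dact D \<alpha>" "dact D 0 = 0" "dact D unit_form = 0"
proof -
  have "dact D (\<alpha> + \<beta>) xs = dact D \<alpha> xs + dact D \<beta> xs" "dact D (c \<cdot> \<alpha>) xs = c * dact D \<alpha> xs"
    "dact D (- \<alpha>) xs = - dact D \<alpha> xs" for xs c and \<alpha> \<beta> :: "'a form"
    by (induction xs arbitrary: \<alpha> \<beta>) (simp_all add: dact_Cons fscale_apply algebra_simps)
  note * = this
  have z: "dact D 0 xs = 0" for xs
    using *(2)[of 0 unit_form xs] by simp
  have "dact D unit_form xs = 0" for xs
    by (cases xs) (simp_all add: dact_Cons z, simp add: unit_form_apply)
  with z * show "dact D (\<alpha> + \<beta>) = dact D \<alpha> + dact D \<beta>" "dact D (c \<cdot> \<alpha>) = c \<cdot> dact D \<alpha>"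
    "dact D (- \<alpha>) = - dact D \<alpha>" "dact D 0 = 0" "dact D unit_form = 0"
    by (simp_all add: fun_eq_iff fscale_apply)
qed

lemma dact_diff [simp]: "dact D (\<alpha> - \<beta>) = dact D \<alpha> - dact D \<beta>"
  using dact_linear(1)[of D \<alpha> "- \<beta>"] by simp

lemma dact_gsgn [simp]: "dact D (gsgn \<alpha>) = gsgn (dact D \<alpha>)"
proof -
  have "dact D (gsgn \<alpha>) xs = gsgn (dact D \<alpha>) xs" for xs
    by (induction xs arbitrary: \<alpha>) (simp_all add: dact_Cons gsgn_apply algebra_simps)
  then show ?thesis by auto
qed

lemma dact_wedge [simp]: "dact D (\<alpha> \<^bold>\<and> \<beta>) = dact D \<alpha> \<^bold>\<and> \<beta> + \<alpha> \<^bold>\<and> dact D \<beta>"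
proof -
  have "dact D (\<alpha> \<^bold>\<and> \<beta>) xs = (dact D \<alpha> \<^bold>\<and> \<beta> + \<alpha> \<^bold>\<and> dact D \<beta>) xs" for xs
    by (induction xs arbitrary: \<alpha> \<beta>) (simp_all add: dact_Cons wedge_Cons)
  then show ?thesis by auto
qed

lemma dact_one_form [simp]: "dact D (one_form \<theta>) = one_form (\<lambda>x. \<theta> (D x))"
proof (rule ext)
  show "dact D (one_form \<theta>) xs = one_form (\<lambda>x. \<theta> (D x)) xs" for xs
    by (cases xs) (simp_all add: dact_Cons, simp_all add: one_form_def split: list.split)
qed

lemma altm_dact [simp, intro]:
  assumes "linear D" "altm \<alpha>" shows "altm (dact D \<alpha>)"
proof -
  have "dact D \<alpha> (xs @ x # y # ys) = - dact D \<alpha> (xs @ y # x # ys)" for xs x y ys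
    using assms(2)
  proof (induction xs arbitrary: \<alpha>)
    case Nil
    then show ?case
      using altm_contr_swap[OF Nil, of x y] altm_swap[OF Nil, of "D x" y] altm_swap[OF Nil, of x "D y"]
      by (simp add: dact_Cons contr_apply)
  next
    case (Cons z xs)
    moreover have "\<alpha> (D z # xs @ x # y # ys) = - \<alpha> (D z # xs @ y # x # ys)"
      by (rule altm_swap_at[OF Cons.prems, of "D z # xs", unfolded append_Cons])
    ultimately show ?case by (simp add: dact_Cons)
  qed
  moreover have "linear (\<lambda>x. dact D \<alpha> (xs @ x # ys))" for xs ys
    using assms(2)
  proof (induction xs arbitrary: \<alpha>)
    case Nil
    then show ?case
      using altm_linear[OF Nil] assms(1)
      by (simp add: dact_Cons linear_iff altm_contr_linear[OF Nil] fscale_apply scaleR_conv_of_real algebra_simps)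
  next
    case (Cons z xs)
    moreover have "linear (\<lambda>x. \<alpha> (D z # xs @ x # ys))"
      by (rule altm_linear_at[OF Cons.prems, of "D z # xs", unfolded append_Cons])
    ultimately show ?case by (simp add: dact_Cons linear_compose_add)
  qed
  ultimately show ?thesis by (rule altmI)
qed

lemma one_form_wedge_eq_sum:
  "(one_form \<theta> \<^bold>\<and> \<beta>) xs = (\<Sum>j<length xs. (- 1) ^ j * \<theta> (xs ! j) * \<beta> (nths xs (- {j})))"
proof (induction xs arbitrary: \<beta>)
  case (Cons x xs)
  have "{j. Suc j \<in> - {0}} = UNIV" "\<And>i. {j. Suc j \<in> - {Suc i}} = - {i}" by auto
  then show ?case
    by (simp add: wedge_Cons fscale_apply Cons sum.lessThan_Suc_shift nths_Cons nths_all contr_apply sum_negf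
        del: sum.lessThan_Suc)
qed (simp add: one_form_def)

text \<open>Each image under \<open>D\<close> is moved to the front past the preceding arguments,
  which is where \<open>ext_d\<close> places the bracket.\<close>

lemma dact_eq_sum:
  assumes "altm \<alpha>"
  shows "dact D \<alpha> xs = (\<Sum>j<length xs. (- 1) ^ j * \<alpha> (D (xs ! j) # nths xs (- {j})))"
  using assms
proof (induction xs arbitrary: \<alpha>)
  case (Cons x xs)
  have "{j. Suc j \<in> - {0}} = UNIV" "\<And>i. {j. Suc j \<in> - {Suc i}} = - {i}" by auto
  then show ?case
    using Cons altm_swap[OF Cons.prems, of _ x]
    by (simp add: dact_Cons sum.lessThan_Suc_shift nths_Cons nths_all contr_apply
        del: sum.lessThan_Suc)
qed simp

lemma ext_d_Nil [simp]: "ext_d \<mu> \<alpha> [] = 0"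
  by (simp add: ext_d_def)

text \<open>Cartan's formula. Pairs containing index 0 give the Lie derivative along
  \<open>x\<close>, which on left-invariant forms is \<open>- dact (\<mu> x) \<alpha>\<close>; in
  the other pairs, moving \<open>x\<close> to the front past the bracket changes the sign.\<close>

lemma ext_d_Cons:
  assumes "altm \<alpha>"
  shows "ext_d \<mu> \<alpha> (x # xs) = - dact (\<mu> x) \<alpha> xs - ext_d \<mu> (contr x \<alpha>) xs"
proof -
  let ?n = "length xs" and ?P = "{(i, j). i < j \<and> j < length xs}"
  let ?f = "\<lambda>(i, j). (- 1) ^ (i + j) * \<alpha> (\<mu> ((x # xs) ! i) ((x # xs) ! j) # nths (x # xs) (- {i, j}))"
  have fin: "finite ?P"
    by (rule finite_subset[of _ "{..<?n} \<times> {..<?n}"]) auto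
  have *: "{(i, j). i < j \<and> j < length (x # xs)} = (\<lambda>j. (0, Suc j)) ` {..<?n} \<union> map_prod Suc Suc ` ?P"
  proof (intro set_eqI iffI)
    fix z assume "z \<in> {(i, j). i < j \<and> j < length (x # xs)}"
    then obtain i j where z: "z = (i, j)" "i < j" "j < Suc ?n" by auto
    then obtain j' where j: "j = Suc j'" by (cases j) auto
    show "z \<in> (\<lambda>j. (0, Suc j)) ` {..<?n} \<union> map_prod Suc Suc ` ?P"
    proof (cases i)
      case (Suc i')
      then have "z = map_prod Suc Suc (i', j')" "(i', j') \<in> ?P" using z j by auto
      then show ?thesis by blast
    qed (use z j in auto)
  qed auto
  have sets: "{k. k \<noteq> j} = - {j}" "{k. k \<noteq> i \<and> k \<noteq> j} = - {i, j}" for i j :: nat by auto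
  have "ext_d \<mu> \<alpha> (x # xs) = sum ?f ((\<lambda>j. (0, Suc j)) ` {..<?n}) + sum ?f (map_prod Suc Suc ` ?P)"
    unfolding ext_d_def * by (rule sum.union_disjoint) (use fin in auto)
  also have "sum ?f ((\<lambda>j. (0, Suc j)) ` {..<?n}) = - dact (\<mu> x) \<alpha> xs"
    by (subst sum.reindex) (auto simp: inj_on_def dact_eq_sum[OF assms] nths_Cons sets simp flip: sum_negf)
  also have "sum ?f (map_prod Suc Suc ` ?P) = - ext_d \<mu> (contr x \<alpha>) xs"
    unfolding ext_d_def sum_negf[symmetric]
    by (subst sum.reindex) (auto simp: inj_on_def nths_Cons sets contr_apply altm_swap[OF assms, of _ x] intro!: sum.cong)
  finally show ?thesis by simp
qed

text \<open>Both sides obey the same recursion: for this bracket,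
  \<open>dact (\<mu> x) \<alpha>\<close> is \<open>\<epsilon> x\<close> times
  \<open>dact D \<alpha>\<close> minus the product of \<open>\<epsilon>\<close> with the contraction
  by \<open>D x\<close>.\<close>

lemma ext_d_eq:
  assumes "altm \<alpha>" and \<mu>: "\<And>x y. \<mu> x y = \<epsilon> x *\<^sub>R D y - \<epsilon> y *\<^sub>R D x"
  shows "ext_d \<mu> \<alpha> = - (one_form (\<lambda>x. complex_of_real (\<epsilon> x)) \<^bold>\<and> dact D \<alpha>)"
proof -
  let ?e = "\<lambda>x. complex_of_real (\<epsilon> x)"
  have "ext_d \<mu> \<alpha> xs = - (one_form ?e \<^bold>\<and> dact D \<alpha>) xs" for xs
    using assms(1)
  proof (induction xs arbitrary: \<alpha>)
    case (Cons x xs)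
    have lin: "linear (\<lambda>x. \<alpha> (x # ys))" for ys using altm_linear[OF Cons.prems] .
    have "dact (\<mu> x) \<alpha> xs = ?e x * dact D \<alpha> xs - (one_form ?e \<^bold>\<and> contr (D x) \<alpha>) xs"
      unfolding dact_eq_sum[OF Cons.prems] one_form_wedge_eq_sum
      by (simp add: \<mu> linear_diff[OF lin] linear_cmul[OF lin] contr_apply scaleR_conv_of_real
          algebra_simps sum_subtractf sum_distrib_left)
    then show ?case
      by (simp add: ext_d_Cons[OF Cons.prems] Cons wedge_Cons fscale_apply)
  qed (simp add: one_form_def)
  then show ?thesis by (auto simp: fun_eq_iff)
qed

section \<open>Bidegree\<close>

definition ccontr :: "'g \<times> 'g \<Rightarrow> 'g form \<Rightarrow> 'g form" where
  "ccontr z \<alpha> = contr (fst z) \<alpha> + \<i> \<cdot> contr (snd z) \<alpha>"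

lemma form_cx_Nil [simp]: "form_cx \<alpha> [] = \<alpha> []"
  by (simp add: form_cx_def)

lemma form_cx_linear: "form_cx (\<alpha> + \<beta>) zs = form_cx \<alpha> zs + form_cx \<beta> zs"
  "form_cx (c \<cdot> \<alpha>) zs = c * form_cx \<alpha> zs"
  by (simp_all add: form_cx_def fscale_apply algebra_simps sum.distrib sum_distrib_left)

lemma form_cx_Cons: "form_cx \<alpha> (z # zs) = form_cx (ccontr z \<alpha>) zs"
proof -
  let ?n = "length zs"
  let ?v = "\<lambda>T. map (\<lambda>k. if k \<in> T then snd (zs ! k) else fst (zs ! k)) [0..<?n]"
  have "form_cx \<alpha> (z # zs) = (\<Sum>T\<in>Pow {..<?n}. \<i> ^ card (insert 0 (Suc ` T)) * \<alpha> (snd z # ?v T))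
    + (\<Sum>T\<in>Pow {..<?n}. \<i> ^ card (Suc ` T) * \<alpha> (fst z # ?v T))"
    unfolding form_cx_def length_Cons sum_Pow_lessThan_Suc
    by (simp add: map_upt_Suc inj_image_mem_iff del: upt_Suc cong: if_cong)
  also have "\<dots> = \<i> * form_cx (contr (snd z) \<alpha>) zs + form_cx (contr (fst z) \<alpha>) zs"
    unfolding form_cx_def sum_distrib_left
    by (intro arg_cong2[where f = "(+)"] sum.cong refl)
      (auto simp: contr_apply card_image card_insert_if image_iff dest: finite_subset)
  finally show ?thesis
    by (simp add: ccontr_def form_cx_linear)
qed

text \<open>The cardinality condition moves into the summand, so that the sum runs over a full power
  set and can be split by index 0.\<close>

lemma bidegree_eq_sum: "bidegree J p q \<alpha> xs = (if length xs = p + q then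
    \<Sum>S\<in>Pow {..<p + q}. if card S = p then
      form_cx \<alpha> (map (\<lambda>k. if k \<in> S then part10 J (xs ! k) else part01 J (xs ! k)) [0..<p + q]) else 0 else 0)"
proof -
  have "{S. S \<subseteq> {..<p + q} \<and> card S = p} = {S \<in> Pow {..<p + q}. card S = p}" by auto
  then show ?thesis
    unfolding bidegree_def by (simp add: sum.inter_filter del: Pow_iff)
qed

lemma bidegree_Nil: "bidegree J p q \<alpha> [] = (if p = 0 \<and> q = 0 then \<alpha> [] else 0)"
  by (simp add: bidegree_eq_sum)

text \<open>The head of the list contributes either its (1,0) or its (0,1) part. The tests for 0
  guard the truncated subtractions.\<close>

lemma bidegree_Cons: "bidegree J p q \<alpha> (x # xs) =
  (if p = 0 then 0 else bidegree J (p - 1) q (ccontr (part10 J x) \<alpha>) xs)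
  + (if q = 0 then 0 else bidegree J p (q - 1) (ccontr (part01 J x) \<alpha>) xs)"
proof (cases "Suc (length xs) = p + q")
  case True
  let ?n = "length xs"
  let ?m = "\<lambda>S. map (\<lambda>k. if k \<in> S then part10 J (xs ! k) else part01 J (xs ! k)) [0..<?n]"
  have fin: "\<And>S. S \<subseteq> {..<?n} \<Longrightarrow> finite S" by (rule finite_subset) auto
  have c: "card (insert 0 (Suc ` S)) = Suc (card S)" if "S \<subseteq> {..<?n}" for S
    using fin[OF that] by (auto simp: card_image)
  have "bidegree J p q \<alpha> (x # xs) =
     (\<Sum>S\<in>Pow {..<?n}. if Suc (card S) = p then form_cx (ccontr (part10 J x) \<alpha>) (?m S) else 0)
   + (\<Sum>S\<in>Pow {..<?n}. if card S = p then form_cx (ccontr (part01 J x) \<alpha>) (?m S) else 0)"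
    unfolding bidegree_eq_sum True[symmetric] sum_Pow_lessThan_Suc length_Cons
    by (auto intro!: arg_cong2[where f = "(+)"] sum.cong
        simp: c card_image map_upt_Suc inj_image_mem_iff form_cx_Cons simp del: upt_Suc cong: if_cong)
  also have "(\<Sum>S\<in>Pow {..<?n}. if Suc (card S) = p then form_cx (ccontr (part10 J x) \<alpha>) (?m S) else 0)
    = (if p = 0 then 0 else bidegree J (p - 1) q (ccontr (part10 J x) \<alpha>) xs)"
    using True by (cases p) (auto simp: bidegree_eq_sum cong: if_cong)
  also have "(\<Sum>S\<in>Pow {..<?n}. if card S = p then form_cx (ccontr (part01 J x) \<alpha>) (?m S) else 0)
    = (if q = 0 then 0 else bidegree J p (q - 1) (ccontr (part01 J x) \<alpha>) xs)"
  \<comment> \<open>If \<open>q\<close> is 0 then \<open>p\<close> exceeds the length of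
    \<open>xs\<close>, so no subset of the indices has \<open>p\<close> elements.\<close>
  proof (cases q)
    case 0
    have "card S \<noteq> p" if "S \<subseteq> {..<?n}" for S
      using card_mono[OF _ that] True 0 by auto
    then show ?thesis using 0 by (auto intro!: sum.neutral)
  next
    case (Suc q')
    then show ?thesis using True by (auto simp: bidegree_eq_sum cong: if_cong)
  qed
  finally show ?thesis .
qed (auto simp: bidegree_def)

lemma bidegree_linear [simp]: "bidegree J p q (\<alpha> + \<beta>) = bidegree J p q \<alpha> + bidegree J p q \<beta>"
  "bidegree J p q (c \<cdot> \<alpha>) = c \<cdot> bidegree J p q \<alpha>"
  by (auto simp: bidegree_eq_sum fun_eq_iff form_cx_linear fscale_apply sum_distrib_left
      sum.distrib[symmetric] intro!: sum.cong)

lemma bidegree_uminus [simp]: "bidegree J p q (- \<alpha>) = - bidegree J p q \<alpha>"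
  using bidegree_linear(2)[of J p q "- 1" \<alpha>] by simp

lemma bidegree_diff [simp]: "bidegree J p q (\<alpha> - \<beta>) = bidegree J p q \<alpha> - bidegree J p q \<beta>"
  using bidegree_linear(1)[of J p q \<alpha> "- \<beta>"] by simp

lemma bidegree_0 [simp]: "bidegree J p q 0 = 0"
  using bidegree_linear(2)[of J p q 0 unit_form] by simp

lemma contr_bidegree: "contr x (bidegree J p q \<alpha>) =
  (if p = 0 then 0 else bidegree J (p - 1) q (ccontr (part10 J x) \<alpha>))
  + (if q = 0 then 0 else bidegree J p (q - 1) (ccontr (part01 J x) \<alpha>))"
  by (auto simp: contr_apply bidegree_Cons fun_eq_iff)

lemma ccontr_linear [simp]: "ccontr z (\<alpha> + \<beta>) = ccontr z \<alpha> + ccontr z \<beta>"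
  "ccontr z (\<alpha> - \<beta>) = ccontr z \<alpha> - ccontr z \<beta>" "ccontr z (- \<alpha>) = - ccontr z \<alpha>"
  "ccontr z (c \<cdot> \<alpha>) = c \<cdot> ccontr z \<alpha>"  "ccontr z 0 = 0"
  by (simp_all add: ccontr_def algebra_simps)

lemma altm_ccontr [simp]: "altm \<alpha> \<Longrightarrow> altm (ccontr z \<alpha>)"
  by (simp add: ccontr_def)

lemma ccontr_swap: "altm \<alpha> \<Longrightarrow> ccontr z (ccontr w \<alpha>) = - ccontr w (ccontr z \<alpha>)"
  by (simp add: ccontr_def altm_contr_swap[of \<alpha> "fst z"] altm_contr_swap[of \<alpha> "snd z"] algebra_simps)

lemma ccontr_parts:
  assumes "altm \<alpha>"
  shows "ccontr (part10 J x) \<alpha> = (1/2) \<cdot> contr x \<alpha> - (\<i>/2) \<cdot> contr (J x) \<alpha>"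
    "ccontr (part01 J x) \<alpha> = (1/2) \<cdot> contr x \<alpha> + (\<i>/2) \<cdot> contr (J x) \<alpha>"
  by (simp_all add: ccontr_def part10_def part01_def altm_contr_linear[OF assms])

lemma altm_bidegree [simp, intro]:
  assumes "altm \<alpha>" "linear J"
  shows "altm (bidegree J p q \<alpha>)"
proof (rule altmI)
  show "bidegree J p q \<alpha> (xs @ x # y # ys) = - bidegree J p q \<alpha> (xs @ y # x # ys)" for xs x y ys
    using assms(1)
  proof (induction xs arbitrary: \<alpha> p q)
    case Nil
    then show ?case
      by (simp add: bidegree_Cons ccontr_swap[of _ _ "part10 J x"] ccontr_swap[of _ _ "part01 J x"])
  next
    case (Cons z xs)
    then show ?case by (simp add: bidegree_Cons)
  qed
  show "linear (\<lambda>x. bidegree J p q \<alpha> (xs @ x # ys))" for xs ys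
    using assms(1)
  proof (induction xs arbitrary: \<alpha> p q)
    case Nil
    show ?case
      by (simp add: bidegree_Cons linear_iff ccontr_parts[OF Nil] linear_add[OF assms(2)]
          linear_cmul[OF assms(2)] altm_contr_linear[OF Nil] fscale_apply scaleR_conv_of_real algebra_simps)
  next
    case (Cons z xs)
    then show ?case
      by (cases p; cases q) (simp_all add: bidegree_Cons linear_compose_add linear_zero)
  qed
qed

text \<open>A 1-form that behaves like this under \<open>J\<close> vanishes on (0,1) parts, so it
  uses up one of the \<open>p\<close> slots.\<close>

lemma bidegree_wedge10:
  assumes "linear \<theta>" "\<And>x. \<theta> (J x) = \<i> * \<theta> x"
  shows "bidegree J p q (one_form \<theta> \<^bold>\<and> \<beta>) = (if p = 0 then 0 else one_form \<theta> \<^bold>\<and> bidegree J (p - 1) q \<beta>)"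
proof -
  have c: "ccontr (part10 J x) (one_form \<theta> \<^bold>\<and> \<beta>) = \<theta> x \<cdot> \<beta> - one_form \<theta> \<^bold>\<and> ccontr (part10 J x) \<beta>"
    "ccontr (part01 J x) (one_form \<theta> \<^bold>\<and> \<beta>) = - (one_form \<theta> \<^bold>\<and> ccontr (part01 J x) \<beta>)" for x \<beta>
    using assms(2)[of x] linear_cmul[OF assms(1)] linear_neg[OF assms(1)]
    by (simp_all add: ccontr_def part10_def part01_def fun_eq_iff fscale_apply scaleR_conv_of_real algebra_simps)
  have "bidegree J p q (one_form \<theta> \<^bold>\<and> \<beta>) xs = (if p = 0 then 0 else one_form \<theta> \<^bold>\<and> bidegree J (p - 1) q \<beta>) xs" for xs
  proof (induction xs arbitrary: p q \<beta>)
    case Nil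
    then show ?case by (auto simp: bidegree_Nil one_form_def)
  next
    case (Cons x xs)
    then show ?case by (auto simp: bidegree_Cons c wedge_Cons contr_bidegree fscale_apply)
  qed
  then show ?thesis by auto
qed

lemma bidegree_wedge01:
  assumes "linear \<theta>" "\<And>x. \<theta> (J x) = - (\<i> * \<theta> x)"
  shows "bidegree J p q (one_form \<theta> \<^bold>\<and> \<beta>) = (if q = 0 then 0 else one_form \<theta> \<^bold>\<and> bidegree J p (q - 1) \<beta>)"
proof -
  have c: "ccontr (part01 J x) (one_form \<theta> \<^bold>\<and> \<beta>) = \<theta> x \<cdot> \<beta> - one_form \<theta> \<^bold>\<and> ccontr (part01 J x) \<beta>"
    "ccontr (part10 J x) (one_form \<theta> \<^bold>\<and> \<beta>) = - (one_form \<theta> \<^bold>\<and> ccontr (part10 J x) \<beta>)" for x \<beta>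
    using assms(2)[of x] linear_cmul[OF assms(1)] linear_neg[OF assms(1)]
    by (simp_all add: ccontr_def part10_def part01_def fun_eq_iff fscale_apply scaleR_conv_of_real algebra_simps)
  have "bidegree J p q (one_form \<theta> \<^bold>\<and> \<beta>) xs = (if q = 0 then 0 else one_form \<theta> \<^bold>\<and> bidegree J p (q - 1) \<beta>) xs" for xs
  proof (induction xs arbitrary: p q \<beta>)
    case Nil
    then show ?case by (auto simp: bidegree_Nil one_form_def)
  next
    case (Cons x xs)
    then show ?case by (auto simp: bidegree_Cons c wedge_Cons contr_bidegree fscale_apply)
  qed
  then show ?thesis by auto
qed

text \<open>\<open>J\<close> acts as i on (1,0) parts and as -i on (0,1) parts. In the combination
  of \<open>contr x\<close> and \<open>contr (J x)\<close> that makes up the contraction, one of the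
  two recursive terms therefore cancels.\<close>

lemma ccontr_bidegree:
  assumes "altm \<alpha>" "linear J" "\<And>x. J (J x) = - x"
  shows "ccontr (part10 J x) (bidegree J p q \<alpha>) = (if p = 0 then 0 else bidegree J (p - 1) q (ccontr (part10 J x) \<alpha>))"
    "ccontr (part01 J x) (bidegree J p q \<alpha>) = (if q = 0 then 0 else bidegree J p (q - 1) (ccontr (part01 J x) \<alpha>))"
proof -
  have J: "ccontr (part10 J (J x)) \<alpha> = \<i> \<cdot> ccontr (part10 J x) \<alpha>"
    "ccontr (part01 J (J x)) \<alpha> = (- \<i>) \<cdot> ccontr (part01 J x) \<alpha>"
    by (simp_all add: ccontr_parts assms altm_contr_linear[OF assms(1)] algebra_simps)
  show "ccontr (part10 J x) (bidegree J p q \<alpha>) = (if p = 0 then 0 else bidegree J (p - 1) q (ccontr (part10 J x) \<alpha>))"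
    "ccontr (part01 J x) (bidegree J p q \<alpha>) = (if q = 0 then 0 else bidegree J p (q - 1) (ccontr (part01 J x) \<alpha>))"
    unfolding ccontr_parts[OF altm_bidegree[OF assms(1,2)]] contr_bidegree J
    by (auto simp: fun_eq_iff fscale_apply)
qed

lemma bidegree_bidegree:
  assumes "altm \<alpha>" "linear J" "\<And>x. J (J x) = - x"
  shows "bidegree J p' q' (bidegree J p q \<alpha>) = (if p' = p \<and> q' = q then bidegree J p q \<alpha> else 0)"
proof -
  have "bidegree J p' q' (bidegree J p q \<alpha>) xs = (if p' = p \<and> q' = q then bidegree J p q \<alpha> xs else 0)" for xs
    using assms(1)
  proof (induction xs arbitrary: \<alpha> p q p' q')
    case (Cons x xs)
    then show ?case
      by (auto simp: bidegree_Cons[of _ _ _ "bidegree J p q \<alpha>"] ccontr_bidegree[OF _ assms(2,3)]) (auto simp: bidegree_Cons)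
  qed (auto simp: bidegree_Nil)
  then show ?thesis by auto
qed

lemma bidegree_sum:
  assumes "altm \<alpha>"
  shows "(\<Sum>p\<le>length xs. bidegree J p (length xs - p) \<alpha> xs) = \<alpha> xs"
  using assms
proof (induction xs arbitrary: \<alpha>)
  case (Cons x xs)
  let ?n = "length xs" and ?A = "ccontr (part10 J x) \<alpha>" and ?B = "ccontr (part01 J x) \<alpha>"
  have "(\<Sum>p\<le>Suc ?n. if p = 0 then 0 else bidegree J (p - 1) (Suc ?n - p) ?A xs)
    = (\<Sum>p\<le>?n. bidegree J p (?n - p) ?A xs)"
    by (subst sum.atMost_Suc_shift) simp
  moreover have "(\<Sum>p\<le>Suc ?n. if Suc ?n - p = 0 then 0 else bidegree J p (Suc ?n - p - 1) ?B xs)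
    = (\<Sum>p\<le>?n. bidegree J p (?n - p) ?B xs)"
    by (auto intro!: sum.cong simp: Suc_diff_le)
  ultimately have "(\<Sum>p\<le>length (x # xs). bidegree J p (length (x # xs) - p) \<alpha> (x # xs)) = ?A xs + ?B xs"
    using Cons by (simp only: bidegree_Cons sum.distrib length_Cons altm_ccontr)
  also have "\<dots> = \<alpha> (x # xs)"
    using Cons.prems by (simp add: ccontr_parts fscale_apply contr_apply)
  finally show ?case .
qed (simp add: bidegree_Nil)

text \<open>A map commuting with \<open>J\<close> respects the (1,0) and (0,1) parts of vectors, so
  its derivation preserves the type.\<close>

lemma dact_bidegree:
  assumes "altm \<alpha>" "linear J" "linear D" "\<And>x. D (J x) = J (D x)"
  shows "dact D (bidegree J p q \<alpha>) = bidegree J p q (dact D \<alpha>)"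
proof -
  have c: "ccontr (part10 J x) (dact D \<alpha>) = ccontr (part10 J (D x)) \<alpha> + dact D (ccontr (part10 J x) \<alpha>)"
    "ccontr (part01 J x) (dact D \<alpha>) = ccontr (part01 J (D x)) \<alpha> + dact D (ccontr (part01 J x) \<alpha>)" if "altm \<alpha>" for x \<alpha>
    using that assms(3) by (simp_all add: ccontr_parts assms(4) algebra_simps)
  have "dact D (bidegree J p q \<alpha>) xs = bidegree J p q (dact D \<alpha>) xs" for xs
    using assms(1)
  proof (induction xs arbitrary: \<alpha> p q)
    case (Cons x xs)
    then show ?case
      by (auto simp: dact_Cons bidegree_Cons[of _ _ _ "dact D \<alpha>"] c contr_bidegree) (auto simp: bidegree_Cons)
  qed (auto simp: bidegree_Nil)
  then show ?thesis by auto
qed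

lemma sum_degree_pairs:
  fixes f :: "nat \<Rightarrow> nat \<Rightarrow> complex"
  shows "(\<Sum>(p, q)\<in>{(p, q). p + q + 1 = Suc n}. f p q) = (\<Sum>p\<le>n. f p (n - p))"
  by (rule sum.reindex_bij_witness[where i = "\<lambda>p. (p, n - p)" and j = fst]) auto


section \<open>Almost abelian complex Lie algebras\<close>

text \<open>In the application \<open>\<epsilon>\<close> is the coordinate transverse to the abelian
  ideal and \<open>D\<close> is the adjoint action of e_6. That \<open>D\<close> commutes with
  \<open>J\<close> on the whole algebra, not only on the complex part of the ideal, encodes a = 0
  and v = 0.\<close>

locale almost_abelian =
  fixes \<mu> :: "'g::euclidean_space \<Rightarrow> 'g \<Rightarrow> 'g" and J D :: "'g \<Rightarrow> 'g" and \<epsilon> :: "'g \<Rightarrow> real"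
  assumes J: "linear J" "J (J x) = - x"
    and D: "linear D" "D (J x) = J (D x)"
    and \<epsilon>: "linear \<epsilon>" "\<epsilon> (D x) = 0"
    and \<mu>: "\<mu> x y = \<epsilon> x *\<^sub>R D y - \<epsilon> y *\<^sub>R D x"
begin

text \<open>\<open>\<theta>\<close> has type (1,0), its conjugate \<open>\<theta>'\<close> has type
  (0,1), and \<open>- \<epsilon>\<close> is i/2 times their difference. This splits d into its two
  types.\<close>

definition \<theta> :: "'g form" where
  "\<theta> = one_form (\<lambda>x. complex_of_real (\<epsilon> (J x)) + \<i> * complex_of_real (\<epsilon> x))"

definition \<theta>' :: "'g form" where
  "\<theta>' = one_form (\<lambda>x. complex_of_real (\<epsilon> (J x)) - \<i> * complex_of_real (\<epsilon> x))"

lemma linear_\<epsilon>: "linear (\<lambda>x. complex_of_real (\<epsilon> x))" "linear (\<lambda>x. complex_of_real (\<epsilon> (J x)))"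
  using \<epsilon>(1) J(1) by (simp_all add: linear_iff scaleR_conv_of_real)

lemma linear_\<theta>: "linear (\<lambda>x. complex_of_real (\<epsilon> (J x)) + \<i> * complex_of_real (\<epsilon> x))"
  "linear (\<lambda>x. complex_of_real (\<epsilon> (J x)) - \<i> * complex_of_real (\<epsilon> x))"
  by (intro linear_compose_add linear_compose_sub linear_complex_mult linear_\<epsilon>)+

lemma altm_\<theta> [simp]: "altm \<theta>" "altm \<theta>'"
  unfolding \<theta>_def \<theta>'_def using linear_\<theta> by auto

lemma \<epsilon>_eq: "- one_form (\<lambda>x. complex_of_real (\<epsilon> x)) = (\<i>/2) \<cdot> \<theta> - (\<i>/2) \<cdot> \<theta>'"
  by (auto simp: \<theta>_def \<theta>'_def fun_eq_iff fscale_apply one_form_def field_simps split: list.split)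

lemma dact_\<theta> [simp]: "dact D \<theta> = 0" "dact D \<theta>' = 0"
proof -
  have "\<epsilon> (J (D x)) = 0" for x
    using \<epsilon>(2)[of "J x"] by (simp add: D)
  then show "dact D \<theta> = 0" "dact D \<theta>' = 0"
    by (simp_all add: \<theta>_def \<theta>'_def \<epsilon>(2) one_form_linear)
qed

lemma ext_d_split:
  assumes "altm \<alpha>"
  shows "ext_d \<mu> \<alpha> = (\<i>/2) \<cdot> (\<theta> \<^bold>\<and> dact D \<alpha>) - (\<i>/2) \<cdot> (\<theta>' \<^bold>\<and> dact D \<alpha>)"
proof -
  have "ext_d \<mu> \<alpha> = (- one_form (\<lambda>x. complex_of_real (\<epsilon> x))) \<^bold>\<and> dact D \<alpha>"
    using ext_d_eq[of \<alpha> \<mu> \<epsilon> D, OF assms \<mu>] by simp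
  then show ?thesis unfolding \<epsilon>_eq by simp
qed

lemma bidegree_\<theta>: "bidegree J p q (\<theta> \<^bold>\<and> \<beta>) = (if p = 0 then 0 else \<theta> \<^bold>\<and> bidegree J (p - 1) q \<beta>)"
  "bidegree J p q (\<theta>' \<^bold>\<and> \<beta>) = (if q = 0 then 0 else \<theta>' \<^bold>\<and> bidegree J p (q - 1) \<beta>)"
  unfolding \<theta>_def \<theta>'_def
  by (rule bidegree_wedge10 bidegree_wedge01, rule linear_\<theta>,
      simp add: J linear_neg[OF \<epsilon>(1)] algebra_simps)+

lemma bidegree_ext_d:
  assumes "altm \<alpha>"
  shows "bidegree J p' q' (ext_d \<mu> (bidegree J p q \<alpha>)) =
    (if p' = Suc p \<and> q' = q then (\<i>/2) \<cdot> (\<theta> \<^bold>\<and> bidegree J p q (dact D \<alpha>)) else 0)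
    - (if p' = p \<and> q' = Suc q then (\<i>/2) \<cdot> (\<theta>' \<^bold>\<and> bidegree J p q (dact D \<alpha>)) else 0)"
  using assms D(1) J(1)
  by (auto simp: ext_d_split dact_bidegree[OF assms J(1) D] bidegree_\<theta> bidegree_bidegree[OF _ J])

text \<open>The components of fixed total degree add up to the form only on lists of that length. A
  product with a 1-form evaluates its other factor just on lists shorter by one, so this is
  enough.\<close>

lemma wedge_one_form_cong:
  assumes "\<And>ys. Suc (length ys) = length xs \<Longrightarrow> \<beta> ys = \<beta>' ys"
  shows "(one_form \<phi> \<^bold>\<and> \<beta>) xs = (one_form \<phi> \<^bold>\<and> \<beta>') xs"
  unfolding one_form_wedge_eq_sum
proof (rule sum.cong)
  fix j assume "j \<in> {..<length xs}"
  then have "{i. i < length xs \<and> i \<in> - {j}} = {..<length xs} - {j}" "j < length xs" by auto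
  then have "Suc (length (nths xs (- {j}))) = length xs" by (simp add: length_nths)
  then show "(- 1) ^ j * \<phi> (xs ! j) * \<beta> (nths xs (- {j})) = (- 1) ^ j * \<phi> (xs ! j) * \<beta>' (nths xs (- {j}))"
    using assms by simp
qed simp

text \<open>On each (p, q) component the projection selects the \<open>\<theta>\<close> half of d,
  and the components then recombine.\<close>

lemma del_eq:
  assumes "altm \<alpha>"
  shows "del \<mu> J \<alpha> = (\<i>/2) \<cdot> (\<theta> \<^bold>\<and> dact D \<alpha>)"
proof (rule ext)
  fix xs :: "'g list"
  show "del \<mu> J \<alpha> xs = ((\<i>/2) \<cdot> (\<theta> \<^bold>\<and> dact D \<alpha>)) xs"
  proof (cases xs)
    case Nil
    then show ?thesis by (simp add: del_def fscale_apply \<theta>_def one_form_def)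
  next
    case (Cons x ys)
    let ?n = "length ys" and ?b = "\<lambda>p. bidegree J p (length ys - p) (dact D \<alpha>)"
    have "del \<mu> J \<alpha> xs = (\<Sum>p\<le>?n. bidegree J (p + 1) (?n - p) (ext_d \<mu> (bidegree J p (?n - p) \<alpha>)) xs)"
      by (simp only: del_def Cons length_Cons sum_degree_pairs)
    also have "\<dots> = (\<Sum>p\<le>?n. (\<i>/2) * (\<theta> \<^bold>\<and> ?b p) xs)"
      by (simp add: bidegree_ext_d[OF assms] fscale_apply)
    also have "\<dots> = (\<i>/2) * (\<theta> \<^bold>\<and> (\<lambda>zs. \<Sum>p\<le>?n. ?b p zs)) xs"
      by (simp add: wedge_def sum_distrib_left sum.swap[of _ "Pow _"])
    also have "\<dots> = (\<i>/2) * (\<theta> \<^bold>\<and> dact D \<alpha>) xs"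
      unfolding \<theta>_def
      by (intro arg_cong2[where f = "(*)"] refl wedge_one_form_cong)
        (metis Cons altm_dact assms D(1) bidegree_sum length_Cons nat.inject)
    finally show ?thesis by (simp add: fscale_apply)
  qed
qed

lemma delbar_eq:
  assumes "altm \<alpha>"
  shows "delbar \<mu> J \<alpha> = - ((\<i>/2) \<cdot> (\<theta>' \<^bold>\<and> dact D \<alpha>))"
proof (rule ext)
  fix xs :: "'g list"
  show "delbar \<mu> J \<alpha> xs = (- ((\<i>/2) \<cdot> (\<theta>' \<^bold>\<and> dact D \<alpha>))) xs"
  proof (cases xs)
    case Nil
    then show ?thesis by (simp add: delbar_def fscale_apply \<theta>'_def one_form_def)
  next
    case (Cons x ys)
    let ?n = "length ys" and ?b = "\<lambda>p. bidegree J p (length ys - p) (dact D \<alpha>)"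
    have "delbar \<mu> J \<alpha> xs = (\<Sum>p\<le>?n. bidegree J p (?n - p + 1) (ext_d \<mu> (bidegree J p (?n - p) \<alpha>)) xs)"
      by (simp only: delbar_def Cons length_Cons sum_degree_pairs)
    also have "\<dots> = - (\<Sum>p\<le>?n. (\<i>/2) * (\<theta>' \<^bold>\<and> ?b p) xs)"
      by (simp add: bidegree_ext_d[OF assms] fscale_apply sum_negf)
    also have "(\<Sum>p\<le>?n. (\<i>/2) * (\<theta>' \<^bold>\<and> ?b p) xs) = (\<i>/2) * (\<theta>' \<^bold>\<and> (\<lambda>zs. \<Sum>p\<le>?n. ?b p zs)) xs"
      by (simp add: wedge_def sum_distrib_left sum.swap[of _ "Pow _"])
    also have "\<dots> = (\<i>/2) * (\<theta>' \<^bold>\<and> dact D \<alpha>) xs"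
      unfolding \<theta>'_def
      by (intro arg_cong2[where f = "(*)"] refl wedge_one_form_cong)
        (metis Cons altm_dact assms D(1) bidegree_sum length_Cons nat.inject)
    finally show ?thesis by (simp add: fscale_apply)
  qed
qed

end


section \<open>Hodge star\<close>

text \<open>The Hodge star with the orthonormal list and the volume form as free parameters, because
  both change in the recursion over the list.\<close>

definition hsum :: "'g list \<Rightarrow> 'g form \<Rightarrow> 'g form \<Rightarrow> 'g form" where
  "hsum es \<beta> \<gamma> = (\<lambda>xs. \<Sum>S\<in>Pow {..<length es}. \<beta> (nths es S) * \<gamma> (nths es S @ xs))"

text \<open>For an orthonormal basis this is contraction with the metric dual of
  \<open>\<phi>\<close>.\<close>

primrec sharp_contr :: "'g list \<Rightarrow> ('g \<Rightarrow> complex) \<Rightarrow> 'g form \<Rightarrow> 'g form" where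
  "sharp_contr [] \<phi> \<gamma> = 0"
| "sharp_contr (e # es) \<phi> \<gamma> = \<phi> e \<cdot> contr e \<gamma> + sharp_contr es \<phi> \<gamma>"

lemma hsum_Nil: "hsum [] \<beta> \<gamma> = \<beta> [] \<cdot> \<gamma>"
  by (simp add: hsum_def fscale_def)

lemma hsum_Cons: "hsum (e # es) \<beta> \<gamma> = hsum es (contr e \<beta>) (contr e \<gamma>) + hsum es \<beta> \<gamma>"
  unfolding hsum_def length_Cons sum_Pow_lessThan_Suc
  by (simp add: fun_eq_iff nths_Cons contr_apply inj_image_mem_iff Diff_Suc_image image_iff)

lemma hsum_linear [simp]:
  "hsum es (\<beta> + \<beta>') \<gamma> = hsum es \<beta> \<gamma> + hsum es \<beta>' \<gamma>" "hsum es (\<beta> - \<beta>') \<gamma> = hsum es \<beta> \<gamma> - hsum es \<beta>' \<gamma>"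
  "hsum es (- \<beta>) \<gamma> = - hsum es \<beta> \<gamma>" "hsum es (c \<cdot> \<beta>) \<gamma> = c \<cdot> hsum es \<beta> \<gamma>" "hsum es 0 \<gamma> = 0"
  "hsum es \<beta> (\<gamma> + \<gamma>') = hsum es \<beta> \<gamma> + hsum es \<beta> \<gamma>'" "hsum es \<beta> (c \<cdot> \<gamma>) = c \<cdot> hsum es \<beta> \<gamma>"
  "hsum es \<beta> (- \<gamma>) = - hsum es \<beta> \<gamma>" "hsum es \<beta> 0 = 0"
  by (auto simp: hsum_def fun_eq_iff fscale_apply algebra_simps sum.distrib sum_subtractf sum_negf sum_distrib_left)

lemma sharp_contr_linear [simp]:
  "sharp_contr es \<phi> (\<gamma> + \<gamma>') = sharp_contr es \<phi> \<gamma> + sharp_contr es \<phi> \<gamma>'"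
  "sharp_contr es \<phi> (c \<cdot> \<gamma>) = c \<cdot> sharp_contr es \<phi> \<gamma>" "sharp_contr es \<phi> (- \<gamma>) = - sharp_contr es \<phi> \<gamma>"
  by (induction es) (simp_all add: algebra_simps)

lemma contr_sharp_contr: "altm \<gamma> \<Longrightarrow> contr x (sharp_contr es \<phi> \<gamma>) = - sharp_contr es \<phi> (contr x \<gamma>)"
  by (induction es) (simp_all add: altm_contr_swap[of \<gamma> x])

text \<open>A 1-form factor turns into a contraction of the volume form; terms contracted twice with
  the same \<open>e\<close> vanish by alternation. The star of a product of 1-forms can thus be
  computed without knowing the orthonormal basis.\<close>

lemma hsum_wedge:
  assumes "altm \<gamma>"
  shows "hsum es (one_form \<phi> \<^bold>\<and> \<beta>) \<gamma> = hsum es \<beta> (sharp_contr es \<phi> \<gamma>)"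
  using assms
proof (induction es arbitrary: \<beta> \<gamma>)
  case Nil
  then show ?case by (simp add: hsum_Nil one_form_def fscale_apply)
next
  case (Cons e es)
  then show ?case
    by (simp add: hsum_Cons contr_sharp_contr altm_contr_same del: plus_fun_apply minus_apply)
qed

lemma hsum_unit [simp]: "hsum es unit_form \<gamma> = \<gamma>"
proof (induction es arbitrary: \<gamma>)
  case Nil
  show ?case by (simp add: hsum_Nil unit_form_def)
next
  case (Cons e es)
  then show ?case by (simp add: hsum_Cons)
qed

lemma hsum_one_form: "altm \<gamma> \<Longrightarrow> hsum es (one_form \<phi>) \<gamma> = sharp_contr es \<phi> \<gamma>"
  using hsum_wedge[of \<gamma> es \<phi> unit_form] by simp

lemma altm_sum: "(\<And>i. i \<in> A \<Longrightarrow> altm (f i)) \<Longrightarrow> altm (\<lambda>xs. \<Sum>i\<in>A. f i xs)"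
proof (induction A rule: infinite_finite_induct)
  case (insert a A)
  then have "altm (f a + (\<lambda>xs. \<Sum>i\<in>A. f i xs))" by (intro altm_add) auto
  then show ?case using insert by (simp add: func_plus)
qed (use altm_zero in \<open>simp_all add: func_zero\<close>)

lemma altm_append: "altm \<gamma> \<Longrightarrow> altm (\<lambda>xs. \<gamma> (ys @ xs))"
proof (induction ys arbitrary: \<gamma>)
  case (Cons y ys)
  then have "altm (\<lambda>xs. contr y \<gamma> (ys @ xs))" by blast
  then show ?case by (simp add: contr_apply)
qed simp

lemma altm_hsum [simp, intro]: "altm \<gamma> \<Longrightarrow> altm (hsum es \<beta> \<gamma>)"
  unfolding hsum_def using altm_append altm_scale[unfolded fscale_def] by (intro altm_sum) blast


section \<open>Forms are determined by their values on a basis\<close>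

text \<open>Vanishing on all sublists of \<open>es\<close>, which hold all components of an
  alternating form. For a frame of six vectors it unfolds to 64 scalar equations; identities of
  forms are later left to the simplifier in this shape.\<close>

primrec vanishes_on :: "'g list \<Rightarrow> 'g form \<Rightarrow> bool" where
  "vanishes_on [] \<alpha> \<longleftrightarrow> \<alpha> [] = 0"
| "vanishes_on (e # es) \<alpha> \<longleftrightarrow> vanishes_on es \<alpha> \<and> vanishes_on es (contr e \<alpha>)"

lemma vanishes_on_linear:
  "vanishes_on es \<alpha> \<Longrightarrow> vanishes_on es \<beta> \<Longrightarrow> vanishes_on es (\<alpha> + \<beta>)"
  "vanishes_on es \<alpha> \<Longrightarrow> vanishes_on es (c \<cdot> \<alpha>)" "vanishes_on es \<alpha> \<Longrightarrow> vanishes_on es (- \<alpha>)" "vanishes_on es 0"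
  by (induction es arbitrary: \<alpha> \<beta>) (auto simp: fscale_apply)

text \<open>A repeated vector gives 0 and a vector out of order can be swapped back, so testing
  sublists suffices.\<close>

lemma vanishes_on_contr:
  assumes "altm \<alpha>" "vanishes_on es \<alpha>" "x \<in> set es"
  shows "vanishes_on es (contr x \<alpha>)"
  using assms
proof (induction es arbitrary: \<alpha>)
  case (Cons e es)
  show ?case
  proof (cases "x = e")
    case True
    then show ?thesis
      using Cons.prems by (simp add: altm_contr_same vanishes_on_linear(4) del: zero_fun_apply)
  next
    case False
    then have "vanishes_on es (contr x \<alpha>)" "vanishes_on es (- contr x (contr e \<alpha>))"
      using Cons by (auto intro: vanishes_on_linear(3))
    then show ?thesis
      using altm_contr_swap[OF Cons.prems(1), of e x] by simp
  qed
qed simp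

lemma vanishes_on_contr_span:
  assumes "altm \<alpha>" "vanishes_on es \<alpha>" "x \<in> span (set es)"
  shows "vanishes_on es (contr x \<alpha>)"
  using assms(3)
  by (induction rule: span_induct_alt)
    (simp_all add: altm_contr_linear[OF assms(1)] vanishes_on_linear vanishes_on_contr[OF assms(1,2)]
      del: plus_fun_apply zero_fun_apply)

lemma vanishes_onD:
  assumes "altm \<alpha>" "vanishes_on es \<alpha>" "span (set es) = UNIV"
  shows "\<alpha> = 0"
proof -
  have "\<alpha> [] = 0" if "vanishes_on es \<alpha>" for \<alpha> :: "'a form" and es
    using that by (induction es) auto
  then have "\<alpha> xs = 0" for xs
    using assms
  proof (induction xs arbitrary: \<alpha>)
    case (Cons x xs)
    have "contr x \<alpha> xs = 0"
      using Cons.IH[of "contr x \<alpha>"] vanishes_on_contr_span[OF Cons.prems(2,3)] Cons.prems by auto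
    then show ?case by (simp add: contr_apply)
  qed
  then show ?thesis by (simp add: fun_eq_iff)
qed

text \<open>Polarisation: the value at a list with \<open>x + y\<close> in both places is 0.\<close>

lemma is_form_altm:
  assumes "is_form k \<alpha>" shows "altm \<alpha>"
proof (rule altmI)
  have z: "\<alpha> xs = 0" if "length xs \<noteq> k \<or> \<not> distinct xs" for xs
    using assms that unfolding is_form_def by blast
  have lin: "linear (\<lambda>x. \<alpha> (xs @ x # ys))" for xs ys
  proof (cases "Suc (length xs + length ys) = k")
    case True
    then have "length (xs @ undefined # ys) = k" "length xs < k" by auto
    then have "linear (\<lambda>x. \<alpha> ((xs @ undefined # ys)[length xs := x]))"
      using assms unfolding is_form_def by blast
    then show ?thesis by simp
  qed (simp add: z linear_iff)
  then show "linear (\<lambda>x. \<alpha> (xs @ x # ys))" for xs ys .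
  show "\<alpha> (xs @ x # y # ys) = - \<alpha> (xs @ y # x # ys)" for xs x y ys
  proof -
    have "0 = \<alpha> (xs @ (x + y) # (x + y) # ys)" by (simp add: z)
    also have "\<dots> = \<alpha> (xs @ x # (x + y) # ys) + \<alpha> (xs @ y # (x + y) # ys)"
      by (rule linear_add[OF lin])
    also have "\<alpha> (xs @ x # (x + y) # ys) = \<alpha> (xs @ x # x # ys) + \<alpha> (xs @ x # y # ys)"
      using linear_add[OF lin[of "xs @ [x]" ys], of x y] by simp
    also have "\<alpha> (xs @ y # (x + y) # ys) = \<alpha> (xs @ y # x # ys) + \<alpha> (xs @ y # y # ys)"
      using linear_add[OF lin[of "xs @ [y]" ys], of x y] by simp
    finally show ?thesis by (simp add: z eq_neg_iff_add_eq_0)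
  qed
qed

lemma altm_not_distinct:
  assumes "altm \<alpha>" "\<not> distinct xs"
  shows "\<alpha> xs = 0"
  using assms
proof (induction xs arbitrary: \<alpha>)
  case (Cons x xs)
  have *: "\<alpha> (x # xs) = 0" if "x \<in> set xs" "altm \<alpha>" for xs \<alpha>
    using that
  proof (induction xs arbitrary: \<alpha>)
    case (Cons y xs)
    show ?case
    proof (cases "x = y")
      case True
      then show ?thesis using altm_swap[OF Cons.prems(2), of x x xs] by simp
    next
      case False
      then have "contr y \<alpha> (x # xs) = 0" using Cons by auto
      then show ?thesis using altm_swap[OF Cons.prems(2), of x y xs] by (simp add: contr_apply)
    qed
  qed simp
  show ?case
  proof (cases "x \<in> set xs")
    case False
    then have "contr x \<alpha> xs = 0" using Cons by auto
    then show ?thesis by (simp add: contr_apply)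
  qed (use * Cons in auto)
qed simp

lemma altm_is_form:
  assumes "altm \<alpha>" "\<And>xs. length xs \<noteq> k \<Longrightarrow> \<alpha> xs = 0"
  shows "is_form k \<alpha>"
  unfolding is_form_def
proof (intro conjI allI impI)
  fix xs :: "'a list" and i assume "length xs = k" "i < k"
  then have "xs[i := x] = take i xs @ x # drop (Suc i) xs" for x
    by (simp add: upd_conv_take_nth_drop)
  then show "linear (\<lambda>x. \<alpha> (xs[i := x]))"
    using altm_linear_at[OF assms(1)] by simp
qed (use assms altm_not_distinct in auto)

section \<open>Hermitian linear algebra\<close>

lemma linear_euclidean_sum: "linear f \<Longrightarrow> f x = (\<Sum>b\<in>Basis. (x \<bullet> b) *\<^sub>R f (b :: 'a::euclidean_space))"
  by (metis (no_types, lifting) euclidean_representation linear_cmul linear_sum sum.cong)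

lemma lin_trace_commute:
  assumes "linear f" "linear h"
  shows "lin_trace (\<lambda>x. f (h x)) = lin_trace (\<lambda>x. h (f x))"
proof -
  have "f (h b) \<bullet> b = (\<Sum>c\<in>Basis. (h b \<bullet> c) * (f c \<bullet> b))" for b
    by (subst linear_euclidean_sum[OF assms(1)]) (simp add: inner_sum_left)
  moreover have "h (f c) \<bullet> c = (\<Sum>b\<in>Basis. (f c \<bullet> b) * (h b \<bullet> c))" for c
    by (subst linear_euclidean_sum[OF assms(2)]) (simp add: inner_sum_left)
  ultimately show ?thesis
    unfolding lin_trace_def by (simp, subst sum.swap) (simp add: mult.commute)
qed

locale hermitian_space =
  fixes J :: "'g::euclidean_space \<Rightarrow> 'g" and g :: "'g \<Rightarrow> 'g \<Rightarrow> real"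
  assumes linear_J: "linear J" and J_J [simp]: "J (J x) = - x" and herm: "hermitian_metric J g"
begin

lemma bilinear_g: "bilinear g" and g_commute: "g x y = g y x" and g_pos: "x \<noteq> 0 \<Longrightarrow> g x x > 0"
  and g_J: "g (J x) (J y) = g x y"
  using herm unfolding hermitian_metric_def by blast+

lemmas J_simps = linear_add[OF linear_J] linear_diff[OF linear_J] linear_neg[OF linear_J]
  linear_0[OF linear_J] linear_cmul[OF linear_J]

lemmas g_simps = bilinear_ladd[OF bilinear_g] bilinear_radd[OF bilinear_g]
  bilinear_lmul[OF bilinear_g] bilinear_rmul[OF bilinear_g] bilinear_lneg[OF bilinear_g]
  bilinear_rneg[OF bilinear_g] bilinear_lzero[OF bilinear_g] bilinear_rzero[OF bilinear_g]
  bilinear_lsub[OF bilinear_g] bilinear_rsub[OF bilinear_g]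

lemma g_J_left: "g (J x) y = - g x (J y)"
  using g_J[of x "J y"] by (simp add: g_simps)

lemma g_J_self [simp]: "g x (J x) = 0" "g (J x) x = 0"
  using g_J_left[of x x] g_commute[of x "J x"] by auto

lemma g_eq_0_iff: "g x x = 0 \<longleftrightarrow> x = 0"
  using g_pos[of x] bilinear_lzero[OF bilinear_g, of x] by (cases "x = 0") auto

lemma linear_g: "linear (g v)" "linear (\<lambda>x. g x v)"
  using bilinear_g by (auto simp: bilinear_def)

lemma g_nondegenerate: "(\<And>z. g z x = g z y) \<Longrightarrow> x = y"
  using g_eq_0_iff[of "x - y"] by (simp add: g_simps)

lemma g_sum_right: "g v (\<Sum>i\<in>I. f i) = (\<Sum>i\<in>I. g v (f i))"
  by (rule linear_sum[OF linear_g(1)])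

lemma metric_of_fundamental_form: "metric_of J (fundamental_form J g) = g"
  by (auto simp: metric_of_def fundamental_form_def fun_eq_iff g_J)

end

locale hermitian_basis = hermitian_space J g
  for J :: "'a::euclidean_space \<Rightarrow> 'a" and g +
  fixes e :: "nat \<Rightarrow> 'a"
  assumes onb: "orthonormal_basis g e"
begin

lemma g_onb: "i \<in> {1..DIM('a)} \<Longrightarrow> j \<in> {1..DIM('a)} \<Longrightarrow> g (e i) (e j) = (if i = j then 1 else 0)"
  using onb unfolding orthonormal_basis_def by blast

lemma span_onb: "span (e ` {1..DIM('a)}) = UNIV"
proof -
  let ?I = "{1..DIM('a)}"
  have inj: "inj_on e ?I"
    by (rule inj_onI) (metis g_onb zero_neq_one)
  have "independent (e ` ?I)"
  proof (rule independent_if_scalars_zero)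
    fix f x assume 0: "(\<Sum>x\<in>e ` ?I. f x *\<^sub>R x) = 0" and "x \<in> e ` ?I"
    then obtain i where i: "i \<in> ?I" "x = e i" by auto
    have "0 = g x (\<Sum>x\<in>e ` ?I. f x *\<^sub>R x)" unfolding 0 by (simp add: g_simps)
    also have "\<dots> = (\<Sum>j\<in>?I. f (e j) * g x (e j))"
      by (simp add: g_sum_right g_simps sum.reindex[OF inj] del: One_nat_def)
    also have "\<dots> = (\<Sum>j\<in>?I. if i = j then f (e j) else 0)"
      by (rule sum.cong) (use i g_onb in auto)
    also have "\<dots> = f x" using i by simp
    finally show "f x = 0" by simp
  qed simp
  then show ?thesis
    using card_ge_dim_independent[of "e ` ?I" UNIV] card_image[OF inj] by auto
qed

lemma onb_expansion: "(\<Sum>i = 1..DIM('a). g v (e i) *\<^sub>R e i) = v"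
proof -
  let ?w = "v - (\<Sum>i = 1..DIM('a). g v (e i) *\<^sub>R e i)"
  have "g (e j) ?w = 0" if "j \<in> {1..DIM('a)}" for j
  proof -
    have "g (e j) (\<Sum>i = 1..DIM('a). g v (e i) *\<^sub>R e i) = (\<Sum>i = 1..DIM('a). g v (e i) * g (e j) (e i))"
      by (simp add: g_sum_right g_simps)
    also have "\<dots> = (\<Sum>i = 1..DIM('a). if i = j then g v (e i) else 0)"
      by (rule sum.cong) (use that g_onb in auto)
    also have "\<dots> = g v (e j)" using that by simp
    finally show ?thesis by (simp add: g_simps g_commute)
  qed
  then have *: "g ?w (e j) = 0" if "j \<in> {1..DIM('a)}" for j
    using that by (simp only: g_commute[of ?w])
  have "g ?w x = 0" if "x \<in> span (e ` {1..DIM('a)})" for x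
    using that
  proof (induction rule: span_induct_alt)
    case (step c x y)
    then show ?case
      using * by (auto simp only: bilinear_radd[OF bilinear_g] bilinear_rmul[OF bilinear_g]) simp
  qed (simp only: bilinear_rzero[OF bilinear_g])
  then have "?w = 0" unfolding span_onb using g_eq_0_iff[of ?w] by blast
  then show ?thesis by simp
qed

text \<open>\<open>lin_trace\<close> uses the standard basis of the type, which is unrelated to
  \<open>g\<close>; this makes it computable in any orthonormal basis for \<open>g\<close>.\<close>

lemma lin_trace_onb:
  assumes "linear f"
  shows "(\<Sum>i = 1..DIM('a). g (f (e i)) (e i)) = lin_trace f"
proof -
  have *: "f b = (\<Sum>i = 1..DIM('a). g b (e i) *\<^sub>R f (e i))" for b
    using arg_cong[OF onb_expansion[of b], of f] by (simp only: linear_sum[OF assms] linear_cmul[OF assms])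
  have "lin_trace f = (\<Sum>b\<in>Basis. \<Sum>i = 1..DIM('a). g b (e i) * (f (e i) \<bullet> b))"
    unfolding lin_trace_def by (subst *) (simp add: inner_sum_left)
  also have "\<dots> = (\<Sum>i = 1..DIM('a). \<Sum>b\<in>Basis. (f (e i) \<bullet> b) * g b (e i))"
    by (subst sum.swap) (simp add: mult.commute)
  also have "\<dots> = (\<Sum>i = 1..DIM('a). g (f (e i)) (e i))"
    by (rule sum.cong, simp, subst (2) linear_euclidean_sum[OF linear_g(2)]) simp
  finally show ?thesis ..
qed

lemma adjoint_exists:
  assumes "linear D"
  obtains D' where "linear D'" "\<And>x y. g (D x) y = g x (D' y)"
proof
  let ?D' = "\<lambda>y. \<Sum>i = 1..DIM('a). g (D (e i)) y *\<^sub>R e i"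
  show "linear ?D'"
    by (auto simp: linear_iff g_simps algebra_simps sum.distrib scaleR_right.sum)
  fix x y
  have "D x = (\<Sum>i = 1..DIM('a). g x (e i) *\<^sub>R D (e i))"
    using arg_cong[OF onb_expansion[of x], of D] by (simp only: linear_sum[OF assms] linear_cmul[OF assms])
  then have "g (D x) y = (\<Sum>i = 1..DIM('a). g y (D (e i)) * g x (e i))"
    by (subst g_commute) (simp add: g_sum_right g_simps mult.commute)
  then show "g (D x) y = g x (?D' y)"
    by (simp add: g_sum_right g_simps g_commute[of y])
qed

definition onb_list :: "'a list" where
  "onb_list = map e [1..<DIM('a) + 1]"

lemma sharp_contr_onb:
  assumes "altm \<gamma>"
  shows "sharp_contr onb_list (\<lambda>x. complex_of_real (g v x)) \<gamma> = contr v \<gamma>"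
proof -
  have "sharp_contr es (\<lambda>x. complex_of_real (g v x)) \<gamma> = contr (sum_list (map (\<lambda>x. g v x *\<^sub>R x) es)) \<gamma>" for es
    by (induction es) (simp_all add: altm_contr_linear[OF assms])
  then show ?thesis
    by (simp add: onb_list_def comp_def interv_sum_list_conv_sum_set_nat atLeastLessThanSuc_atLeastAtMost
        onb_expansion Suc_eq_plus1[symmetric] del: upt_Suc One_nat_def)
qed

end

context hermitian_space
begin

lemma some_onb:
  assumes "orthonormal_basis g e"
  shows "hermitian_basis J g (some_onb g)"
  by unfold_locales (use someI[of "orthonormal_basis g", OF assms] in \<open>simp add: some_onb_def\<close>)

end


section \<open>The Chern connection\<close>

locale almost_abelian_hermitian = almost_abelian \<mu> J D \<epsilon> + hermitian_basis J g e
  for \<mu> :: "'g::euclidean_space \<Rightarrow> 'g \<Rightarrow> 'g" and J D \<epsilon> g e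
begin

lemmas D_simps = linear_add[OF D(1)] linear_diff[OF D(1)] linear_neg[OF D(1)] linear_0[OF D(1)] linear_cmul[OF D(1)]
lemmas \<epsilon>_simps = linear_add[OF \<epsilon>(1)] linear_diff[OF \<epsilon>(1)] linear_neg[OF \<epsilon>(1)] linear_0[OF \<epsilon>(1)] linear_cmul[OF \<epsilon>(1)]

lemma \<epsilon>_J_D: "\<epsilon> (J (D x)) = 0"
  using \<epsilon>(2)[of "J x"] by (simp add: D)

text \<open>The difference \<open>E\<close> of two such connections is skew and complex linear in
  its second argument; the torsion condition controls how it depends on the first.\<close>

lemma chern_connection_unique:
  assumes N: "is_chern_connection \<mu> J g N" and N': "is_chern_connection \<mu> J g N'"
  shows "N = N'"
proof -
  define E where "E X Y = N X Y - N' X Y" for X Y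
  have skew: "g (E X Y) Z = - g Y (E X Z)" for X Y Z
  proof -
    have "g (N X Y) Z + g Y (N X Z) = 0" "g (N' X Y) Z + g Y (N' X Z) = 0"
      using N N' unfolding is_chern_connection_def by blast+
    then show ?thesis by (simp add: E_def g_simps)
  qed
  have EJ: "E X (J Y) = J (E X Y)" for X Y
    using N N' by (simp add: is_chern_connection_def E_def J_simps)
  have ET: "E (J X) (J Y) - E (J Y) (J X) = - (E X Y - E Y X)" for X Y
  proof -
    have "torsion \<mu> N (J X) (J Y) - torsion \<mu> N' (J X) (J Y) = - (torsion \<mu> N X Y - torsion \<mu> N' X Y)"
      using N N' by (simp add: is_chern_connection_def)
    then show ?thesis unfolding torsion_def E_def by (simp add: algebra_simps)
  qed
  have lin: "E (- X) Y = - E X Y" for X Y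
    using N N' by (simp add: is_chern_connection_def E_def bilinear_lneg)
  have self_neg: "v = 0" if "v = - v" for v :: 'g
    using that by (metis add_eq_0_iff real_vector.scale_eq_0_iff scaleR_2 zero_neq_numeral)
  have J0: "v = 0" if "J v = 0" for v
    using J_J[of v] that J_simps(4) by simp
  \<comment> \<open>\<open>F\<close> is twice the part of \<open>E\<close> that is antilinear in the
    first argument. It is symmetric, antilinear in \<open>X\<close> and linear in \<open>Y\<close>,
    hence zero.\<close>
  define F where "F X Y = E X Y + J (E (J X) Y)" for X Y
  have Fsym: "F X Y = F Y X" for X Y
    using ET[of X Y] unfolding F_def EJ by (simp add: algebra_simps)
  have FJ: "F X (J Y) = J (F X Y)" "F (J X) Y = - J (F X Y)" for X Y
    by (simp_all add: F_def EJ J_simps lin)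
  have "J (F X Y) = - J (F X Y)" for X Y
    using FJ(1)[of X Y] FJ(2)[of Y X] Fsym[of X "J Y"] Fsym[of X Y] by simp
  then have "F X Y = 0" for X Y using self_neg J0 by blast
  then have "J (E X Y + J (E (J X) Y)) = 0" for X Y
    by (simp add: F_def J_simps)
  then have E1: "E (J X) Y = J (E X Y)" for X Y
    by (simp add: J_simps)
  \<comment> \<open>Now \<open>E\<close> is complex linear in the first argument too, and skewness
    at \<open>J X\<close> and at \<open>X\<close> yield opposite signs for the same
    quantity.\<close>
  have "g (J (E X Y)) Z = 0" for X Y Z
  proof -
    have "g (J (E X Y)) Z = - g Y (J (E X Z))" using skew[of "J X" Y Z] by (simp add: E1)
    also have "\<dots> = g (J Y) (E X Z)" by (simp add: g_J_left)
    also have "\<dots> = - g (J (E X Y)) Z" using skew[of X "J Y" Z] by (simp add: EJ)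
    finally show ?thesis by simp
  qed
  then have "E X Y = 0" for X Y using g_eq_0_iff J0 by blast
  then show ?thesis by (auto simp: E_def fun_eq_iff)
qed

text \<open>The derivative along \<open>X\<close> is the skew-adjoint part of \<epsilon>(X) D +
  \<epsilon>(J X) J D. Of the adjoint \<open>D'\<close> only linearity and commutation with
  \<open>J\<close> are passed on; this is what the trace of a commutator needs.\<close>

lemma chern_connection:
  obtains D' where "linear D'" "\<And>x. D' (J x) = J (D' x)"
    "chern_connection \<mu> J g = (\<lambda>X Y. (1/2) *\<^sub>R (\<epsilon> X *\<^sub>R D Y + \<epsilon> (J X) *\<^sub>R J (D Y))
      - (1/2) *\<^sub>R (\<epsilon> X *\<^sub>R D' Y - \<epsilon> (J X) *\<^sub>R J (D' Y)))"
proof -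
  obtain D' where D': "linear D'" "\<And>x y. g (D x) y = g x (D' y)"
    using adjoint_exists[OF D(1)] by blast
  have D'J: "D' (J x) = J (D' x)" for x
  proof (rule g_nondegenerate)
    fix z
    have "g z (D' (J x)) = - g (D (J z)) x"
      using g_J_left[of "D z" x] by (simp add: D'(2)[symmetric] D(2))
    then show "g z (D' (J x)) = g z (J (D' x))"
      by (simp add: D'(2) g_J_left)
  qed
  note D'_simps = linear_add[OF D'(1)] linear_neg[OF D'(1)] linear_cmul[OF D'(1)]
  let ?N = "\<lambda>X Y. (1/2) *\<^sub>R (\<epsilon> X *\<^sub>R D Y + \<epsilon> (J X) *\<^sub>R J (D Y))
      - (1/2) *\<^sub>R (\<epsilon> X *\<^sub>R D' Y - \<epsilon> (J X) *\<^sub>R J (D' Y))"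
  have chern: "is_chern_connection \<mu> J g ?N"
    unfolding is_chern_connection_def
  proof (intro conjI allI)
    show "bilinear ?N"
      unfolding bilinear_def linear_iff
      by (simp add: D_simps D'_simps \<epsilon>_simps J_simps scaleR_add_left scaleR_add_right
          scaleR_diff_right mult.commute)
    fix X Y Z
    have D'_left: "g (D' Y) Z = g Y (D Z)" for Y Z
      using D'(2)[of Z Y] by (simp only: g_commute[of Y "D Z"] g_commute[of "D' Y" Z])
    have 1: "g (D Y) Z = g Y (D' Z)" "g (J (D Y)) Z = - g Y (J (D' Z))"
      "g (D' Y) Z = g Y (D Z)" "g (J (D' Y)) Z = - g Y (J (D Z))"
      by (simp_all add: D'(2) D'_left g_J_left D'J D(2))
    show "g (?N X Y) Z + g Y (?N X Z) = 0"
      by (simp add: g_simps 1 algebra_simps)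
    show "?N X (J Y) = J (?N X Y)"
      by (simp add: D(2) D'J J_simps algebra_simps)
    show "torsion \<mu> ?N (J X) (J Y) = - torsion \<mu> ?N X Y"
      unfolding torsion_def \<mu>
      by (simp add: D(2) D'J J_simps \<epsilon>_simps algebra_simps)
        (simp add: scaleR_add_left[symmetric])
  qed
  have "chern_connection \<mu> J g = ?N"
    unfolding chern_connection_def using chern chern_connection_unique[OF _ chern] by (rule the_equality)
  then show thesis using that D'(1) D'J by blast
qed

text \<open>
  The Chern connection vanishes on the derived algebra, so the Chern--Ricci form is the trace of
  \<open>J\<close> composed with a commutator of maps commuting with \<open>J\<close>.
\<close>

theorem chern_ricci_form_eq_0: "chern_ricci_form \<mu> J (fundamental_form J g) = 0"
proof -
  interpret s: hermitian_basis J g "some_onb g" by (rule some_onb[OF onb])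
  obtain D' where D': "linear D'" "\<And>x. D' (J x) = J (D' x)"
    and N: "chern_connection \<mu> J g = (\<lambda>X Y. (1/2) *\<^sub>R (\<epsilon> X *\<^sub>R D Y + \<epsilon> (J X) *\<^sub>R J (D Y))
      - (1/2) *\<^sub>R (\<epsilon> X *\<^sub>R D' Y - \<epsilon> (J X) *\<^sub>R J (D' Y)))"
    using chern_connection by blast
  define N where "N = chern_connection \<mu> J g"
  note D'_simps = linear_add[OF D'(1)] linear_neg[OF D'(1)] linear_cmul[OF D'(1)]
  have lin: "linear (N X)" for X
    unfolding N_def N linear_iff
    by (simp add: D_simps D'_simps \<epsilon>_simps J_simps scaleR_add_left scaleR_add_right
        scaleR_diff_right mult.commute)
  have NJ: "N X (J Y) = J (N X Y)" for X Y
    unfolding N_def N by (simp add: D(2) D'(2) J_simps algebra_simps)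
  have "N (\<mu> X Y) Z = 0" for X Y Z
    unfolding N_def N by (simp add: \<mu> \<epsilon>_simps J_simps \<epsilon>(2) \<epsilon>_J_D)
  then have R: "chern_curvature \<mu> J g X Y Z = N X (N Y Z) - N Y (N X Z)" for X Y Z
    by (simp add: chern_curvature_def Let_def N_def)
  have linJ: "linear (\<lambda>Z. J (N X Z))" for X
    using linear_compose[OF lin linear_J] by (simp add: comp_def)
  have "(\<Sum>i = 1..DIM('g). g (chern_curvature \<mu> J g X Y (some_onb g i)) (J (some_onb g i))) = 0" for X Y
  proof -
    have linR: "linear (\<lambda>Z. J (chern_curvature \<mu> J g X Y Z))"
      unfolding R using linear_compose[OF lin linJ] by (simp add: comp_def J_simps linear_compose_sub)
    have "(\<Sum>i = 1..DIM('g). g (chern_curvature \<mu> J g X Y (some_onb g i)) (J (some_onb g i)))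
      = - lin_trace (\<lambda>Z. J (chern_curvature \<mu> J g X Y Z))"
      unfolding s.lin_trace_onb[OF linR, symmetric] by (simp add: g_J_left sum_negf)
    also have "lin_trace (\<lambda>Z. J (chern_curvature \<mu> J g X Y Z))
      = lin_trace (\<lambda>Z. N X (J (N Y Z))) - lin_trace (\<lambda>Z. J (N Y (N X Z)))"
      by (simp add: R lin_trace_def J_simps NJ inner_diff_left sum_subtractf)
    also have "\<dots> = 0"
      using lin_trace_commute[OF lin linJ] by simp
    finally show ?thesis by simp
  qed
  then show ?thesis
    by (auto simp: chern_ricci_form_def metric_of_fundamental_form Let_def fun_eq_iff
        simp del: One_nat_def of_real_sum simp flip: of_real_sum split: list.split)
qed

end

section \<open>Unitary frames\<close>

lemma numeral_mult_form [simp]: "(numeral k :: 'g form) * \<alpha> = numeral k \<cdot> \<alpha>"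
  by (simp add: fun_eq_iff fscale_apply)

lemma is_form_degree: "is_form k \<alpha> \<Longrightarrow> length xs \<noteq> k \<Longrightarrow> \<alpha> xs = 0"
  unfolding is_form_def by blast

lemma is_form_diff:
  assumes "is_form k \<alpha>" "is_form k \<beta>"
  shows "is_form k (\<alpha> - \<beta>)"
proof -
  have 1: "altm (\<alpha> - \<beta>)"
    by (rule altm_diff[OF assms[THEN is_form_altm]])
  have 2: "(\<alpha> - \<beta>) xs = 0" if "length xs \<noteq> k" for xs
    using is_form_degree[OF assms(1) that] is_form_degree[OF assms(2) that] by (simp only: minus_apply diff_self)
  show ?thesis
    using 1 2 by (rule altm_is_form)
qed

locale unitary_frame = hermitian_space J g
  for J :: "'g::euclidean_space \<Rightarrow> 'g" and g +
  fixes x1 x2 x3 :: 'g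
  assumes dim: "DIM('g) = 6"
    and frame: "g x1 x1 = 1" "g x2 x2 = 1" "g x3 x3 = 1" "g x1 x2 = 0" "g x1 (J x2) = 0"
      "g x1 x3 = 0" "g x1 (J x3) = 0" "g x2 x3 = 0" "g x2 (J x3) = 0"
begin

abbreviation "frame_list \<equiv> [x1, J x1, x2, J x2, x3, J x3]"

lemma frame_g [simp]:
  "g x1 x1 = 1" "g x2 x2 = 1" "g x3 x3 = 1" "g x1 x2 = 0" "g x1 (J x2) = 0"
  "g x1 x3 = 0" "g x1 (J x3) = 0" "g x2 x3 = 0" "g x2 (J x3) = 0"
  "g x2 x1 = 0" "g (J x2) x1 = 0" "g x3 x1 = 0" "g (J x3) x1 = 0" "g x3 x2 = 0" "g (J x3) x2 = 0"
  "g (J x1) x2 = 0" "g (J x1) x3 = 0" "g (J x2) x3 = 0" "g x2 (J x1) = 0" "g x3 (J x1) = 0" "g x3 (J x2) = 0"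
proof -
  have 1: "g x2 x1 = 0" "g x3 x1 = 0" "g x3 x2 = 0"
    using frame g_commute by metis+
  have 2: "g x2 (J x1) = 0" "g x3 (J x1) = 0" "g x3 (J x2) = 0"
    using frame g_J_left[of x1 x2] g_J_left[of x1 x3] g_J_left[of x2 x3]
      g_commute[of x2 "J x1"] g_commute[of x3 "J x1"] g_commute[of x3 "J x2"] by auto
  show "g x1 x1 = 1" "g x2 x2 = 1" "g x3 x3 = 1" "g x1 x2 = 0" "g x1 (J x2) = 0"
    "g x1 x3 = 0" "g x1 (J x3) = 0" "g x2 x3 = 0" "g x2 (J x3) = 0"
    "g x2 x1 = 0" "g (J x2) x1 = 0" "g x3 x1 = 0" "g (J x3) x1 = 0" "g x3 x2 = 0" "g (J x3) x2 = 0"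
    "g (J x1) x2 = 0" "g (J x1) x3 = 0" "g (J x2) x3 = 0" "g x2 (J x1) = 0" "g x3 (J x1) = 0" "g x3 (J x2) = 0"
    using frame 1 2 by (simp_all add: g_J_left)
qed

lemma frame_g_J [simp]:
  "g (J x1) (J x1) = 1" "g (J x2) (J x2) = 1" "g (J x3) (J x3) = 1" "g (J x1) (J x2) = 0"
  "g (J x1) (J x3) = 0" "g (J x2) (J x3) = 0" "g (J x2) (J x1) = 0"
  "g (J x3) (J x1) = 0" "g (J x3) (J x2) = 0"
  by (simp_all add: g_J)

text \<open>Lists are indexed from 0 and orthonormal bases from 1, hence the shift.\<close>

lemma orthonormal_frame: "orthonormal_basis g (\<lambda>i. frame_list ! (i - 1))"
proof -
  have "{1..DIM('g)} = {1, 2, 3, 4, 5, 6}" unfolding dim by auto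
  then show ?thesis by (simp add: orthonormal_basis_def)
qed

lemma span_frame: "span (set frame_list) = UNIV"
proof -
  interpret hermitian_basis J g "\<lambda>i. frame_list ! (i - 1)"
    by unfold_locales (rule orthonormal_frame)
  have "{1..DIM('g)} = {1, 2, 3, 4, 5, 6}" unfolding dim by auto
  then show ?thesis using span_onb by simp
qed

sublocale onb: hermitian_basis J g "some_onb g"
  by (rule some_onb[OF orthonormal_frame])

lemma form_eq_on_frame:
  assumes "altm \<alpha>" "altm \<beta>" "vanishes_on frame_list (\<alpha> - \<beta>)"
  shows "\<alpha> = \<beta>"
  using vanishes_onD[OF altm_diff[OF assms(1,2)] assms(3) span_frame] by simp

lemma linear_eq_on_frame:
  assumes "linear f" "linear h" "\<And>v. v \<in> set frame_list \<Longrightarrow> f v = h v"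
  shows "f = h"
  using linear_eq_on_span[OF assms(1,2), of "set frame_list"] assms(3) span_frame by auto

definition flat :: "'g \<Rightarrow> 'g form" where
  "flat v = one_form (\<lambda>x. complex_of_real (g v x))"

lemma linear_complex_g: "linear (\<lambda>x. complex_of_real (g v x))"
  using linear_g(1)[of v] by (simp add: linear_iff scaleR_conv_of_real)

lemma altm_flat [simp]: "altm (flat v)"
  unfolding flat_def by (rule altm_one_form[OF linear_complex_g])

lemma flat_simps [simp]:
  "contr x (flat v) = complex_of_real (g v x) \<cdot> unit_form" "gsgn (flat v) = - flat v"
  "flat v \<^bold>\<and> flat v = 0" "flat v \<^bold>\<and> flat v \<^bold>\<and> \<beta> = 0" "flat v [] = 0"
  by (simp_all add: flat_def, simp add: one_form_def)

lemma flat_Cons: "flat v (x # xs) = complex_of_real (g v x) * unit_form xs"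
  by (simp add: flat_def one_form_def unit_form_def split: list.split)

lemma flat_swap: "flat v \<^bold>\<and> flat w = - (flat w \<^bold>\<and> flat v)"
  unfolding flat_def by (rule one_form_swap)

lemma flat_swap': "flat v \<^bold>\<and> flat w \<^bold>\<and> \<beta> = - (flat w \<^bold>\<and> flat v \<^bold>\<and> \<beta>)"
  unfolding flat_def by (rule one_form_swap')

text \<open>Oriented rules that sort products of the frame 1-forms into the order X1, Y1, X2, Y2,
  X3, Y3, a normal form; the primed rules act inside longer products.\<close>

lemmas flat_sort =
  flat_swap[of "J x1" x1] flat_swap[of x2 x1] flat_swap[of "J x2" x1] flat_swap[of x3 x1] flat_swap[of "J x3" x1]
  flat_swap[of x2 "J x1"] flat_swap[of "J x2" "J x1"] flat_swap[of x3 "J x1"] flat_swap[of "J x3" "J x1"]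
  flat_swap[of "J x2" x2] flat_swap[of x3 x2] flat_swap[of "J x3" x2]
  flat_swap[of x3 "J x2"] flat_swap[of "J x3" "J x2"] flat_swap[of "J x3" x3]
  flat_swap'[of "J x1" x1] flat_swap'[of x2 x1] flat_swap'[of "J x2" x1] flat_swap'[of x3 x1] flat_swap'[of "J x3" x1]
  flat_swap'[of x2 "J x1"] flat_swap'[of "J x2" "J x1"] flat_swap'[of x3 "J x1"] flat_swap'[of "J x3" "J x1"]
  flat_swap'[of "J x2" x2] flat_swap'[of x3 x2] flat_swap'[of "J x3" x2]
  flat_swap'[of x3 "J x2"] flat_swap'[of "J x3" "J x2"] flat_swap'[of "J x3" x3]

abbreviation X1 where "X1 \<equiv> flat x1"
abbreviation Y1 where "Y1 \<equiv> flat (J x1)"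
abbreviation X2 where "X2 \<equiv> flat x2"
abbreviation Y2 where "Y2 \<equiv> flat (J x2)"
abbreviation X3 where "X3 \<equiv> flat x3"
abbreviation Y3 where "Y3 \<equiv> flat (J x3)"

definition \<omega> :: "'g form" where
  "\<omega> = fundamental_form J g"

lemma altm_\<omega> [simp]: "altm \<omega>"
proof -
  have "is_form 2 \<omega>"
    unfolding is_form_def
  proof (intro conjI allI impI)
    fix xs :: "'g list" and i assume xs: "length xs = 2"
    then obtain a b where ab: "xs = [a, b]"
      by (metis (no_types, lifting) One_nat_def Suc_1 Suc_length_conv length_0_conv)
    show "\<not> distinct xs \<Longrightarrow> \<omega> xs = 0"
      by (auto simp: ab \<omega>_def fundamental_form_def)
    show "linear (\<lambda>x. \<omega> (xs[i := x]))" if "i < 2"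
    proof -
      consider "i = 0" | "i = 1" using \<open>i < 2\<close> by linarith
      then show ?thesis
        by cases (simp_all add: ab \<omega>_def fundamental_form_def linear_iff g_simps J_simps scaleR_conv_of_real)
    qed
  qed (auto simp: \<omega>_def fundamental_form_def split: list.split)
  then show ?thesis by (rule is_form_altm)
qed

lemma \<omega>_apply: "\<omega> [x, y] = complex_of_real (g (J x) y)" "length xs \<noteq> 2 \<Longrightarrow> \<omega> xs = 0"
  by (auto simp: \<omega>_def fundamental_form_def split: list.split)

lemma \<omega>_eq: "\<omega> = X1 \<^bold>\<and> Y1 + X2 \<^bold>\<and> Y2 + X3 \<^bold>\<and> Y3"
  by (rule form_eq_on_frame)
    (simp_all add: contr_apply \<omega>_apply unit_form_apply fscale_apply g_simps)

lemma wedge_power_\<omega>: "wedge_power \<omega> (Suc 0) = \<omega>" "wedge_power \<omega> 2 = \<omega> \<^bold>\<and> \<omega>" "wedge_power \<omega> 3 = \<omega> \<^bold>\<and> \<omega> \<^bold>\<and> \<omega>"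
  by (simp_all add: numeral_2_eq_2 numeral_3_eq_3 flip: unit_form_def)

lemma \<omega>_\<omega>: "\<omega> \<^bold>\<and> \<omega> = 2 \<cdot> (X1 \<^bold>\<and> Y1 \<^bold>\<and> X2 \<^bold>\<and> Y2) + 2 \<cdot> (X1 \<^bold>\<and> Y1 \<^bold>\<and> X3 \<^bold>\<and> Y3) + 2 \<cdot> (X2 \<^bold>\<and> Y2 \<^bold>\<and> X3 \<^bold>\<and> Y3)"
  unfolding \<omega>_eq by (simp add: flat_sort)

section \<open>Volume form and Hodge star in a unitary frame\<close>

definition vol :: "'g form" where
  "vol = X1 \<^bold>\<and> Y1 \<^bold>\<and> X2 \<^bold>\<and> Y2 \<^bold>\<and> X3 \<^bold>\<and> Y3"

lemma altm_vol [simp]: "altm vol"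
  by (simp add: vol_def)

lemma volume_form_\<omega>: "volume_form \<omega> = vol"
proof -
  have "\<omega> \<^bold>\<and> \<omega> \<^bold>\<and> \<omega> = 6 \<cdot> vol"
    unfolding \<omega>_\<omega> vol_def \<omega>_eq by (simp add: flat_sort) (auto simp: fun_eq_iff fscale_apply)
  then show ?thesis
    by (simp add: volume_form_def dim wedge_power_\<omega> fscale_apply fun_eq_iff)
      (simp add: fact_numeral)
qed

abbreviation hs :: "'g form \<Rightarrow> 'g form \<Rightarrow> 'g form" where
  "hs \<equiv> hsum onb.onb_list"

lemma hodge_\<omega>: "hodge J \<omega> \<beta> = hs \<beta> vol"
  unfolding hodge_def hsum_def volume_form_\<omega> unfolding \<omega>_def metric_of_fundamental_form
  by (simp add: Let_def onb.onb_list_def)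

text \<open>The orthonormal basis chosen in \<open>hodge\<close> drops out here: whatever it is, the
  metric dual of \<open>flat v\<close> is \<open>v\<close>.\<close>

lemma hs_flat [simp]:
  "altm \<gamma> \<Longrightarrow> hs (flat v \<^bold>\<and> \<beta>) \<gamma> = hs \<beta> (contr v \<gamma>)" "altm \<gamma> \<Longrightarrow> hs (flat v) \<gamma> = contr v \<gamma>"
  unfolding flat_def by (simp_all add: hsum_wedge hsum_one_form onb.sharp_contr_onb)

text \<open>
  The Hermitian forms on the complex plane spanned by \<open>x\<^sub>2\<close> and \<open>x\<^sub>3\<close>: diagonal entries \<open>k1\<close>, \<open>k2\<close>
  and off-diagonal entry \<open>kr + i ki\<close>.
\<close>

definition eta :: "real \<Rightarrow> real \<Rightarrow> real \<Rightarrow> real \<Rightarrow> 'g form" where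
  "eta k1 k2 kr ki = complex_of_real k1 \<cdot> (X2 \<^bold>\<and> Y2) + complex_of_real k2 \<cdot> (X3 \<^bold>\<and> Y3)
    + complex_of_real kr \<cdot> (X2 \<^bold>\<and> Y3 + X3 \<^bold>\<and> Y2) + complex_of_real ki \<cdot> (X2 \<^bold>\<and> X3 + Y2 \<^bold>\<and> Y3)"

lemma altm_eta [simp]: "altm (eta k1 k2 kr ki)"
  by (simp add: eta_def)

text \<open>Apart from its effect on X1 and Y1, the star replaces the Hermitian matrix of
  \<open>eta\<close> by its adjugate.\<close>

lemma hodge_eta:
  "hodge J \<omega> (X1 \<^bold>\<and> eta k1 k2 kr ki) = Y1 \<^bold>\<and> eta k2 k1 (- kr) (- ki)"
  "hodge J \<omega> (Y1 \<^bold>\<and> eta k1 k2 kr ki) = - (X1 \<^bold>\<and> eta k2 k1 (- kr) (- ki))"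
  "hodge J \<omega> (X1 \<^bold>\<and> Y1 \<^bold>\<and> eta k1 k2 kr ki) = eta k2 k1 (- kr) (- ki)"
  unfolding hodge_\<omega> eta_def vol_def by (simp_all add: algebra_simps flat_sort)

lemma hodge_\<omega>_\<omega>: "hodge J \<omega> (\<omega> \<^bold>\<and> \<omega>) = 2 \<cdot> \<omega>"
  unfolding hodge_\<omega> \<omega>_\<omega> vol_def by (simp add: \<omega>_eq algebra_simps)

lemma hodge_linear [simp]: "hodge J \<omega> (\<alpha> + \<beta>) = hodge J \<omega> \<alpha> + hodge J \<omega> \<beta>"
  "hodge J \<omega> (\<alpha> - \<beta>) = hodge J \<omega> \<alpha> - hodge J \<omega> \<beta>"
  "hodge J \<omega> (- \<alpha>) = - hodge J \<omega> \<alpha>" "hodge J \<omega> (c \<cdot> \<alpha>) = c \<cdot> hodge J \<omega> \<alpha>" "hodge J \<omega> 0 = 0"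
  by (simp_all add: hodge_\<omega>)

lemma altm_hodge [simp]: "altm (hodge J \<omega> \<alpha>)"
  by (simp add: hodge_\<omega>)

section \<open>Inverting the product with the fundamental form\<close>

lemma wedge_two_apply:
  assumes "\<And>xs. length xs \<noteq> 2 \<Longrightarrow> \<gamma> xs = 0" "\<And>xs. length xs \<noteq> 2 \<Longrightarrow> \<gamma>' xs = 0"
  shows "(\<gamma> \<^bold>\<and> \<gamma>') [a, b, c, d] = \<gamma> [a, b] * \<gamma>' [c, d] - \<gamma> [a, c] * \<gamma>' [b, d] + \<gamma> [a, d] * \<gamma>' [b, c]
    + \<gamma> [b, c] * \<gamma>' [a, d] - \<gamma> [b, d] * \<gamma>' [a, c] + \<gamma> [c, d] * \<gamma>' [a, b]"
  by (simp add: wedge_Cons contr_apply gsgn_apply assms)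

text \<open>One half of the hard Lefschetz theorem in complex dimension 3; it makes the description
  in \<open>iota\<close> definite. Two vectors together with a pair v, J v orthogonal to them
  isolate an off-diagonal component of \<open>\<gamma>\<close>; the diagonal ones occur only in sums
  of two.\<close>

lemma wedge_\<omega>_inject:
  assumes "is_form 2 \<gamma>" "\<gamma> \<^bold>\<and> \<omega> = 0"
  shows "\<gamma> = 0"
proof -
  have alt: "altm \<gamma>" using is_form_altm[OF assms(1)] .
  have deg: "\<gamma> xs = 0" if "length xs \<noteq> 2" for xs
    using assms(1) that unfolding is_form_def by blast
  have *: "\<gamma> [a, b] * \<omega> [c, d] - \<gamma> [a, c] * \<omega> [b, d] + \<gamma> [a, d] * \<omega> [b, c]
    + \<gamma> [b, c] * \<omega> [a, d] - \<gamma> [b, d] * \<omega> [a, c] + \<gamma> [c, d] * \<omega> [a, b] = 0" for a b c d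
    using wedge_two_apply[of \<gamma> \<omega> a b c d] deg \<omega>_apply(2) assms(2) by simp
  have 1: "\<gamma> [x1, J x1] + \<gamma> [x2, J x2] = 0" "\<gamma> [x1, J x1] + \<gamma> [x3, J x3] = 0" "\<gamma> [x2, J x2] + \<gamma> [x3, J x3] = 0"
    using *[of x1 "J x1" x2 "J x2"] *[of x1 "J x1" x3 "J x3"] *[of x2 "J x2" x3 "J x3"]
    by (simp_all add: \<omega>_apply g_simps add.commute)
  have "2 * \<gamma> [x1, J x1] = (\<gamma> [x1, J x1] + \<gamma> [x2, J x2]) + (\<gamma> [x1, J x1] + \<gamma> [x3, J x3])
    - (\<gamma> [x2, J x2] + \<gamma> [x3, J x3])" by simp
  then have "\<gamma> [x1, J x1] = 0" unfolding 1 by simp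
  moreover from this 1 have "\<gamma> [x2, J x2] = 0" "\<gamma> [x3, J x3] = 0" by auto
  moreover have "\<gamma> [x1, x2] = 0" "\<gamma> [x1, J x2] = 0" "\<gamma> [J x1, x2] = 0" "\<gamma> [J x1, J x2] = 0"
    using *[of x1 x2 x3 "J x3"] *[of x1 "J x2" x3 "J x3"] *[of "J x1" x2 x3 "J x3"] *[of "J x1" "J x2" x3 "J x3"]
    by (simp_all add: \<omega>_apply g_simps)
  moreover have "\<gamma> [x1, x3] = 0" "\<gamma> [x1, J x3] = 0" "\<gamma> [J x1, x3] = 0" "\<gamma> [J x1, J x3] = 0"
    using *[of x1 x2 "J x2" x3] *[of x1 x2 "J x2" "J x3"] *[of "J x1" x2 "J x2" x3] *[of "J x1" x2 "J x2" "J x3"]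
    by (simp_all add: \<omega>_apply g_simps)
  moreover have "\<gamma> [x2, x3] = 0" "\<gamma> [x2, J x3] = 0" "\<gamma> [J x2, x3] = 0" "\<gamma> [J x2, J x3] = 0"
    using *[of x1 "J x1" x2 x3] *[of x1 "J x1" x2 "J x3"] *[of x1 "J x1" "J x2" x3] *[of x1 "J x1" "J x2" "J x3"]
    by (simp_all add: \<omega>_apply g_simps)
  ultimately have "vanishes_on frame_list \<gamma>"
    by (simp add: contr_apply deg)
  then show ?thesis using vanishes_onD[OF alt _ span_frame] by blast
qed

lemma iota_eqI:
  assumes "is_form 2 \<gamma>" "\<gamma> \<^bold>\<and> \<omega> = \<beta>"
  shows "iota \<omega> \<beta> = \<gamma>"
  unfolding iota_def
proof (rule the_equality)
  fix \<gamma>' assume "is_form 2 \<gamma>' \<and> \<gamma>' \<^bold>\<and> \<omega> = \<beta>"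
  then have "is_form 2 (\<gamma>' - \<gamma>)" "(\<gamma>' - \<gamma>) \<^bold>\<and> \<omega> = 0"
    using assms is_form_diff[of 2 \<gamma>' \<gamma>] by simp_all
  then have "\<gamma>' - \<gamma> = 0" by (rule wedge_\<omega>_inject)
  then show "\<gamma>' = \<gamma>" by simp
qed (use assms in auto)

lemma wedge_\<omega>_surj:
  assumes "altm \<beta>" "\<And>xs. length xs \<noteq> 4 \<Longrightarrow> \<beta> xs = 0"
  obtains \<gamma> where "is_form 2 \<gamma>" "\<gamma> \<^bold>\<and> \<omega> = \<beta>"
proof
  let ?a = "\<beta> [x1, J x1, x2, J x2]" and ?b = "\<beta> [x1, J x1, x3, J x3]" and ?c = "\<beta> [x2, J x2, x3, J x3]"
  \<comment> \<open>The component of \<open>\<beta>\<close> on a pair of complex lines is the sum of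
    the two diagonal coefficients there; the first three coefficients solve this system.\<close>
  let ?\<gamma> = "((?a + ?b - ?c) / 2) \<cdot> (X1 \<^bold>\<and> Y1) + ((?a + ?c - ?b) / 2) \<cdot> (X2 \<^bold>\<and> Y2) + ((?b + ?c - ?a) / 2) \<cdot> (X3 \<^bold>\<and> Y3)
    + \<beta> [x1, x2, x3, J x3] \<cdot> (X1 \<^bold>\<and> X2) + \<beta> [x1, J x2, x3, J x3] \<cdot> (X1 \<^bold>\<and> Y2)
    + \<beta> [J x1, x2, x3, J x3] \<cdot> (Y1 \<^bold>\<and> X2) + \<beta> [J x1, J x2, x3, J x3] \<cdot> (Y1 \<^bold>\<and> Y2)
    + \<beta> [x1, x2, J x2, x3] \<cdot> (X1 \<^bold>\<and> X3) + \<beta> [x1, x2, J x2, J x3] \<cdot> (X1 \<^bold>\<and> Y3)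
    + \<beta> [J x1, x2, J x2, x3] \<cdot> (Y1 \<^bold>\<and> X3) + \<beta> [J x1, x2, J x2, J x3] \<cdot> (Y1 \<^bold>\<and> Y3)
    + \<beta> [x1, J x1, x2, x3] \<cdot> (X2 \<^bold>\<and> X3) + \<beta> [x1, J x1, x2, J x3] \<cdot> (X2 \<^bold>\<and> Y3)
    + \<beta> [x1, J x1, J x2, x3] \<cdot> (Y2 \<^bold>\<and> X3) + \<beta> [x1, J x1, J x2, J x3] \<cdot> (Y2 \<^bold>\<and> Y3)"
  have two: "(flat v \<^bold>\<and> flat w) xs = 0" if "length xs \<noteq> 2" for v w xs
    using that by (cases xs; cases "tl xs"; cases "tl (tl xs)") (auto simp: wedge_Cons fscale_apply flat_Cons unit_form_apply)
  show "is_form 2 ?\<gamma>"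
    by (rule altm_is_form) (simp_all add: fscale_apply two)
  have 1: "\<beta> = ?a \<cdot> (X1 \<^bold>\<and> Y1 \<^bold>\<and> X2 \<^bold>\<and> Y2) + ?b \<cdot> (X1 \<^bold>\<and> Y1 \<^bold>\<and> X3 \<^bold>\<and> Y3) + ?c \<cdot> (X2 \<^bold>\<and> Y2 \<^bold>\<and> X3 \<^bold>\<and> Y3)
    + \<beta> [x1, x2, x3, J x3] \<cdot> (X1 \<^bold>\<and> X2 \<^bold>\<and> X3 \<^bold>\<and> Y3) + \<beta> [x1, J x2, x3, J x3] \<cdot> (X1 \<^bold>\<and> Y2 \<^bold>\<and> X3 \<^bold>\<and> Y3)
    + \<beta> [J x1, x2, x3, J x3] \<cdot> (Y1 \<^bold>\<and> X2 \<^bold>\<and> X3 \<^bold>\<and> Y3) + \<beta> [J x1, J x2, x3, J x3] \<cdot> (Y1 \<^bold>\<and> Y2 \<^bold>\<and> X3 \<^bold>\<and> Y3)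
    + \<beta> [x1, x2, J x2, x3] \<cdot> (X1 \<^bold>\<and> X2 \<^bold>\<and> Y2 \<^bold>\<and> X3) + \<beta> [x1, x2, J x2, J x3] \<cdot> (X1 \<^bold>\<and> X2 \<^bold>\<and> Y2 \<^bold>\<and> Y3)
    + \<beta> [J x1, x2, J x2, x3] \<cdot> (Y1 \<^bold>\<and> X2 \<^bold>\<and> Y2 \<^bold>\<and> X3) + \<beta> [J x1, x2, J x2, J x3] \<cdot> (Y1 \<^bold>\<and> X2 \<^bold>\<and> Y2 \<^bold>\<and> Y3)
    + \<beta> [x1, J x1, x2, x3] \<cdot> (X1 \<^bold>\<and> Y1 \<^bold>\<and> X2 \<^bold>\<and> X3) + \<beta> [x1, J x1, x2, J x3] \<cdot> (X1 \<^bold>\<and> Y1 \<^bold>\<and> X2 \<^bold>\<and> Y3)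
    + \<beta> [x1, J x1, J x2, x3] \<cdot> (X1 \<^bold>\<and> Y1 \<^bold>\<and> Y2 \<^bold>\<and> X3) + \<beta> [x1, J x1, J x2, J x3] \<cdot> (X1 \<^bold>\<and> Y1 \<^bold>\<and> Y2 \<^bold>\<and> Y3)"
    (is "_ = ?\<beta>")
    by (rule form_eq_on_frame)
      (simp_all add: assms(1), simp_all add: fscale_apply unit_form_apply contr_apply assms(2))
  have 2: "?\<gamma> \<^bold>\<and> \<omega> = ?\<beta>"
    unfolding \<omega>_eq by (simp add: flat_sort) (auto simp: fun_eq_iff fscale_apply field_simps)
  show "?\<gamma> \<^bold>\<and> \<omega> = \<beta>" by (rule trans[OF 2 1[symmetric]])
qed

end

section \<open>The right-hand side of the balanced flow\<close>

locale almost_abelian_frame = almost_abelian \<mu> J D \<epsilon> + unitary_frame J g x1 x2 x3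
  for \<mu> :: "'g::euclidean_space \<Rightarrow> 'g \<Rightarrow> 'g" and J D \<epsilon> g x1 x2 x3
begin

sublocale almost_abelian_hermitian \<mu> J D \<epsilon> g "some_onb g" ..

lemma del_simps [simp]: "altm \<alpha> \<Longrightarrow> altm (del \<mu> J \<alpha>)" "altm \<alpha> \<Longrightarrow> altm (delbar \<mu> J \<alpha>)"
  "del \<mu> J 0 = 0" "delbar \<mu> J 0 = 0"
  using D(1) by (simp_all add: del_eq delbar_eq)

lemma del_adj_eq: "del_adj \<mu> J \<omega> \<alpha> = - hodge J \<omega> (delbar \<mu> J (hodge J \<omega> \<alpha>))"
  and delbar_adj_eq: "delbar_adj \<mu> J \<omega> \<alpha> = - hodge J \<omega> (del \<mu> J (hodge J \<omega> \<alpha>))"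
  by (simp_all add: del_adj_def delbar_adj_def fun_eq_iff)

lemma adj_simps [simp]: "altm (del_adj \<mu> J \<omega> \<alpha>)" "altm (delbar_adj \<mu> J \<omega> \<alpha>)"
  "del_adj \<mu> J \<omega> 0 = 0" "delbar_adj \<mu> J \<omega> 0 = 0"
  by (simp_all add: del_adj_eq delbar_adj_eq)

lemma bott_chern_laplacian_eq:
  "bott_chern_laplacian \<mu> J \<omega> \<alpha> =
     del \<mu> J (delbar \<mu> J (delbar_adj \<mu> J \<omega> (del_adj \<mu> J \<omega> \<alpha>)))
   + delbar_adj \<mu> J \<omega> (del_adj \<mu> J \<omega> (del \<mu> J (delbar \<mu> J \<alpha>)))
   + delbar_adj \<mu> J \<omega> (del \<mu> J (del_adj \<mu> J \<omega> (delbar \<mu> J \<alpha>)))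
   + del_adj \<mu> J \<omega> (delbar \<mu> J (delbar_adj \<mu> J \<omega> (del \<mu> J \<alpha>)))
   + delbar_adj \<mu> J \<omega> (delbar \<mu> J \<alpha>) + del_adj \<mu> J \<omega> (del \<mu> J \<alpha>)"
  by (simp add: bott_chern_laplacian_def Let_def fun_eq_iff)

lemma balanced_flow_rhs_eq:
  "balanced_flow_rhs \<mu> J \<omega> = (1/2) \<cdot> iota \<omega> (bott_chern_laplacian \<mu> J \<omega> (\<omega> \<^bold>\<and> \<omega>))"
proof -
  have \<rho>: "chern_ricci_form \<mu> J \<omega> = 0"
    unfolding \<omega>_def by (rule chern_ricci_form_eq_0)
  have i0: "iota \<omega> 0 = 0"
    by (rule iota_eqI) (simp_all add: is_form_def linear_zero)
  have z: "(\<lambda>ys. \<i> * del \<mu> J (delbar \<mu> J (hodge J \<omega> (chern_ricci_form \<mu> J \<omega> \<^bold>\<and> \<omega>))) ys) = 0"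
    unfolding \<rho> by (simp add: fun_eq_iff)
  have d: "DIM('g) div 2 = 3" "(3::nat) - 2 = Suc 0" "(3::nat) - 1 = 2"
    using dim by simp_all
  show ?thesis
    unfolding balanced_flow_rhs_def Let_def d wedge_power_\<omega> z i0
    by (simp add: fun_eq_iff fscale_apply)
qed

end

text \<open>
  In complex notation the frame makes \<open>D\<close> upper triangular: \<open>D x\<^sub>1 = 0\<close>, \<open>D x\<^sub>2 = \<lambda>\<^sub>1 x\<^sub>2\<close> and
  \<open>D x\<^sub>3 = b x\<^sub>2 + \<lambda>\<^sub>2 x\<^sub>3\<close> with \<open>\<lambda>\<^sub>1 = al + i nu\<close>, \<open>\<lambda>\<^sub>2 = - al + i nu'\<close> and \<open>b = br + i bi\<close>.
\<close>

locale balanced_frame = almost_abelian_frame +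
  fixes al nu nu' br bi \<delta> :: real
  assumes D1: "D x1 = 0"
    and D2: "D x2 = al *\<^sub>R x2 + nu *\<^sub>R J x2"
    and D3: "D x3 = br *\<^sub>R x2 + bi *\<^sub>R J x2 - al *\<^sub>R x3 + nu' *\<^sub>R J x3"
    and \<epsilon>_frame: "\<epsilon> x1 = 0" "\<epsilon> x2 = 0" "\<epsilon> (J x2) = 0" "\<epsilon> x3 = 0" "\<epsilon> (J x3) = 0" "\<epsilon> (J x1) = \<delta>"
    and \<delta>: "\<delta> \<noteq> 0"
begin

lemma \<epsilon>_eq_g: "\<epsilon> = (\<lambda>x. \<delta> * g (J x1) x)"
  by (rule linear_eq_on_frame) (auto simp: \<epsilon>_frame linear_iff g_simps \<epsilon>_simps algebra_simps)

lemma D_frame: "D (J x1) = 0" "D (J x2) = al *\<^sub>R J x2 - nu *\<^sub>R x2"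
  "D (J x3) = br *\<^sub>R J x2 - bi *\<^sub>R x2 - al *\<^sub>R J x3 - nu' *\<^sub>R x3"
  by (simp_all add: D(2) D1 D2 D3 J_simps)

lemma flat_eqI:
  assumes "linear h" "\<And>v. v \<in> set frame_list \<Longrightarrow> h v = g w v"
  shows "one_form (\<lambda>x. complex_of_real (h x)) = flat w"
  unfolding flat_def using linear_eq_on_frame[OF assms(1) linear_g(1) assms(2)] by simp

lemma linear_g_D: "linear (\<lambda>x. g v (D x))"
  using linear_compose[OF D(1) linear_g(1)] by (simp add: comp_def)

lemma flat_linear: "flat (v + w) = flat v + flat w" "flat (v - w) = flat v - flat w" "flat (- v) = - flat v"
  "flat (c *\<^sub>R v) = complex_of_real c \<cdot> flat v" "flat 0 = 0"
  unfolding flat_def by (simp_all add: g_simps one_form_linear)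

lemma dact_flat: "dact D (flat v) = one_form (\<lambda>x. complex_of_real (g v (D x)))"
  by (simp add: flat_def)

lemma dact_frame [simp]:
  "dact D X1 = 0" "dact D Y1 = 0"
  "dact D X2 = flat (al *\<^sub>R x2 - nu *\<^sub>R J x2 + br *\<^sub>R x3 - bi *\<^sub>R J x3)"
  "dact D Y2 = flat (nu *\<^sub>R x2 + al *\<^sub>R J x2 + bi *\<^sub>R x3 + br *\<^sub>R J x3)"
  "dact D X3 = flat (- (al *\<^sub>R x3) - nu' *\<^sub>R J x3)"
  "dact D Y3 = flat (nu' *\<^sub>R x3 - al *\<^sub>R J x3)"
proof -
  have "dact D X1 = flat 0" "dact D Y1 = flat 0"
    unfolding dact_flat by (rule flat_eqI[OF linear_g_D]; auto simp: D_frame D1 D2 D3 g_simps)+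
  then show "dact D X1 = 0" "dact D Y1 = 0" by (simp_all add: flat_linear)
qed (unfold dact_flat, (rule flat_eqI[OF linear_g_D]; auto simp: D_frame D1 D2 D3 g_simps)+)

text \<open>Only the difference of the imaginary parts matters: adding a multiple of
  \<open>J\<close> on the plane to \<open>D\<close> does not change the derivation on the
  J-invariant forms \<open>eta\<close>.\<close>

abbreviation "dn \<equiv> nu - nu'"

text \<open>In matrix terms H goes to A^* H + H A, for the triangular complex matrix A of
  \<open>D\<close>.\<close>

lemma dact_eta: "dact D (eta k1 k2 kr ki) =
  eta (2 * al * k1) (2 * (br * kr + bi * ki) - 2 * al * k2) (br * k1 + dn * ki) (bi * k1 - dn * kr)"
  unfolding eta_def
  by (simp add: flat_linear flat_sort) (simp add: fun_eq_iff fscale_apply algebra_simps)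

lemma \<theta>_flat: "\<theta> = complex_of_real \<delta> \<cdot> (X1 + \<i> \<cdot> Y1)" "\<theta>' = complex_of_real \<delta> \<cdot> (X1 - \<i> \<cdot> Y1)"
  unfolding \<theta>_def \<theta>'_def flat_def fun_cong[OF \<epsilon>_eq_g]
  by (auto simp: fun_eq_iff one_form_def fscale_apply g_J algebra_simps split: list.split)

lemma hodge_\<theta>_eta:
  "hodge J \<omega> (\<theta>' \<^bold>\<and> eta k1 k2 kr ki) = \<i> \<cdot> (\<theta>' \<^bold>\<and> eta k2 k1 (- kr) (- ki))"
  "hodge J \<omega> (\<theta> \<^bold>\<and> \<theta>' \<^bold>\<and> eta k1 k2 kr ki) = (- 2 * \<i> * complex_of_real (\<delta>^2)) \<cdot> eta k2 k1 (- kr) (- ki)"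
  "\<theta> \<^bold>\<and> \<theta>' \<^bold>\<and> \<beta> = (- 2 * \<i> * complex_of_real (\<delta>^2)) \<cdot> (X1 \<^bold>\<and> Y1 \<^bold>\<and> \<beta>)"
proof -
  show *: "\<theta> \<^bold>\<and> \<theta>' \<^bold>\<and> \<beta> = (- 2 * \<i> * complex_of_real (\<delta>^2)) \<cdot> (X1 \<^bold>\<and> Y1 \<^bold>\<and> \<beta>)" for \<beta>
    unfolding \<theta>_flat by (simp add: flat_sort power2_eq_square) (auto simp: fun_eq_iff fscale_apply)
  show "hodge J \<omega> (\<theta>' \<^bold>\<and> eta k1 k2 kr ki) = \<i> \<cdot> (\<theta>' \<^bold>\<and> eta k2 k1 (- kr) (- ki))"
    unfolding \<theta>_flat by (simp add: hodge_eta algebra_simps)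
  show "hodge J \<omega> (\<theta> \<^bold>\<and> \<theta>' \<^bold>\<and> eta k1 k2 kr ki) = (- 2 * \<i> * complex_of_real (\<delta>^2)) \<cdot> eta k2 k1 (- kr) (- ki)"
    unfolding * by (simp add: hodge_eta)
qed

lemma \<omega>_eq_eta: "\<omega> = X1 \<^bold>\<and> Y1 + eta 1 1 0 0"
  by (simp add: \<omega>_eq eta_def algebra_simps)

lemma wedge_rotate: "\<omega> \<^bold>\<and> \<beta> = \<beta> \<^bold>\<and> \<omega>"
proof -
  have "flat v \<^bold>\<and> flat w \<^bold>\<and> \<beta> = \<beta> \<^bold>\<and> flat v \<^bold>\<and> flat w" for v w
  proof -
    have "\<beta> \<^bold>\<and> flat v \<^bold>\<and> flat w = flat v \<^bold>\<and> gsgn \<beta> \<^bold>\<and> flat w"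
      using wedge_one_form_commute[of \<beta>] unfolding flat_def by (metis wedge_assoc)
    also have "gsgn \<beta> \<^bold>\<and> flat w = flat w \<^bold>\<and> \<beta>"
      using wedge_one_form_commute[of "gsgn \<beta>"] unfolding flat_def by simp
    finally show ?thesis ..
  qed
  then show ?thesis by (simp add: \<omega>_eq)
qed

text \<open>Let A be the trace-free part of the complex matrix of \<open>D\<close> on the plane, and
  S its Hermitian part. Then \<open>nA\<close> is |A|^2, and \<open>H0\<close> is |S|^4 +
  |[A, A^*]|^2 / 8.\<close>

definition "H0 = (2 * al^2 + (br^2 + bi^2) / 2)^2 + (br^2 + bi^2)^2 / 4 + (al^2 + dn^2 / 4) * (br^2 + bi^2)"
definition "nA = 2 * (al^2 + dn^2 / 4) + (br^2 + bi^2)"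

lemma eta_scale: "complex_of_real c \<cdot> eta k1 k2 kr ki = eta (c * k1) (c * k2) (c * kr) (c * ki)"
  by (simp add: eta_def)

text \<open>Read from right to left this computes \<open>iota \<omega>\<close>: half of the trace of
  the matrix becomes the coefficient on the first complex line, and the trace-free part
  stays.\<close>

lemma wedge_\<omega>_lefschetz:
  "(complex_of_real h \<cdot> (X1 \<^bold>\<and> Y1) + eta (- m) m r i) \<^bold>\<and> \<omega> = X1 \<^bold>\<and> Y1 \<^bold>\<and> eta (h - m) (h + m) r i"
  unfolding eta_def \<omega>_eq by (simp add: flat_sort) (simp add: fun_eq_iff fscale_apply algebra_simps)

text \<open>With A as for \<open>H0\<close>, the \<open>eta\<close> part is [A, A^*] times - |A|^2 /
  2. In particular it is trace-free.\<close>

theorem balanced_flow_rhs_frame: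
  "balanced_flow_rhs \<mu> J \<omega> = complex_of_real (\<delta>^4) \<cdot>
    (complex_of_real H0 \<cdot> (X1 \<^bold>\<and> Y1)
      + eta (- nA * (br^2 + bi^2) / 2) (nA * (br^2 + bi^2) / 2)
          (nA * (al * br + dn / 2 * bi)) (nA * (al * bi - dn / 2 * br)))" (is "_ = ?R")
proof -
  have \<psi>: "dact D (\<omega> \<^bold>\<and> \<omega>) = 2 \<cdot> (X1 \<^bold>\<and> Y1 \<^bold>\<and> eta (2 * al) (- 2 * al) br bi)"
  proof -
    have "dact D (\<omega> \<^bold>\<and> \<omega>) = 2 \<cdot> (dact D \<omega> \<^bold>\<and> \<omega>)"
      by (simp add: wedge_rotate[of "dact D \<omega>"] fun_eq_iff fscale_apply)
    also have "dact D \<omega> = eta (2 * al) (- 2 * al) br bi"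
      by (simp add: \<omega>_eq_eta dact_eta)
    also have "\<dots> \<^bold>\<and> \<omega> = X1 \<^bold>\<and> Y1 \<^bold>\<and> eta (2 * al) (- 2 * al) br bi"
      unfolding wedge_rotate[symmetric] by (simp add: \<omega>_eq_eta wedge_rotate[symmetric], simp add: eta_def flat_sort)
    finally show ?thesis .
  qed
  \<comment> \<open>\<open>\<theta>\<close> and \<open>\<theta>'\<close> involve only X1 and Y1, so
    they annihilate the product found in \<open>\<psi>\<close>. Hence five of the six terms of the
    Bott-Chern Laplacian vanish on the square of \<open>\<omega>\<close>.\<close>
  have 0: "del \<mu> J (\<omega> \<^bold>\<and> \<omega>) = 0" "delbar \<mu> J (\<omega> \<^bold>\<and> \<omega>) = 0"
    by (simp_all add: del_eq delbar_eq \<psi> \<theta>_flat flat_sort del: dact_wedge)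
  let ?k1 = "4 * al^2" and ?k2 = "2 * (br^2 + bi^2) + 4 * al^2" and ?kr = "2 * al * br + dn * bi" and ?ki = "2 * al * bi - dn * br"
  have d\<omega>: "dact D \<omega> = eta (2 * al) (- 2 * al) br bi"
    by (simp add: \<omega>_eq_eta dact_eta)
  have 1: "del_adj \<mu> J \<omega> (\<omega> \<^bold>\<and> \<omega>) = - (\<theta>' \<^bold>\<and> eta (- 2 * al) (2 * al) (- br) (- bi))"
    by (simp add: del_adj_eq hodge_\<omega>_\<omega> delbar_eq d\<omega> hodge_\<theta>_eta)
  have 2: "delbar_adj \<mu> J \<omega> (del_adj \<mu> J \<omega> (\<omega> \<^bold>\<and> \<omega>))
    = (\<i> * complex_of_real (\<delta>^2)) \<cdot> eta ?k2 ?k1 (- ?kr) (- ?ki)"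
    unfolding 1 by (simp add: delbar_adj_eq del_eq hodge_\<theta>_eta dact_eta)
      (simp add: algebra_simps power2_eq_square hodge_eta)
  let ?m1 = "2 * al * (2 * al * ?k2)"
  let ?m2 = "2 * (br * (br * ?k2 - dn * ?ki) + bi * (bi * ?k2 + dn * ?kr)) - 2 * al * (2 * (- br * ?kr - bi * ?ki) - 2 * al * ?k1)"
  let ?mr = "br * (2 * al * ?k2) + dn * (bi * ?k2 + dn * ?kr)"
  let ?mi = "bi * (2 * al * ?k2) - dn * (br * ?k2 - dn * ?ki)"
  have 3: "del \<mu> J (delbar \<mu> J (delbar_adj \<mu> J \<omega> (del_adj \<mu> J \<omega> (\<omega> \<^bold>\<and> \<omega>))))
    = complex_of_real (\<delta>^4 / 2) \<cdot> (X1 \<^bold>\<and> Y1 \<^bold>\<and> eta ?m1 ?m2 ?mr ?mi)"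
    unfolding 2 by (simp add: del_eq delbar_eq hodge_\<theta>_eta dact_eta)
      (simp add: power2_eq_square power4_eq_xxxx algebra_simps)
  have L: "bott_chern_laplacian \<mu> J \<omega> (\<omega> \<^bold>\<and> \<omega>) = complex_of_real (\<delta>^4 / 2) \<cdot> (X1 \<^bold>\<and> Y1 \<^bold>\<and> eta ?m1 ?m2 ?mr ?mi)"
    unfolding bott_chern_laplacian_eq 0 3 by simp
  have I: "iota \<omega> (complex_of_real (\<delta>^4 / 2) \<cdot> (X1 \<^bold>\<and> Y1 \<^bold>\<and> eta ?m1 ?m2 ?mr ?mi)) = 2 \<cdot> ?R"
  proof (rule iota_eqI)
    have two: "(flat v \<^bold>\<and> flat w) xs = 0" if "length xs \<noteq> 2" for v w xs
      using that by (cases xs; cases "tl xs"; cases "tl (tl xs)") (auto simp: wedge_Cons fscale_apply flat_Cons unit_form_apply)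
    show "is_form 2 (2 \<cdot> ?R)"
      by (rule altm_is_form) (simp_all add: fscale_apply two eta_def)
    \<comment> \<open>The diagonal is brought into the form h - m, h + m, up to the factor 4, so
      that \<open>wedge_\<omega>_lefschetz\<close> yields the quotient.\<close>
    have c: "?m1 = 4 * H0 - 4 * (nA * (br^2 + bi^2) / 2)" "?m2 = 4 * H0 + 4 * (nA * (br^2 + bi^2) / 2)"
      "?mr = 4 * (nA * (al * br + dn / 2 * bi))" "?mi = 4 * (nA * (al * bi - dn / 2 * br))"
      unfolding H0_def nA_def by (simp_all add: power2_eq_square field_simps)
    show "(2 \<cdot> ?R) \<^bold>\<and> \<omega> = complex_of_real (\<delta>^4 / 2) \<cdot> (X1 \<^bold>\<and> Y1 \<^bold>\<and> eta ?m1 ?m2 ?mr ?mi)"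
    proof -
      have "(2 \<cdot> ?R) \<^bold>\<and> \<omega> = complex_of_real (\<delta>^4 / 2) \<cdot> (X1 \<^bold>\<and> Y1 \<^bold>\<and> (complex_of_real 4 \<cdot>
        eta (H0 - nA * (br^2 + bi^2) / 2) (H0 + nA * (br^2 + bi^2) / 2)
          (nA * (al * br + dn / 2 * bi)) (nA * (al * bi - dn / 2 * br))))"
        using wedge_\<omega>_lefschetz[of H0 "nA * (br^2 + bi^2) / 2" "nA * (al * br + dn / 2 * bi)" "nA * (al * bi - dn / 2 * br)"]
        unfolding minus_mult_left minus_divide_left by (simp only: wedge_linear(4,9) fscale_simps(7)) simp
      then show ?thesis
        unfolding c eta_scale by (simp add: right_diff_distrib distrib_left)
    qed
  qed
  have half: "(1/2) \<cdot> 2 \<cdot> \<alpha> = \<alpha>" for \<alpha> :: "'a form" by simp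
  show ?thesis
    unfolding balanced_flow_rhs_eq L I by (rule half)
qed

end

section \<open>Lipschitz dependence of the flow on the metric\<close>

primrec basis_expansion :: "'g list \<Rightarrow> 'g::euclidean_space form \<Rightarrow> 'g form" where
  "basis_expansion [] \<beta> = \<beta> [] \<cdot> unit_form"
| "basis_expansion (b # bs) \<beta> = basis_expansion bs \<beta>
    + one_form (\<lambda>x. complex_of_real (b \<bullet> x)) \<^bold>\<and> basis_expansion bs (contr b \<beta>)"

lemma linear_complex_inner: "linear (\<lambda>x. complex_of_real (b \<bullet> x))"
  by (simp add: linear_iff inner_add_right scaleR_conv_of_real)

lemma altm_basis_expansion [simp]: "altm (basis_expansion bs \<beta>)"
  by (induction bs arbitrary: \<beta>) (simp_all add: linear_complex_inner altm_one_form altm_wedge)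

lemma contr_basis_expansion:
  assumes "\<And>c. c \<in> set bs \<Longrightarrow> c \<bullet> x = 0"
  shows "contr x (basis_expansion bs \<beta>) = 0"
  using assms
  by (induction bs arbitrary: \<beta>) (simp_all del: zero_fun_apply)

lemma vanishes_on_one_form_wedge:
  assumes "\<And>c. c \<in> set bs \<Longrightarrow> \<phi> c = 0"
  shows "vanishes_on bs (one_form \<phi> \<^bold>\<and> \<beta>)"
  using assms
  by (induction bs arbitrary: \<beta>) (simp_all add: vanishes_on_linear(3), simp add: one_form_def)

lemma vanishes_on_basis_expansion:
  assumes "set bs \<subseteq> Basis" "distinct bs"
  shows "vanishes_on bs (\<beta> - basis_expansion bs \<beta>)"
  using assms
proof (induction bs arbitrary: \<beta>)
  case Nil
  show ?case by (simp add: fscale_apply unit_form_apply)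
next
  case (Cons b bs)
  then have 0: "\<And>c. c \<in> set bs \<Longrightarrow> b \<bullet> c = 0" "\<And>c. c \<in> set bs \<Longrightarrow> c \<bullet> b = 0" and b: "b \<bullet> b = 1"
    by (auto simp: inner_same_Basis subset_iff) (metis inner_not_same_Basis)+
  let ?w = "\<lambda>\<beta>. one_form (\<lambda>x. complex_of_real (b \<bullet> x)) \<^bold>\<and> basis_expansion bs \<beta>"
  have w: "vanishes_on bs (- one_form (\<lambda>x. complex_of_real (b \<bullet> x)) \<^bold>\<and> \<gamma>)" 
    "vanishes_on bs (one_form (\<lambda>x. complex_of_real (b \<bullet> x)) \<^bold>\<and> \<gamma>)" for \<gamma>
    using vanishes_on_one_form_wedge[of bs "\<lambda>x. complex_of_real (b \<bullet> x)" \<gamma>] 0 by (simp_all add: vanishes_on_linear(3))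
  have "vanishes_on bs ((\<beta> - basis_expansion bs \<beta>) + - ?w (contr b \<beta>))"
    using Cons.IH[of \<beta>] Cons.prems w by (intro vanishes_on_linear(1)) (simp_all del: minus_apply)
  moreover have "contr b (\<beta> - basis_expansion (b # bs) \<beta>) = contr b \<beta> - basis_expansion bs (contr b \<beta>)"
    by (simp add: contr_basis_expansion 0 b)
  ultimately show ?case
    using Cons.IH[of "contr b \<beta>"] Cons.prems
    by (simp only: vanishes_on.simps basis_expansion.simps) (simp add: algebra_simps del: minus_apply plus_fun_apply)
qed

lemma basis_expansion_eq:
  fixes \<beta> :: "'g::euclidean_space form"
  assumes "altm \<beta>" "set bs = Basis" "distinct bs"
  shows "basis_expansion bs \<beta> = \<beta>"
proof -
  have "span (set bs) = UNIV" using assms(2) by simp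
  then have "\<beta> - basis_expansion bs \<beta> = 0"
    using vanishes_onD[OF altm_diff[OF assms(1) altm_basis_expansion] vanishes_on_basis_expansion] assms by simp
  then show ?thesis by simp
qed

section \<open>Bounded Lipschitz functions of the metric\<close>

definition metric_ball :: "('g \<Rightarrow> 'g) \<Rightarrow> real \<Rightarrow> real \<Rightarrow> ('g::euclidean_space \<Rightarrow> 'g \<Rightarrow> real) set" where
  "metric_ball J c C = {g. hermitian_metric J g \<and> (\<forall>x. c * (x \<bullet> x) \<le> g x x) \<and> (\<forall>x y. \<bar>g x y\<bar> \<le> C * norm x * norm y)}"

definition metric_dist :: "('g::euclidean_space \<Rightarrow> 'g \<Rightarrow> real) \<Rightarrow> ('g \<Rightarrow> 'g \<Rightarrow> real) \<Rightarrow> real" where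
  "metric_dist g g' = (\<Sum>b\<in>Basis. \<Sum>b'\<in>Basis. \<bar>g b b' - g' b b'\<bar>)"

text \<open>The bound is part of the notion so that it is closed under products.\<close>

definition lip_on :: "('g::euclidean_space \<Rightarrow> 'g \<Rightarrow> real) set \<Rightarrow> (('g \<Rightarrow> 'g \<Rightarrow> real) \<Rightarrow> complex) \<Rightarrow> bool" where
  "lip_on K F \<longleftrightarrow> (\<exists>L\<ge>0. \<forall>g\<in>K. norm (F g) \<le> L \<and> (\<forall>g'\<in>K. norm (F g - F g') \<le> L * metric_dist g g'))"

lemma metric_dist_nonneg: "0 \<le> metric_dist g g'"
  unfolding metric_dist_def by (intro sum_nonneg) simp

lemma lip_onI: "0 \<le> L \<Longrightarrow> 0 \<le> M \<Longrightarrow> (\<And>g. g \<in> K \<Longrightarrow> norm (F g) \<le> L) \<Longrightarrow>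
  (\<And>g g'. g \<in> K \<Longrightarrow> g' \<in> K \<Longrightarrow> norm (F g - F g') \<le> M * metric_dist g g') \<Longrightarrow> lip_on K F"
  unfolding lip_on_def
  by (rule exI[of _ "L + M"]) (smt (verit) metric_dist_nonneg mult_right_mono)

lemma lip_on_cong: "(\<And>g. g \<in> K \<Longrightarrow> F g = G g) \<Longrightarrow> lip_on K F \<longleftrightarrow> lip_on K G"
  unfolding lip_on_def by (intro ex_cong1) auto

lemma lip_on_const [simp]: "lip_on K (\<lambda>_. c)"
  by (rule lip_onI[of "norm c" 0]) auto

lemma lip_on_add [intro]:
  assumes "lip_on K F" "lip_on K G" shows "lip_on K (\<lambda>g. F g + G g)"
proof -
  from assms obtain L M where L: "0 \<le> L" "\<And>g. g \<in> K \<Longrightarrow> norm (F g) \<le> L"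
      "\<And>g g'. g \<in> K \<Longrightarrow> g' \<in> K \<Longrightarrow> norm (F g - F g') \<le> L * metric_dist g g'"
    and M: "0 \<le> M" "\<And>g. g \<in> K \<Longrightarrow> norm (G g) \<le> M"
      "\<And>g g'. g \<in> K \<Longrightarrow> g' \<in> K \<Longrightarrow> norm (G g - G g') \<le> M * metric_dist g g'"
    unfolding lip_on_def by auto
  show ?thesis
  proof (rule lip_onI[of "L + M" "L + M"])
    fix g g' assume g: "g \<in> K" "g' \<in> K"
    have "norm (F g + G g - (F g' + G g')) \<le> norm (F g - F g') + norm (G g - G g')"
      by (metis add_diff_add norm_triangle_ineq)
    then show "norm (F g + G g - (F g' + G g')) \<le> (L + M) * metric_dist g g'"
      using L(3)[OF g] M(3)[OF g] by (simp add: distrib_right)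
  qed (use L M in \<open>auto intro!: norm_triangle_le add_mono\<close>)
qed

lemma lip_on_mult [intro]:
  assumes "lip_on K F" "lip_on K G" shows "lip_on K (\<lambda>g. F g * G g)"
proof -
  from assms obtain L M where L: "0 \<le> L" "\<And>g. g \<in> K \<Longrightarrow> norm (F g) \<le> L"
      "\<And>g g'. g \<in> K \<Longrightarrow> g' \<in> K \<Longrightarrow> norm (F g - F g') \<le> L * metric_dist g g'"
    and M: "0 \<le> M" "\<And>g. g \<in> K \<Longrightarrow> norm (G g) \<le> M"
      "\<And>g g'. g \<in> K \<Longrightarrow> g' \<in> K \<Longrightarrow> norm (G g - G g') \<le> M * metric_dist g g'"
    unfolding lip_on_def by auto
  show ?thesis
  proof (rule lip_onI[of "L * M" "2 * L * M"])
    fix g g' assume g: "g \<in> K" "g' \<in> K"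
    have "norm (F g * G g - F g' * G g') \<le> norm (F g - F g') * norm (G g) + norm (F g') * norm (G g - G g')"
      unfolding norm_mult[symmetric] by (rule norm_triangle_le[THEN order_trans[rotated]]) (auto simp: algebra_simps)
    also have "\<dots> \<le> (L * metric_dist g g') * M + L * (M * metric_dist g g')"
      using L M g by (intro add_mono mult_mono) (auto simp: metric_dist_nonneg)
    finally show "norm (F g * G g - F g' * G g') \<le> 2 * L * M * metric_dist g g'" by simp
  qed (use L M in \<open>auto simp: norm_mult intro!: mult_mono\<close>)
qed

lemma lip_on_sum [intro]:
  "(\<And>i. i \<in> A \<Longrightarrow> lip_on K (\<lambda>g. F g i)) \<Longrightarrow> lip_on K (\<lambda>g. \<Sum>i\<in>A. F g i)"
  by (induction A rule: infinite_finite_induct) auto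

definition lip_form :: "('g::euclidean_space \<Rightarrow> 'g \<Rightarrow> real) set \<Rightarrow> (('g \<Rightarrow> 'g \<Rightarrow> real) \<Rightarrow> 'g form) \<Rightarrow> bool" where
  "lip_form K F \<longleftrightarrow> (\<forall>xs. lip_on K (\<lambda>g. F g xs))"

lemma lip_form_cong: "(\<And>g. g \<in> K \<Longrightarrow> F g = G g) \<Longrightarrow> lip_form K F \<longleftrightarrow> lip_form K G"
  unfolding lip_form_def by (intro all_cong1 lip_on_cong) simp

lemma lip_form_const [simp]: "lip_form K (\<lambda>_. \<alpha>)"
  by (simp add: lip_form_def)

lemma lip_form_add [intro]: "lip_form K F \<Longrightarrow> lip_form K G \<Longrightarrow> lip_form K (\<lambda>g. F g + G g)"
  by (auto simp: lip_form_def)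

lemma lip_form_scale [intro]: "lip_on K c \<Longrightarrow> lip_form K F \<Longrightarrow> lip_form K (\<lambda>g. c g \<cdot> F g)"
  by (auto simp: lip_form_def fscale_apply)

lemma lip_form_uminus [intro]: "lip_form K F \<Longrightarrow> lip_form K (\<lambda>g. - F g)"
  using lip_form_scale[of K "\<lambda>_. - 1" F] by simp

lemma lip_form_contr [intro]: "lip_form K F \<Longrightarrow> lip_form K (\<lambda>g. contr x (F g))"
  by (simp add: lip_form_def contr_apply)

lemma lip_form_wedge [intro]: "lip_form K F \<Longrightarrow> lip_form K G \<Longrightarrow> lip_form K (\<lambda>g. F g \<^bold>\<and> G g)"
  unfolding lip_form_def wedge_def by (intro allI lip_on_sum lip_on_mult) auto

lemma lip_form_dact [intro]: "lip_form K F \<Longrightarrow> lip_form K (\<lambda>g. dact D (F g))"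
  unfolding lip_form_def
proof
  fix xs assume "\<forall>xs. lip_on K (\<lambda>g. F g xs)"
  then show "lip_on K (\<lambda>g. dact D (F g) xs)"
    by (induction xs arbitrary: F) (auto simp: dact_Cons contr_apply)
qed

section \<open>Existence of unitary frames\<close>

lemma (in hermitian_space) orthogonal_vector_exists:
  assumes "finite S" "card S < DIM('g)"
  obtains v where "v \<noteq> 0" "\<And>s. s \<in> S \<Longrightarrow> g s v = 0"
proof -
  define T where "T s = (\<Sum>b\<in>Basis. g s b *\<^sub>R b)" for s
  have T: "T s \<bullet> v = g s v" for s v
    using linear_euclidean_sum[OF linear_g(1), of s v]
    by (simp add: T_def inner_sum_left inner_commute[of v] mult.commute)
  have "dim (T ` S) < DIM('g)"
    using dim_le_card'[of "T ` S"] card_image_le[of S T] assms by simp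
  then have "span (T ` S) \<noteq> UNIV"
    by (metis dim_UNIV dim_span less_irrefl)
  then obtain v where "v \<noteq> 0" "\<And>w. w \<in> span (T ` S) \<Longrightarrow> v \<bullet> w = 0"
    using span_not_UNIV_orthogonal by blast
  then show thesis
    using that[of v] T by (metis imageI inner_commute span_base)
qed

lemma (in hermitian_space) unit_vector:
  assumes "v \<noteq> 0"
  shows "g ((1 / sqrt (g v v)) *\<^sub>R v) ((1 / sqrt (g v v)) *\<^sub>R v) = 1"
  using g_pos[OF assms] by (simp add: g_simps real_sqrt_mult_self)

text \<open>Gram-Schmidt over the complex numbers: each new vector is orthogonal to the previous
  ones and to their images under \<open>J\<close>, at most four conditions in dimension six.\<close>

lemma (in hermitian_space) unitary_frame_exists:
  assumes "DIM('g) = 6"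
  obtains x1 x2 x3 where "unitary_frame J g x1 x2 x3"
proof -
  let ?u = "\<lambda>v. (1 / sqrt (g v v)) *\<^sub>R v"
  obtain v1 :: 'g where v1: "v1 \<noteq> 0" using nonempty_Basis nonzero_Basis by blast
  define x1 where "x1 = ?u v1"
  have "card {x1, J x1} < DIM('g)" using card_insert_le_m1[of 2 "{J x1}"] assms by (simp add: card_insert_if)
  then obtain v2 where v2: "v2 \<noteq> 0" "\<And>s. s \<in> {x1, J x1} \<Longrightarrow> g s v2 = 0"
    using orthogonal_vector_exists[of "{x1, J x1}"] by auto
  define x2 where "x2 = ?u v2"
  have "card {x1, J x1, x2, J x2} < DIM('g)" using assms by (simp add: card_insert_if)
  then obtain v3 where v3: "v3 \<noteq> 0" "\<And>s. s \<in> {x1, J x1, x2, J x2} \<Longrightarrow> g s v3 = 0"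
    using orthogonal_vector_exists[of "{x1, J x1, x2, J x2}"] by auto
  define x3 where "x3 = ?u v3"
  have x2_eq: "g y x2 = g y v2 / sqrt (g v2 v2)" and x3_eq: "g y x3 = g y v3 / sqrt (g v3 v3)" for y
    by (simp_all add: x2_def x3_def g_simps)
  have "g x1 x2 = 0" "g (J x1) x2 = 0" "g x1 x3 = 0" "g (J x1) x3 = 0" "g x2 x3 = 0" "g (J x2) x3 = 0"
    using v2(2)[of x1] v2(2)[of "J x1"] v3(2)[of x1] v3(2)[of "J x1"] v3(2)[of x2] v3(2)[of "J x2"]
    by (simp_all only: insert_iff simp_thms g_simps(4) x2_eq x3_eq)
  then have "unitary_frame J g x1 x2 x3"
    using unit_vector[OF v1] unit_vector[OF v2(1)] unit_vector[OF v3(1)] assms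
    by unfold_locales (simp_all add: x1_def x2_def x3_def g_J_left)
  then show thesis by (rule that)
qed

text \<open>
  The Hodge star is defined through an arbitrarily chosen orthonormal basis, which does not depend
  continuously on the metric.  Expanding the form in the fixed basis instead turns it into an
  expression in \<open>sharp\<close>, the inverse of the metric, which does.
\<close>

definition sharp :: "('g::euclidean_space \<Rightarrow> 'g \<Rightarrow> real) \<Rightarrow> 'g \<Rightarrow> 'g" where
  "sharp g b = (SOME v. \<forall>x. g v x = b \<bullet> x)"

lemma (in hermitian_space) g_sharp: "g (sharp g b) x = b \<bullet> x"
proof -
  define T where "T s = (\<Sum>b\<in>Basis. g s b *\<^sub>R b)" for s
  have T: "T s \<bullet> v = g s v" for s v
    using linear_euclidean_sum[OF linear_g(1), of s v]
    by (simp add: T_def inner_sum_left inner_commute[of v] mult.commute)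
  have lin: "linear T"
    unfolding T_def by (auto simp: linear_iff g_simps algebra_simps sum.distrib scaleR_right.sum)
  have "inj T"
    unfolding linear_injective_0[OF lin] by (metis T g_eq_0_iff inner_zero_left)
  then obtain v where "T v = b"
    using linear_injective_imp_surjective[OF lin] by (metis surjD)
  then have "\<exists>v. \<forall>x. g v x = b \<bullet> x" using T by metis
  then show ?thesis unfolding sharp_def by (rule someI2_ex) blast
qed

section \<open>Lipschitz dependence of the inverse metric and the Hodge star\<close>

lemma metric_ballD:
  assumes "g \<in> metric_ball J c C"
  shows "hermitian_metric J g" "c * (x \<bullet> x) \<le> g x x" "\<bar>g x y\<bar> \<le> C * norm x * norm y"
  using assms unfolding metric_ball_def by auto

lemma bilinear_euclidean_sum:
  assumes "bilinear h"
  shows "h x y = (\<Sum>b\<in>Basis. \<Sum>b'\<in>Basis. (x \<bullet> b) * (y \<bullet> b') * (h b b' :: real))"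
proof -
  have "linear (\<lambda>x. h x y)" "\<And>b. linear (h b)" using assms by (auto simp: bilinear_def)
  then have "h x y = (\<Sum>b\<in>Basis. (x \<bullet> b) *\<^sub>R (\<Sum>b'\<in>Basis. (y \<bullet> b') *\<^sub>R h b b'))"
    using linear_euclidean_sum[of "\<lambda>x. h x y" x] linear_euclidean_sum[of "h _" y] by simp
  then show ?thesis by (simp add: sum_distrib_left mult_ac)
qed

lemma metric_dist_bound:
  assumes "bilinear g" "bilinear g'"
  shows "\<bar>g x y - g' x y\<bar> \<le> metric_dist g g' * norm x * norm y"
proof -
  have "\<bar>g x y - g' x y\<bar> = \<bar>\<Sum>b\<in>Basis. \<Sum>b'\<in>Basis. (x \<bullet> b) * (y \<bullet> b') * (g b b' - g' b b')\<bar>"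
    unfolding bilinear_euclidean_sum[OF assms(1), of x y] bilinear_euclidean_sum[OF assms(2), of x y]
    by (simp add: sum_subtractf algebra_simps)
  also have "\<dots> \<le> (\<Sum>b\<in>Basis. \<Sum>b'\<in>Basis. \<bar>(x \<bullet> b) * (y \<bullet> b') * (g b b' - g' b b')\<bar>)"
    by (rule order_trans[OF sum_abs] sum_mono sum_abs)+
  also have "\<dots> \<le> (\<Sum>b\<in>Basis. \<Sum>b'\<in>Basis. norm x * norm y * \<bar>g b b' - g' b b'\<bar>)"
    unfolding abs_mult by (intro sum_mono mult_mono) (auto simp: Basis_le_norm)
  also have "\<dots> = metric_dist g g' * norm x * norm y"
    by (simp add: metric_dist_def sum_distrib_left sum_distrib_right mult_ac)
  finally show ?thesis .
qed

locale complex_space =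
  fixes J :: "'g::euclidean_space \<Rightarrow> 'g"
  assumes dim6: "DIM('g) = 6" and lin_J: "linear J" and J2: "J (J x) = - x"

locale metric_family = complex_space J for J :: "'g::euclidean_space \<Rightarrow> 'g" +
  fixes c C :: real
  assumes c: "0 < c"
begin

abbreviation "K \<equiv> metric_ball J c C"

lemma hermitian_K: "g \<in> K \<Longrightarrow> hermitian_space J g"
  by (rule hermitian_space.intro[OF lin_J J2 metric_ballD(1)])

lemma bilinear_K: "g \<in> K \<Longrightarrow> bilinear g"
  using hermitian_space.bilinear_g[OF hermitian_K] .

lemma lip_on_metric: "lip_on K (\<lambda>g. complex_of_real (g x y))"
proof (rule lip_onI[of "\<bar>C\<bar> * norm x * norm y" "norm x * norm y"])
  fix g assume g: "g \<in> K"
  have "C * norm x * norm y \<le> \<bar>C\<bar> * norm x * norm y" by (intro mult_right_mono) auto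
  then show "norm (complex_of_real (g x y)) \<le> \<bar>C\<bar> * norm x * norm y"
    using metric_ballD(3)[OF g, of x y] by simp
  fix g' assume g': "g' \<in> K"
  show "norm (complex_of_real (g x y) - complex_of_real (g' x y)) \<le> norm x * norm y * metric_dist g g'"
    using metric_dist_bound[OF g[THEN bilinear_K] g'[THEN bilinear_K], of x y]
    by (simp only: of_real_diff[symmetric] norm_of_real) (simp add: mult_ac)
qed auto

text \<open>The defining equation of \<open>sharp g b\<close> is tested on that vector itself, where
  the lower bound \<open>c\<close> applies.\<close>

lemma sharp_bound:
  assumes "g \<in> K" shows "norm (sharp g b) \<le> norm b / c"
proof -
  interpret hermitian_space J g by (rule hermitian_K[OF assms])
  let ?v = "sharp g b"
  have "c * (norm ?v * norm ?v) \<le> norm b * norm ?v"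
    using metric_ballD(2)[OF assms, of ?v] norm_cauchy_schwarz[of b ?v]
    by (simp add: g_sharp dot_square_norm power2_eq_square)
  then have "c * norm ?v \<le> norm b"
    by (cases "norm ?v = 0") (auto simp: mult.assoc[symmetric])
  then show ?thesis using c by (simp add: field_simps)
qed

lemma lip_on_sharp: "lip_on K (\<lambda>g. complex_of_real (sharp g b \<bullet> y))"
proof (rule lip_onI[of "norm b / c * norm y" "norm b / c / c * norm y"])
  fix g assume g: "g \<in> K"
  have "\<bar>sharp g b \<bullet> y\<bar> \<le> norm (sharp g b) * norm y" by (rule Cauchy_Schwarz_ineq2)
  also have "\<dots> \<le> norm b / c * norm y" by (intro mult_right_mono sharp_bound[OF g]) simp
  finally show "norm (complex_of_real (sharp g b \<bullet> y)) \<le> norm b / c * norm y" by simp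
  fix g' assume g': "g' \<in> K"
  interpret g: hermitian_space J g by (rule hermitian_K[OF g])
  interpret g': hermitian_space J g' by (rule hermitian_K[OF g'])
  let ?v' = "sharp g' b" and ?w = "sharp g b - sharp g' b"
  have "c * (norm ?w * norm ?w) \<le> g ?w ?w"
    using metric_ballD(2)[OF g, of ?w] by (simp add: dot_square_norm power2_eq_square)
  \<comment> \<open>\<open>sharp g b\<close> for \<open>g\<close> and \<open>?v'\<close> for
    \<open>g'\<close> represent the same functional, so only the change of the metric at
    \<open>?v'\<close> remains.\<close>
  also have "\<dots> = - (g ?v' ?w - g' ?v' ?w)"
    by (simp add: g.g_simps(9)[of _ _ ?w] g.g_sharp g'.g_sharp)
  also have "\<dots> \<le> metric_dist g g' * norm ?v' * norm ?w"
    using metric_dist_bound[OF g.bilinear_g g'.bilinear_g, of ?v' ?w] by linarith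
  finally have "c * norm ?w \<le> metric_dist g g' * norm ?v'"
    by (cases "norm ?w = 0") (auto simp: mult.assoc[symmetric] metric_dist_nonneg)
  also have "\<dots> \<le> metric_dist g g' * (norm b / c)"
    by (intro mult_left_mono sharp_bound[OF g'] metric_dist_nonneg)
  finally have *: "norm ?w \<le> norm b / c / c * metric_dist g g'"
    using c by (simp add: field_simps)
  have "\<bar>?w \<bullet> y\<bar> \<le> norm ?w * norm y" by (rule Cauchy_Schwarz_ineq2)
  also have "\<dots> \<le> norm b / c / c * metric_dist g g' * norm y" by (intro mult_right_mono *) simp
  finally show "norm (complex_of_real (sharp g b \<bullet> y) - complex_of_real (sharp g' b \<bullet> y))
    \<le> norm b / c / c * norm y * metric_dist g g'"
    by (simp only: of_real_diff[symmetric] norm_of_real inner_diff_left[symmetric]) (simp add: mult_ac)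
qed (use c in auto)

lemma lip_form_fundamental: "lip_form K (fundamental_form J)"
proof -
  have "lip_on K (\<lambda>g. fundamental_form J g xs)" for xs
  proof (cases "length xs = 2")
    case True
    then obtain x y where "xs = [x, y]"
      by (metis (no_types, lifting) One_nat_def Suc_1 Suc_length_conv length_0_conv)
    then show ?thesis by (simp add: fundamental_form_def lip_on_metric)
  next
    case False
    then have "fundamental_form J g xs = 0" for g by (auto simp: fundamental_form_def split: list.split)
    then show ?thesis by simp
  qed
  then show ?thesis by (simp add: lip_form_def)
qed

lemma altm_contr_euclidean:
  assumes "altm \<alpha>"
  shows "\<alpha> (v # xs) = (\<Sum>b\<in>Basis. complex_of_real (v \<bullet> b) * \<alpha> (b # xs))"
  by (subst linear_euclidean_sum[OF altm_linear[OF assms], of v]) (simp add: scaleR_conv_of_real)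

lemma lip_on_apply_sharp:
  assumes "lip_form K F" "\<And>g. g \<in> K \<Longrightarrow> altm (F g)"
  shows "lip_on K (\<lambda>g. F g (sharp g b # xs))"
proof (subst lip_on_cong)
  show "F g (sharp g b # xs) = (\<Sum>b'\<in>Basis. complex_of_real (sharp g b \<bullet> b') * F g (b' # xs))" if "g \<in> K" for g
    using altm_contr_euclidean[OF assms(2)[OF that]] .
  show "lip_on K (\<lambda>g. \<Sum>b'\<in>Basis. complex_of_real (sharp g b \<bullet> b') * F g (b' # xs))"
    using assms(1) by (intro lip_on_sum lip_on_mult lip_on_sharp) (simp add: lip_form_def)
qed

lemma lip_form_contr_sharp:
  assumes "lip_form K F" "\<And>g. g \<in> K \<Longrightarrow> altm (F g)"
  shows "lip_form K (\<lambda>g. contr (sharp g b) (F g))"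
  using lip_on_apply_sharp[OF assms] by (simp add: lip_form_def contr_apply)

lemma frame_K:
  assumes "g \<in> K" obtains x1 x2 x3 where "unitary_frame J g x1 x2 x3"
  using hermitian_space.unitary_frame_exists[OF hermitian_K[OF assms] dim6] by blast

text \<open>The induction runs over the fixed basis, for all families \<open>G\<close>, because each
  step contracts the volume form with \<open>sharp g b\<close>.\<close>

lemma lip_form_hsum:
  assumes "lip_form K F" "lip_form K G" "\<And>g. g \<in> K \<Longrightarrow> altm (G g)"
  shows "lip_form K (\<lambda>g. hsum (hermitian_basis.onb_list (some_onb g)) (basis_expansion bs (F g)) (G g))"
  using assms
proof (induction bs arbitrary: F G)
  case Nil
  show ?case
  proof (simp, rule lip_form_scale)
    show "lip_on K (\<lambda>g. F g [])" using Nil(1) by (simp add: lip_form_def)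
  qed (rule Nil)
next
  case (Cons b bs)
  let ?h = "\<lambda>g. hsum (hermitian_basis.onb_list (some_onb g))"
  have *: "?h g (basis_expansion (b # bs) (F g)) (G g) = ?h g (basis_expansion bs (F g)) (G g)
    + ?h g (basis_expansion bs (contr b (F g))) (contr (sharp g b) (G g))" if gK: "g \<in> K" for g
  proof -
    obtain x1 x2 x3 where "unitary_frame J g x1 x2 x3" using frame_K[OF gK] .
    then interpret unitary_frame J g x1 x2 x3 .
    have "(\<lambda>x. complex_of_real (b \<bullet> x)) = (\<lambda>x. complex_of_real (g (sharp g b) x))" by (simp add: g_sharp)
    then show ?thesis using Cons.prems(3)[OF gK]
      by (simp add: hsum_wedge onb.sharp_contr_onb)
  qed
  have 1: "lip_form K (\<lambda>g. ?h g (basis_expansion bs (F g)) (G g))"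
    by (rule Cons.IH[OF Cons.prems])
  have 2: "lip_form K (\<lambda>g. ?h g (basis_expansion bs (contr b (F g))) (contr (sharp g b) (G g)))"
    by (rule Cons.IH) (use Cons.prems in \<open>auto intro: lip_form_contr_sharp\<close>)
  show ?case
    by (subst lip_form_cong[OF *], assumption) (rule lip_form_add[OF 1 2])
qed

lemma altm_fundamental: "g \<in> K \<Longrightarrow> altm (fundamental_form J g)"
  by (metis frame_K unitary_frame.\<omega>_def unitary_frame.altm_\<omega>)

lemma lip_form_volume: "lip_form K (\<lambda>g. volume_form (fundamental_form J g))"
proof -
  have "volume_form (fundamental_form J g) = (1 / fact (DIM('g) div 2)) \<cdot> wedge_power (fundamental_form J g) (DIM('g) div 2)" for g
    by (simp add: volume_form_def fun_eq_iff fscale_apply)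
  moreover have "lip_form K (\<lambda>g. wedge_power (fundamental_form J g) k)" for k
    by (induction k) (simp_all add: lip_form_wedge lip_form_fundamental)
  ultimately show ?thesis by (simp only:) (intro lip_form_scale lip_on_const)
qed

lemma lip_form_hodge:
  assumes "lip_form K F" "\<And>g. g \<in> K \<Longrightarrow> altm (F g)"
  shows "lip_form K (\<lambda>g. hodge J (fundamental_form J g) (F g))"
proof -
  obtain bs :: "'g list" where bs: "set bs = Basis" "distinct bs"
    using finite_distinct_list[OF finite_Basis] by blast
  have *: "hodge J (fundamental_form J g) (F g) =
    hsum (hermitian_basis.onb_list (some_onb g)) (basis_expansion bs (F g)) (volume_form (fundamental_form J g))"
    and **: "altm (volume_form (fundamental_form J g))" if gK: "g \<in> K" for g
  proof -
    obtain x1 x2 x3 where "unitary_frame J g x1 x2 x3" using frame_K[OF gK] .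
    then interpret unitary_frame J g x1 x2 x3 .
    show "hodge J (fundamental_form J g) (F g) =
      hsum (hermitian_basis.onb_list (some_onb g)) (basis_expansion bs (F g)) (volume_form (fundamental_form J g))"
      unfolding basis_expansion_eq[OF assms(2)[OF gK] bs] using hodge_\<omega>[of "F g"] volume_form_\<omega>
      by (simp add: \<omega>_def)
    show "altm (volume_form (fundamental_form J g))"
      using volume_form_\<omega> altm_vol by (simp add: \<omega>_def)
  qed
  show ?thesis
    by (subst lip_form_cong[OF *], assumption) (rule lip_form_hsum[OF assms(1) lip_form_volume **])
qed

end

section \<open>Degrees, and an explicit formula for the Lefschetz quotient\<close>

definition has_degree :: "nat \<Rightarrow> 'g form \<Rightarrow> bool" where
  "has_degree k \<alpha> \<longleftrightarrow> (\<forall>xs. length xs \<noteq> k \<longrightarrow> \<alpha> xs = 0)"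

lemma has_degree_linear [intro]:
  "has_degree k \<alpha> \<Longrightarrow> has_degree k \<beta> \<Longrightarrow> has_degree k (\<alpha> + \<beta>)"
  "has_degree k \<alpha> \<Longrightarrow> has_degree k (- \<alpha>)" "has_degree k \<alpha> \<Longrightarrow> has_degree k (z \<cdot> \<alpha>)"
  by (auto simp: has_degree_def fscale_apply)

lemma has_degree_wedge:
  assumes "has_degree p \<alpha>" "has_degree q \<beta>"
  shows "has_degree (p + q) (\<alpha> \<^bold>\<and> \<beta>)"
  unfolding has_degree_def wedge_def
proof (intro allI impI sum.neutral ballI)
  fix xs :: "'a list" and S assume xs: "length xs \<noteq> p + q" and "S \<in> Pow {..<length xs}"
  then have S: "S \<subseteq> {..<length xs}" by simp
  have "length (nths xs S) + length (nths xs ({..<length xs} - S)) = length xs"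
    using S card_mono[OF _ S] by (simp add: length_nths_subset card_Diff_subset finite_subset[OF S])
  then have "length (nths xs S) \<noteq> p \<or> length (nths xs ({..<length xs} - S)) \<noteq> q" using xs by auto
  then show "shuffle_sign (length xs) S * \<alpha> (nths xs S) * \<beta> (nths xs ({..<length xs} - S)) = 0"
    using assms by (auto simp: has_degree_def)
qed

lemma has_degree_one_form: "has_degree (Suc 0) (one_form \<phi>)"
  by (auto simp: has_degree_def one_form_def split: list.split)

lemma has_degree_dact: "has_degree k \<alpha> \<Longrightarrow> has_degree k (dact D \<alpha>)"
proof -
  assume "has_degree k \<alpha>"
  then have "dact D \<alpha> xs = 0" if "length xs \<noteq> k" for xs
    using that
  proof (induction xs arbitrary: \<alpha> k)
    case (Cons x xs)
    then have "dact D (contr x \<alpha>) xs = 0"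
    proof (cases k)
      case 0
      then have "contr x \<alpha> = 0" using Cons.prems by (simp add: has_degree_def contr_apply fun_eq_iff)
      then show ?thesis by simp
    next
      case (Suc k')
      then have "has_degree k' (contr x \<alpha>)" using Cons.prems by (simp add: has_degree_def contr_apply)
      then show ?thesis using Cons Suc by simp
    qed
    then show ?case using Cons.prems by (simp add: dact_Cons has_degree_def)
  qed simp
  then show ?thesis by (simp add: has_degree_def)
qed

lemma has_degree_hsum:
  assumes "has_degree k \<beta>" "has_degree (k + m) \<gamma>"
  shows "has_degree m (hsum es \<beta> \<gamma>)"
  unfolding has_degree_def hsum_def
proof (intro allI impI sum.neutral ballI)
  fix xs :: "'a list" and S assume "length xs \<noteq> m"
  then have "length (nths es S) \<noteq> k \<or> length (nths es S @ xs) \<noteq> k + m" by auto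
  then have "\<beta> (nths es S) = 0 \<or> \<gamma> (nths es S @ xs) = 0"
    using assms unfolding has_degree_def by blast
  then show "\<beta> (nths es S) * \<gamma> (nths es S @ xs) = 0" by simp
qed

text \<open>The adjoint of the product with omega. Pairing the fixed basis with its metric dual
  avoids an orthonormal basis, so the metric enters only through \<open>sharp\<close>.\<close>

definition lefschetz_dual :: "('g \<Rightarrow> 'g) \<Rightarrow> ('g::euclidean_space \<Rightarrow> 'g \<Rightarrow> real) \<Rightarrow> 'g form \<Rightarrow> 'g form" where
  "lefschetz_dual J g \<beta> = (\<lambda>xs. (1/2) * (\<Sum>b\<in>Basis. \<beta> (sharp g b # J b # xs)))"

context unitary_frame
begin

lemma has_degree_flat [intro]: "has_degree (Suc 0) (flat v)"
  by (simp add: flat_def has_degree_one_form)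

lemma has_degree_hodge: "has_degree k \<beta> \<Longrightarrow> k + m = 6 \<Longrightarrow> has_degree m (hodge J \<omega> \<beta>)"
proof -
  assume *: "has_degree k \<beta>" "k + m = 6"
  have "has_degree (Suc 0 + (Suc 0 + (Suc 0 + (Suc 0 + (Suc 0 + Suc 0))))) vol"
    unfolding vol_def by (intro has_degree_wedge has_degree_flat)
  moreover have "Suc 0 + (Suc 0 + (Suc 0 + (Suc 0 + (Suc 0 + Suc 0)))) = k + m" using * by simp
  ultimately have "has_degree (k + m) vol" by simp
  then show ?thesis unfolding hodge_\<omega> by (rule has_degree_hsum[OF *(1)])
qed

lemma has_degree_\<omega>: "has_degree 2 \<omega>"
  by (simp add: has_degree_def \<omega>_apply)

lemma has_degree_\<omega>_\<omega>: "has_degree 4 (\<omega> \<^bold>\<and> \<omega>)"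
  using has_degree_wedge[OF has_degree_\<omega> has_degree_\<omega>] by simp

lemma frame_expansion:
  "g v x1 *\<^sub>R x1 + g v (J x1) *\<^sub>R J x1 + g v x2 *\<^sub>R x2 + g v (J x2) *\<^sub>R J x2 + g v x3 *\<^sub>R x3 + g v (J x3) *\<^sub>R J x3 = v"
proof -
  interpret hermitian_basis J g "\<lambda>i. frame_list ! (i - 1)"
    by unfold_locales (rule orthonormal_frame)
  have "{1..DIM('g)} = {1, 2, 3, 4, 5, 6}" unfolding dim by auto
  then show ?thesis using onb_expansion[of v] by (simp add: add_ac)
qed

lemma lefschetz_dual_eq:
  assumes "altm \<beta>"
  shows "lefschetz_dual J g \<beta> = contr (J x1) (contr x1 \<beta>) + contr (J x2) (contr x2 \<beta>) + contr (J x3) (contr x3 \<beta>)"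
proof
  fix xs
  have lin: "linear (\<lambda>v. \<beta> (v # ys))" for ys by (rule altm_linear[OF assms])
  have linJ: "linear (\<lambda>w. \<beta> (e # J w # xs))" for e
    using linear_compose[OF linear_J altm_linear[OF altm_contr[OF assms], of e xs]] by (simp add: comp_def contr_apply)
  have trace: "(\<Sum>b\<in>Basis. (b \<bullet> e) *\<^sub>R \<beta> (e # J b # xs)) = \<beta> (e # J e # xs)" for e
    using linear_euclidean_sum[OF linJ[of e], of e] by (simp add: inner_commute)
  have "(\<Sum>b\<in>Basis. \<beta> (sharp g b # J b # xs)) = (\<Sum>b\<in>Basis. (b \<bullet> x1) *\<^sub>R \<beta> (x1 # J b # xs)
    + (b \<bullet> J x1) *\<^sub>R \<beta> (J x1 # J b # xs) + (b \<bullet> x2) *\<^sub>R \<beta> (x2 # J b # xs)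
    + (b \<bullet> J x2) *\<^sub>R \<beta> (J x2 # J b # xs) + (b \<bullet> x3) *\<^sub>R \<beta> (x3 # J b # xs)
    + (b \<bullet> J x3) *\<^sub>R \<beta> (J x3 # J b # xs))"
  proof (rule sum.cong)
    fix b :: 'g
    show "\<beta> (sharp g b # J b # xs) = (b \<bullet> x1) *\<^sub>R \<beta> (x1 # J b # xs)
      + (b \<bullet> J x1) *\<^sub>R \<beta> (J x1 # J b # xs) + (b \<bullet> x2) *\<^sub>R \<beta> (x2 # J b # xs)
      + (b \<bullet> J x2) *\<^sub>R \<beta> (J x2 # J b # xs) + (b \<bullet> x3) *\<^sub>R \<beta> (x3 # J b # xs)
      + (b \<bullet> J x3) *\<^sub>R \<beta> (J x3 # J b # xs)"
      by (subst frame_expansion[of "sharp g b", symmetric]) (simp only: linear_add[OF lin] linear_cmul[OF lin] g_sharp)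
  qed simp
  also have "\<dots> = \<beta> (x1 # J x1 # xs) + \<beta> (J x1 # J (J x1) # xs) + \<beta> (x2 # J x2 # xs) + \<beta> (J x2 # J (J x2) # xs)
    + \<beta> (x3 # J x3 # xs) + \<beta> (J x3 # J (J x3) # xs)"
    unfolding sum.distrib trace ..
  finally have "(\<Sum>b\<in>Basis. \<beta> (sharp g b # J b # xs)) = \<beta> (x1 # J x1 # xs) + \<beta> (J x1 # - x1 # xs)
    + \<beta> (x2 # J x2 # xs) + \<beta> (J x2 # - x2 # xs) + \<beta> (x3 # J x3 # xs) + \<beta> (J x3 # - x3 # xs)"
    by (simp only: J_J)
  moreover have "\<beta> (J v # - v # xs) = \<beta> (v # J v # xs)" for v
    using altm_swap[OF assms, of "J v" "- v" xs] linear_neg[OF lin, of v "J v # xs"] by simp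
  ultimately show "lefschetz_dual J g \<beta> xs = (contr (J x1) (contr x1 \<beta>) + contr (J x2) (contr x2 \<beta>) + contr (J x3) (contr x3 \<beta>)) xs"
    by (simp add: lefschetz_dual_def contr_apply)
qed

lemma altm_lefschetz_dual: "altm \<beta> \<Longrightarrow> altm (lefschetz_dual J g \<beta>)"
  by (simp add: lefschetz_dual_eq del: plus_fun_apply)

text \<open>The commutator of the product with omega and its adjoint is n - k on k-forms, here 3 - 2
  = 1.\<close>

lemma lefschetz_dual_wedge_\<omega>:
  assumes "is_form 2 \<gamma>"
  shows "lefschetz_dual J g (\<gamma> \<^bold>\<and> \<omega>) = \<gamma> + lefschetz_dual J g \<gamma> [] \<cdot> \<omega>"
proof -
  have alt: "altm \<gamma>" using is_form_altm[OF assms(1)] .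
  have deg: "\<gamma> xs = 0" if "length xs \<noteq> 2" for xs
    using assms(1) that unfolding is_form_def by blast
  have alt': "altm (\<gamma> \<^bold>\<and> \<omega>)" using alt by simp
  have d: "has_degree 4 (\<gamma> \<^bold>\<and> \<omega>)"
    using has_degree_wedge[of 2 \<gamma> 2 \<omega>] deg has_degree_\<omega> by (simp add: has_degree_def)
  have z: "(\<gamma> \<^bold>\<and> \<omega>) xs = 0" if "length xs \<noteq> 4" for xs
    using d that by (simp add: has_degree_def)
  have w: "(\<gamma> \<^bold>\<and> \<omega>) [a, b, c, d] = \<gamma> [a, b] * \<omega> [c, d] - \<gamma> [a, c] * \<omega> [b, d] + \<gamma> [a, d] * \<omega> [b, c]
    + \<gamma> [b, c] * \<omega> [a, d] - \<gamma> [b, d] * \<omega> [a, c] + \<gamma> [c, d] * \<omega> [a, b]" for a b c d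
    using wedge_two_apply[of \<gamma> \<omega> a b c d] deg \<omega>_apply(2) by simp
  have same: "\<gamma> [x, x] = 0" for x using altm_not_distinct[OF alt, of "[x, x]"] by simp
  have sw: "\<gamma> [J x1, x1] = - \<gamma> [x1, J x1]" "\<gamma> [J x2, x2] = - \<gamma> [x2, J x2]" "\<gamma> [J x3, x3] = - \<gamma> [x3, J x3]"
    "\<gamma> [x2, x1] = - \<gamma> [x1, x2]" "\<gamma> [x2, J x1] = - \<gamma> [J x1, x2]" "\<gamma> [J x2, x1] = - \<gamma> [x1, J x2]" "\<gamma> [J x2, J x1] = - \<gamma> [J x1, J x2]"
    "\<gamma> [x3, x1] = - \<gamma> [x1, x3]" "\<gamma> [x3, J x1] = - \<gamma> [J x1, x3]" "\<gamma> [J x3, x1] = - \<gamma> [x1, J x3]" "\<gamma> [J x3, J x1] = - \<gamma> [J x1, J x3]"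
    "\<gamma> [x3, x2] = - \<gamma> [x2, x3]" "\<gamma> [x3, J x2] = - \<gamma> [J x2, x3]" "\<gamma> [J x3, x2] = - \<gamma> [x2, J x3]" "\<gamma> [J x3, J x2] = - \<gamma> [J x2, J x3]"
    using altm_swap[OF alt] by blast+
  show ?thesis
    unfolding lefschetz_dual_eq[OF alt'] lefschetz_dual_eq[OF alt]
    by (rule form_eq_on_frame)
      (simp_all add: alt alt' del: contr_wedge,
       simp add: contr_apply z w deg fscale_apply \<omega>_apply same sw g_simps del: contr_wedge)
qed

text \<open>The first dual contains the unknown trace of the quotient. The dual of omega is 3, so
  the second dual is 1 + 3 = 4 times that trace; this eliminates it and explains 1/4.\<close>

lemma iota_eq:
  assumes "altm \<beta>" "has_degree 4 \<beta>"
  shows "iota \<omega> \<beta> = lefschetz_dual J g \<beta> + (- (1/4) * lefschetz_dual J g (lefschetz_dual J g \<beta>) []) \<cdot> \<omega>"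
proof -
  obtain \<gamma> where \<gamma>: "is_form 2 \<gamma>" "\<gamma> \<^bold>\<and> \<omega> = \<beta>"
    using wedge_\<omega>_surj[OF assms(1)] assms(2) unfolding has_degree_def by blast
  have 1: "lefschetz_dual J g \<beta> = \<gamma> + lefschetz_dual J g \<gamma> [] \<cdot> \<omega>"
    using lefschetz_dual_wedge_\<omega>[OF \<gamma>(1)] \<gamma>(2) by simp
  have 4: "lefschetz_dual J g (lefschetz_dual J g \<beta>) [] = 4 * lefschetz_dual J g \<gamma> []"
    unfolding 1 using is_form_altm[OF \<gamma>(1)]
    by (simp add: lefschetz_dual_eq del: plus_fun_apply) (simp add: contr_apply fscale_apply \<omega>_apply)
  show ?thesis
    unfolding iota_eqI[OF \<gamma>] 4 unfolding 1 by (simp add: fun_eq_iff fscale_apply)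
qed

end

context almost_abelian_frame
begin

lemma has_degree_operators:
  assumes "altm \<alpha>" "has_degree k \<alpha>"
  shows "has_degree (Suc k) (del \<mu> J \<alpha>)" "has_degree (Suc k) (delbar \<mu> J \<alpha>)"
    "k \<noteq> 0 \<Longrightarrow> k \<le> 6 \<Longrightarrow> has_degree (k - 1) (del_adj \<mu> J \<omega> \<alpha>)"
    "k \<noteq> 0 \<Longrightarrow> k \<le> 6 \<Longrightarrow> has_degree (k - 1) (delbar_adj \<mu> J \<omega> \<alpha>)"
proof -
  have *: "has_degree (Suc k) (del \<mu> J \<alpha>)" "has_degree (Suc k) (delbar \<mu> J \<alpha>)"
    if "altm \<alpha>" "has_degree k \<alpha>" for \<alpha> k
    using has_degree_wedge[OF has_degree_one_form has_degree_dact[OF that(2), of D]] that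
    by (auto simp: del_eq delbar_eq \<theta>_def \<theta>'_def)
  show "has_degree (Suc k) (del \<mu> J \<alpha>)" "has_degree (Suc k) (delbar \<mu> J \<alpha>)"
    by (rule *[OF assms])+
  assume k: "k \<noteq> 0" "k \<le> 6"
  then have h: "has_degree (6 - k) (hodge J \<omega> \<alpha>)" by (intro has_degree_hodge[OF assms(2)]) simp
  show "has_degree (k - 1) (del_adj \<mu> J \<omega> \<alpha>)" "has_degree (k - 1) (delbar_adj \<mu> J \<omega> \<alpha>)"
    unfolding del_adj_eq delbar_adj_eq
    by (intro has_degree_linear has_degree_hodge[OF *(1)[OF _ h]] has_degree_hodge[OF *(2)[OF _ h]]; use k in simp)+
qed

lemma has_degree_bott_chern:
  assumes "altm \<alpha>" "has_degree 4 \<alpha>"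
  shows "has_degree 4 (bott_chern_laplacian \<mu> J \<omega> \<alpha>)"
proof -
  note h = has_degree_operators
  have s: "Suc 4 = 5" "Suc 5 = 6" "Suc 3 = 4" "Suc 2 = 3" "(4::nat) - 1 = 3" "(5::nat) - 1 = 4" "(6::nat) - 1 = 5" "(3::nat) - 1 = 2"
    by simp_all
  have 1: "has_degree 5 (del \<mu> J \<alpha>)" "has_degree 5 (delbar \<mu> J \<alpha>)" "has_degree 3 (del_adj \<mu> J \<omega> \<alpha>)" if "altm \<alpha>" "has_degree 4 \<alpha>" for \<alpha>
    using h[OF that] by (simp_all add: s)
  have 2: "has_degree 4 (del \<mu> J \<alpha>)" "has_degree 4 (delbar \<mu> J \<alpha>)" "has_degree 2 (delbar_adj \<mu> J \<omega> \<alpha>)" if "altm \<alpha>" "has_degree 3 \<alpha>" for \<alpha>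
    using h[OF that] by (simp_all add: s)
  have 3: "has_degree 3 (delbar \<mu> J \<alpha>)" if "altm \<alpha>" "has_degree 2 \<alpha>" for \<alpha>
    using h[OF that] by (simp_all add: s)
  have 4: "has_degree 6 (del \<mu> J \<alpha>)" "has_degree 4 (del_adj \<mu> J \<omega> \<alpha>)" "has_degree 4 (delbar_adj \<mu> J \<omega> \<alpha>)" if "altm \<alpha>" "has_degree 5 \<alpha>" for \<alpha>
    using h[OF that] by (simp_all add: s)
  have 5: "has_degree 5 (del_adj \<mu> J \<omega> \<alpha>)" if "altm \<alpha>" "has_degree 6 \<alpha>" for \<alpha>
    using h[OF that] by (simp_all add: s)
  show ?thesis
    unfolding bott_chern_laplacian_eq using assms
    by (intro has_degree_linear; simp add: 1 2 3 4 5)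
qed

lemma balanced_flow_rhs_lefschetz:
  defines "\<beta> \<equiv> bott_chern_laplacian \<mu> J \<omega> (\<omega> \<^bold>\<and> \<omega>)"
  shows "balanced_flow_rhs \<mu> J \<omega> = (1/2) \<cdot> (lefschetz_dual J g \<beta>
    + (- (1/4) * lefschetz_dual J g (lefschetz_dual J g \<beta>) []) \<cdot> \<omega>)"
proof -
  have "altm \<beta>" "has_degree 4 \<beta>"
    unfolding \<beta>_def by (simp add: bott_chern_laplacian_eq del: plus_fun_apply)
      (rule has_degree_bott_chern[OF _ has_degree_\<omega>_\<omega>], simp)
  then show ?thesis
    unfolding balanced_flow_rhs_eq \<beta>_def[symmetric] by (simp only: iota_eq)
qed

end


section \<open>Lipschitz estimate for the right-hand side of the flow\<close>

context metric_family
begin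

definition lip_altm :: "(('g \<Rightarrow> 'g \<Rightarrow> real) \<Rightarrow> 'g form) \<Rightarrow> bool" where
  "lip_altm F \<longleftrightarrow> lip_form K F \<and> (\<forall>g\<in>K. altm (F g))"

lemma lip_altm_cong: "(\<And>g. g \<in> K \<Longrightarrow> F g = G g) \<Longrightarrow> lip_altm G \<Longrightarrow> lip_altm F"
  using lip_form_cong[of K F G] by (auto simp: lip_altm_def)

lemma lip_altm_linear:
  "lip_altm F \<Longrightarrow> lip_altm G \<Longrightarrow> lip_altm (\<lambda>g. F g + G g)" "lip_altm F \<Longrightarrow> lip_altm (\<lambda>g. - F g)"
  "lip_on K z \<Longrightarrow> lip_altm F \<Longrightarrow> lip_altm (\<lambda>g. z g \<cdot> F g)"
  by (auto simp: lip_altm_def intro: lip_form_add lip_form_uminus lip_form_scale)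

lemma lip_altm_wedge: "lip_altm F \<Longrightarrow> lip_altm G \<Longrightarrow> lip_altm (\<lambda>g. F g \<^bold>\<and> G g)"
  by (auto simp: lip_altm_def intro: lip_form_wedge)

lemma lip_altm_fundamental: "lip_altm (fundamental_form J)"
  by (simp add: lip_altm_def lip_form_fundamental altm_fundamental)

lemma lip_altm_hodge:
  assumes "lip_altm F" shows "lip_altm (\<lambda>g. hodge J (fundamental_form J g) (F g))"
proof -
  have "altm (hodge J (fundamental_form J g) (F g))" if gK: "g \<in> K" for g
    by (metis frame_K[OF gK] unitary_frame.\<omega>_def unitary_frame.altm_hodge)
  then show ?thesis using assms lip_form_hodge[of F] by (simp add: lip_altm_def)
qed

lemma lip_altm_lefschetz_dual:
  assumes "lip_altm F" shows "lip_altm (\<lambda>g. lefschetz_dual J g (F g))"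
proof -
  have "altm (lefschetz_dual J g (F g))" if gK: "g \<in> K" for g
    using assms gK by (metis frame_K[OF gK] unitary_frame.altm_lefschetz_dual lip_altm_def)
  moreover have "lip_on K (\<lambda>g. lefschetz_dual J g (F g) xs)" for xs
    unfolding lefschetz_dual_def using assms
    by (intro lip_on_mult lip_on_const lip_on_sum lip_on_apply_sharp) (auto simp: lip_altm_def)
  ultimately show ?thesis by (simp add: lip_altm_def lip_form_def)
qed

end

locale almost_abelian_metric_family = metric_family J c C + almost_abelian \<mu> J D \<epsilon>
  for \<mu> :: "'g::euclidean_space \<Rightarrow> 'g \<Rightarrow> 'g" and J :: "'g \<Rightarrow> 'g" and D \<epsilon> c C
begin

lemma almost_abelian_frame_K:
  assumes "g \<in> K" obtains x1 x2 x3 where "almost_abelian_frame \<mu> J D \<epsilon> g x1 x2 x3"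
proof -
  obtain x1 x2 x3 where "unitary_frame J g x1 x2 x3" using frame_K[OF assms] .
  then have "almost_abelian_frame \<mu> J D \<epsilon> g x1 x2 x3"
    by (intro almost_abelian_frame.intro almost_abelian_axioms)
  then show thesis by (rule that)
qed

lemma lip_altm_del:
  assumes "lip_altm F" shows "lip_altm (\<lambda>g. del \<mu> J (F g))" "lip_altm (\<lambda>g. delbar \<mu> J (F g))"
proof -
  have d: "lip_altm (\<lambda>g. dact D (F g))"
    using assms D(1) by (auto simp: lip_altm_def intro: lip_form_dact)
  show "lip_altm (\<lambda>g. del \<mu> J (F g))"
    by (rule lip_altm_cong[where G = "\<lambda>g. (\<i>/2) \<cdot> (\<theta> \<^bold>\<and> dact D (F g))"])
      (use assms d in \<open>auto simp: lip_altm_def del_eq intro!: lip_form_scale lip_form_wedge\<close>)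
  show "lip_altm (\<lambda>g. delbar \<mu> J (F g))"
    by (rule lip_altm_cong[where G = "\<lambda>g. - ((\<i>/2) \<cdot> (\<theta>' \<^bold>\<and> dact D (F g)))"])
      (use assms d in \<open>auto simp: lip_altm_def delbar_eq intro!: lip_form_scale lip_form_wedge lip_form_uminus\<close>)
qed

lemma lip_altm_adj:
  assumes "lip_altm F"
  shows "lip_altm (\<lambda>g. del_adj \<mu> J (fundamental_form J g) (F g))"
    "lip_altm (\<lambda>g. delbar_adj \<mu> J (fundamental_form J g) (F g))"
proof -
  have *: "del_adj \<mu> J \<omega> \<alpha> = - hodge J \<omega> (delbar \<mu> J (hodge J \<omega> \<alpha>))"
    "delbar_adj \<mu> J \<omega> \<alpha> = - hodge J \<omega> (del \<mu> J (hodge J \<omega> \<alpha>))" for \<omega> \<alpha>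
    by (simp_all add: del_adj_def delbar_adj_def fun_eq_iff)
  show "lip_altm (\<lambda>g. del_adj \<mu> J (fundamental_form J g) (F g))"
    "lip_altm (\<lambda>g. delbar_adj \<mu> J (fundamental_form J g) (F g))"
    unfolding * by (intro lip_altm_linear(2) lip_altm_hodge lip_altm_del assms)+
qed

theorem lip_form_balanced_flow_rhs: "lip_form K (\<lambda>g. balanced_flow_rhs \<mu> J (fundamental_form J g))"
proof -
  let ?w = "fundamental_form J"
  let ?b = "\<lambda>g. bott_chern_laplacian \<mu> J (?w g) (?w g \<^bold>\<and> ?w g)"
  let ?r = "\<lambda>g. (1/2) \<cdot> (lefschetz_dual J g (?b g)
    + (- (1/4) * lefschetz_dual J g (lefschetz_dual J g (?b g)) []) \<cdot> ?w g)"
  have "balanced_flow_rhs \<mu> J (?w g) = ?r g" if gK: "g \<in> K" for g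
  proof -
    obtain x1 x2 x3 where "almost_abelian_frame \<mu> J D \<epsilon> g x1 x2 x3"
      using almost_abelian_frame_K[OF gK] .
    then interpret almost_abelian_frame \<mu> J D \<epsilon> g x1 x2 x3 .
    show ?thesis using balanced_flow_rhs_lefschetz unfolding \<omega>_def .
  qed
  moreover have "lip_altm ?r"
  proof -
    have bc: "bott_chern_laplacian \<mu> J \<omega> \<alpha> =
         del \<mu> J (delbar \<mu> J (delbar_adj \<mu> J \<omega> (del_adj \<mu> J \<omega> \<alpha>)))
       + delbar_adj \<mu> J \<omega> (del_adj \<mu> J \<omega> (del \<mu> J (delbar \<mu> J \<alpha>)))
       + delbar_adj \<mu> J \<omega> (del \<mu> J (del_adj \<mu> J \<omega> (delbar \<mu> J \<alpha>)))
       + del_adj \<mu> J \<omega> (delbar \<mu> J (delbar_adj \<mu> J \<omega> (del \<mu> J \<alpha>)))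
       + delbar_adj \<mu> J \<omega> (delbar \<mu> J \<alpha>) + del_adj \<mu> J \<omega> (del \<mu> J \<alpha>)" for \<omega> \<alpha>
      by (simp add: bott_chern_laplacian_def Let_def fun_eq_iff)
    have b: "lip_altm ?b"
      unfolding bc
      by (intro lip_altm_linear(1) lip_altm_del lip_altm_adj lip_altm_wedge lip_altm_fundamental)
    have "lip_on K (\<lambda>g. lefschetz_dual J g (lefschetz_dual J g (?b g)) [])"
      using lip_altm_lefschetz_dual[OF lip_altm_lefschetz_dual[OF b]] by (simp add: lip_altm_def lip_form_def)
    then show ?thesis
      by (intro lip_altm_linear lip_altm_lefschetz_dual b lip_altm_fundamental lip_on_mult lip_on_const)
  qed
  ultimately have "lip_altm (\<lambda>g. balanced_flow_rhs \<mu> J (?w g))" by (rule lip_altm_cong)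
  then show ?thesis by (simp add: lip_altm_def)
qed

end

section \<open>Uniqueness of solutions\<close>

text \<open>Multiplied by exp (- M s) for positive s and by exp (M s) for negative s,
  \<open>u\<close> does not grow away from 0.\<close>

lemma gronwall_zero:
  fixes u u' :: "real \<Rightarrow> real"
  assumes S: "is_interval S" "0 \<in> S" "t \<in> S"
    and u: "\<And>s. s \<in> S \<Longrightarrow> (u has_real_derivative u' s) (at s)"
    and nonneg: "\<And>s. s \<in> S \<Longrightarrow> 0 \<le> u s" and bound: "\<And>s. s \<in> S \<Longrightarrow> \<bar>u' s\<bar> \<le> M * u s" and "u 0 = 0"
  shows "u t = 0"
proof -
  have mem: "s \<in> S" if "0 \<le> s \<and> s \<le> t \<or> t \<le> s \<and> s \<le> 0" for s
    using S that unfolding is_interval_1 by blast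
  have "u t * exp (- M * \<bar>t\<bar>) \<le> 0"
  proof (cases "0 \<le> t")
    case True
    have "u t * exp (- M * t) \<le> u 0 * exp (- M * 0)"
    proof (rule DERIV_nonpos_imp_nonincreasing[OF True, where f = "\<lambda>s. u s * exp (- M * s)"])
      fix s assume "0 \<le> s" "s \<le> t"
      then have s: "s \<in> S" using mem by blast
      have "((\<lambda>s. u s * exp (- M * s)) has_real_derivative (u' s - M * u s) * exp (- M * s)) (at s)"
        by (auto intro!: derivative_eq_intros u[OF s] simp: algebra_simps)
      moreover have "(u' s - M * u s) * exp (- M * s) \<le> 0"
        using bound[OF s] by (intro mult_nonpos_nonneg) auto
      ultimately show "\<exists>y. ((\<lambda>s. u s * exp (- M * s)) has_real_derivative y) (at s) \<and> y \<le> 0" by blast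
    qed
    then show ?thesis using True \<open>u 0 = 0\<close> by simp
  next
    case False
    have "u t * exp (M * t) \<le> u 0 * exp (M * 0)"
    proof (rule DERIV_nonneg_imp_nondecreasing[where f = "\<lambda>s. u s * exp (M * s)"])
      fix s assume "t \<le> s" "s \<le> 0"
      then have s: "s \<in> S" using mem by blast
      have "((\<lambda>s. u s * exp (M * s)) has_real_derivative (u' s + M * u s) * exp (M * s)) (at s)"
        by (auto intro!: derivative_eq_intros u[OF s] simp: algebra_simps)
      moreover have "0 \<le> (u' s + M * u s) * exp (M * s)"
        using bound[OF s] by (intro mult_nonneg_nonneg) auto
      ultimately show "\<exists>y. ((\<lambda>s. u s * exp (M * s)) has_real_derivative y) (at s) \<and> 0 \<le> y" by blast
    qed (use False in simp)
    then show ?thesis using False \<open>u 0 = 0\<close> by simp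
  qed
  then show ?thesis
    using nonneg[OF S(3)] by (smt (verit) exp_gt_zero mult_pos_pos)
qed

text \<open>This puts a solution over a compact time interval into one \<open>metric_ball\<close>.
  The lower constant is a minimum over times and unit vectors.\<close>

lemma compact_metric_family:
  fixes g :: "real \<Rightarrow> 'g::euclidean_space \<Rightarrow> 'g \<Rightarrow> real"
  assumes "compact S" "S \<noteq> {}" and herm: "\<And>s. s \<in> S \<Longrightarrow> hermitian_metric J (g s)"
    and cont: "\<And>x y. continuous_on S (\<lambda>s. g s x y)"
  obtains c C where "0 < c" "\<And>s. s \<in> S \<Longrightarrow> g s \<in> metric_ball J c C"
proof -
  have bil: "bilinear (g s)" if "s \<in> S" for s
    using herm[OF that] unfolding hermitian_metric_def by blast
  let ?T = "S \<times> sphere 0 1 :: (real \<times> 'g) set"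
  \<comment> \<open>Joint continuity in time and vector is seen in coordinates, since
    \<open>cont\<close> fixes both vectors.\<close>
  have "continuous_on ?T (\<lambda>p. \<Sum>b\<in>Basis. \<Sum>b'\<in>Basis. (snd p \<bullet> b) * (snd p \<bullet> b') * g (fst p) b b')"
  proof (intro continuous_on_sum continuous_on_mult continuous_on_inner continuous_on_const continuous_on_snd continuous_on_id)
    show "continuous_on ?T (\<lambda>p. g (fst p) b b')" for b b'
      by (rule continuous_on_compose2[OF cont continuous_on_fst[OF continuous_on_id]]) auto
  qed
  then have "continuous_on ?T (\<lambda>p. g (fst p) (snd p) (snd p))"
    by (rule continuous_on_eq) (rule bilinear_euclidean_sum[symmetric, OF bil], auto)
  moreover have "compact ?T" "?T \<noteq> {}"
    using compact_Times[OF assms(1) compact_sphere[of "0::'g" 1]] assms(2)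
    by (simp_all only: Times_empty sphere_eq_empty DIM_positive) simp_all
  ultimately obtain p where p: "p \<in> ?T" "\<And>q. q \<in> ?T \<Longrightarrow> g (fst p) (snd p) (snd p) \<le> g (fst q) (snd q) (snd q)"
    using continuous_attains_inf[of ?T "\<lambda>p. g (fst p) (snd p) (snd p)"] by blast
  define c where "c = g (fst p) (snd p) (snd p)"
  have "snd p \<noteq> 0" using p(1) by auto
  then have c: "0 < c"
    using herm[of "fst p"] p(1) unfolding c_def hermitian_metric_def by (auto simp: mem_Times_iff)
  have lower: "c * (x \<bullet> x) \<le> g s x x" if s: "s \<in> S" for s x
  proof (cases "x = 0")
    case True
    then show ?thesis using bilinear_lzero[OF bil[OF s]] by simp
  next
    case False
    let ?u = "(1 / norm x) *\<^sub>R x"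
    have "c \<le> g s ?u ?u"
      using p(2)[of "(s, ?u)"] s False by (simp add: c_def)
    also have "\<dots> = g s x x / (x \<bullet> x)"
      by (simp add: bilinear_lmul[OF bil[OF s]] bilinear_rmul[OF bil[OF s]] dot_square_norm power2_eq_square)
    finally show ?thesis using False by (simp add: field_simps)
  qed
  have "continuous_on S (\<lambda>s. metric_dist (g s) (\<lambda>_ _. 0))"
    unfolding metric_dist_def by (intro continuous_intros cont)
  then obtain s0 where s0: "s0 \<in> S" "\<And>s. s \<in> S \<Longrightarrow> metric_dist (g s) (\<lambda>_ _. 0) \<le> metric_dist (g s0) (\<lambda>_ _. 0)"
    using continuous_attains_sup[OF assms(1,2)] by blast
  have upper: "\<bar>g s x y\<bar> \<le> metric_dist (g s0) (\<lambda>_ _. 0) * norm x * norm y" if s: "s \<in> S" for s x y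
  proof -
    have "\<bar>g s x y\<bar> \<le> metric_dist (g s) (\<lambda>_ _. 0) * norm x * norm y"
      using metric_dist_bound[OF bil[OF s], of "\<lambda>_ _. 0" x y] by (simp add: bilinear_def linear_zero)
    also have "\<dots> \<le> metric_dist (g s0) (\<lambda>_ _. 0) * norm x * norm y"
      using s0(2)[OF s] by (intro mult_right_mono) auto
    finally show ?thesis .
  qed
  show thesis
    by (rule that[OF c]) (use herm lower upper in \<open>auto simp: metric_ball_def\<close>)
qed

locale almost_abelian_complex = complex_space J + almost_abelian \<mu> J D \<epsilon>
  for \<mu> :: "'g::euclidean_space \<Rightarrow> 'g \<Rightarrow> 'g" and J :: "'g \<Rightarrow> 'g" and D \<epsilon>
begin

lemma fundamental_form_metric_of:
  assumes "hermitian_metric J h" "\<omega> = fundamental_form J h"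
  shows "hermitian_metric J (metric_of J \<omega>)" "fundamental_form J (metric_of J \<omega>) = \<omega>"
    "\<omega> [x, J y] = complex_of_real (metric_of J \<omega> x y)"
proof -
  interpret hermitian_space J h by unfold_locales (use lin_J J2 assms in \<open>auto simp: linear_iff\<close>)
  have h: "metric_of J \<omega> = h" unfolding assms(2) by (rule metric_of_fundamental_form)
  show "hermitian_metric J (metric_of J \<omega>)" "fundamental_form J (metric_of J \<omega>) = \<omega>"
    "\<omega> [x, J y] = complex_of_real (metric_of J \<omega> x y)"
    unfolding h by (simp_all add: assms fundamental_form_def g_J)
qed

lemma solution_metric:
  assumes "balanced_flow_solution \<mu> J \<omega>0 I \<omega>" "t \<in> I"
  shows "hermitian_metric J (metric_of J (\<omega> t))" "fundamental_form J (metric_of J (\<omega> t)) = \<omega> t"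
    "((\<lambda>s. metric_of J (\<omega> s) x y) has_real_derivative Re (balanced_flow_rhs \<mu> J (\<omega> t) [x, J y])) (at t)"
proof -
  obtain h where "hermitian_metric J h" "\<omega> t = fundamental_form J h"
    using assms unfolding balanced_flow_solution_def by blast
  then show "hermitian_metric J (metric_of J (\<omega> t))" "fundamental_form J (metric_of J (\<omega> t)) = \<omega> t"
    by (rule fundamental_form_metric_of)+
  have "((\<lambda>s. \<omega> s [x, J y]) has_vector_derivative balanced_flow_rhs \<mu> J (\<omega> t) [x, J y]) (at t)"
    using assms unfolding balanced_flow_solution_def by blast
  then show "((\<lambda>s. metric_of J (\<omega> s) x y) has_real_derivative Re (balanced_flow_rhs \<mu> J (\<omega> t) [x, J y])) (at t)"
    unfolding metric_of_def has_real_derivative_iff_has_vector_derivative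
    by (rule bounded_linear.has_vector_derivative[OF bounded_linear_Re])
qed

theorem solution_unique:
  assumes sol: "balanced_flow_solution \<mu> J \<omega>0 I \<omega>" and sol': "balanced_flow_solution \<mu> J \<omega>0 I' \<omega>'"
    and t: "t \<in> I" "t \<in> I'"
  shows "\<omega> t = \<omega>' t"
proof -
  let ?g = "\<lambda>s. metric_of J (\<omega> s)" and ?g' = "\<lambda>s. metric_of J (\<omega>' s)"
  define S where "S = {min 0 t..max 0 t}"
  have I: "is_interval I" "0 \<in> I" "is_interval I'" "0 \<in> I'" and 0: "\<omega> 0 = \<omega>' 0"
    using sol sol' unfolding balanced_flow_solution_def by auto
  have S: "s \<in> I" "s \<in> I'" if "s \<in> S" for s
  proof -
    have "0 \<le> s \<and> s \<le> t \<or> t \<le> s \<and> s \<le> 0" using that by (auto simp: S_def)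
    then show "s \<in> I" "s \<in> I'" using I t unfolding is_interval_1 by blast+
  qed
  have S': "compact S" "S \<noteq> {}" "is_interval S" "0 \<in> S" "t \<in> S" by (auto simp: S_def is_interval_cc)
  have cont: "continuous_on S (\<lambda>s. ?g s x y)" "continuous_on S (\<lambda>s. ?g' s x y)" for x y
    using solution_metric(3)[OF sol S(1)] solution_metric(3)[OF sol' S(2)]
    by (meson DERIV_continuous_on has_field_derivative_at_within)+
  obtain c1 C1 where 1: "0 < c1" "\<And>s. s \<in> S \<Longrightarrow> ?g s \<in> metric_ball J c1 C1"
    using compact_metric_family[OF S'(1,2) solution_metric(1)[OF sol S(1)] cont(1)] by blast
  obtain c2 C2 where 2: "0 < c2" "\<And>s. s \<in> S \<Longrightarrow> ?g' s \<in> metric_ball J c2 C2"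
    using compact_metric_family[OF S'(1,2) solution_metric(1)[OF sol' S(2)] cont(2)] by blast
  interpret almost_abelian_metric_family \<mu> J D \<epsilon> "min c1 c2" "max C1 C2"
    by unfold_locales (use 1(1) 2(1) in simp)
  \<comment> \<open>The two solutions come with different constants; the smaller lower and the
    larger upper one serve both.\<close>
  have mono: "metric_ball J c' C' \<subseteq> K" if "min c1 c2 \<le> c'" "C' \<le> max C1 C2" for c' C'
  proof
    fix h assume h: "h \<in> metric_ball J c' C'"
    have "min c1 c2 * (x \<bullet> x) \<le> c' * (x \<bullet> x)" "C' * norm x * norm y \<le> max C1 C2 * norm x * norm y" for x y
      using that by (auto intro!: mult_right_mono)
    then have "min c1 c2 * (x \<bullet> x) \<le> h x x" "\<bar>h x y\<bar> \<le> max C1 C2 * norm x * norm y" for x y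
      using metric_ballD(2,3)[OF h] order_trans by blast+
    then show "h \<in> K" using metric_ballD(1)[OF h] unfolding metric_ball_def by blast
  qed
  have K: "?g s \<in> K" "?g' s \<in> K" if "s \<in> S" for s
    using mono[of c1 C1] mono[of c2 C2] 1(2)[OF that] 2(2)[OF that] by auto
  let ?R = "\<lambda>h p. balanced_flow_rhs \<mu> J (fundamental_form J h) [fst p, J (snd p)]"
  have "\<exists>L\<ge>0. \<forall>h\<in>K. \<forall>h'\<in>K. norm (?R h p - ?R h' p) \<le> L * metric_dist h h'" for p
    using lip_form_balanced_flow_rhs unfolding lip_form_def lip_on_def by metis
  then obtain L where L: "\<And>p. 0 \<le> L p"
      "\<And>p h h'. h \<in> K \<Longrightarrow> h' \<in> K \<Longrightarrow> norm (?R h p - ?R h' p) \<le> L p * metric_dist h h'"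
    by metis
  let ?B = "Basis \<times> Basis :: ('g \<times> 'g) set"
  define M where "M = (\<Sum>p\<in>?B. L p)"
  have M: "L p \<le> M" if "p \<in> ?B" for p
    unfolding M_def by (rule member_le_sum[OF that]) (auto simp: L)
  define d where "d s p = ?g s (fst p) (snd p) - ?g' s (fst p) (snd p)" for s p
  define d' where "d' s p = Re (?R (?g s) p - ?R (?g' s) p)" for s p
  have dist: "metric_dist (?g s) (?g' s) = (\<Sum>p\<in>?B. \<bar>d s p\<bar>)" for s
    unfolding metric_dist_def d_def sum.cartesian_product by (simp add: case_prod_unfold)
  have deriv: "((\<lambda>s. d s p) has_real_derivative d' s p) (at s)" if "s \<in> S" for s p
    unfolding d_def d'_def using solution_metric(2)[OF sol S(1)[OF that]] solution_metric(2)[OF sol' S(2)[OF that]]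
    by (auto intro!: derivative_eq_intros solution_metric(3)[OF sol S(1)[OF that]] solution_metric(3)[OF sol' S(2)[OF that]])
  have bound: "\<bar>d' s p\<bar> \<le> M * (\<Sum>p\<in>?B. \<bar>d s p\<bar>)" if "s \<in> S" "p \<in> ?B" for s p
  proof -
    have "\<bar>d' s p\<bar> \<le> L p * metric_dist (?g s) (?g' s)"
      unfolding d'_def by (rule order_trans[OF abs_Re_le_cmod L(2)[OF K[OF that(1)]]])
    also have "\<dots> \<le> M * metric_dist (?g s) (?g' s)"
      by (rule mult_right_mono[OF M[OF that(2)] metric_dist_nonneg])
    finally show ?thesis unfolding dist .
  qed
  \<comment> \<open>Squares are used because \<open>metric_dist\<close>, a sum of absolute values,
    need not be differentiable in time.\<close>
  define u where "u s = (\<Sum>p\<in>?B. (d s p)\<^sup>2)" for s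
  have "u t = 0"
  proof (rule gronwall_zero[OF S'(3-5)])
    fix s assume s: "s \<in> S"
    show "(u has_real_derivative (\<Sum>p\<in>?B. 2 * d s p * d' s p)) (at s)"
      unfolding u_def by (rule DERIV_sum) (auto intro!: derivative_eq_intros deriv[OF s] simp: power2_eq_square)
    show "0 \<le> u s" unfolding u_def by (intro sum_nonneg) simp
    have "\<bar>\<Sum>p\<in>?B. 2 * d s p * d' s p\<bar> \<le> (\<Sum>p\<in>?B. 2 * \<bar>d s p\<bar> * (M * (\<Sum>p\<in>?B. \<bar>d s p\<bar>)))"
      by (rule order_trans[OF sum_abs sum_mono]) (simp only: abs_mult abs_numeral, intro mult_left_mono bound[OF s], auto)
    also have "\<dots> = 2 * M * (\<Sum>p\<in>?B. \<bar>d s p\<bar>)\<^sup>2"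
      by (simp add: power2_eq_square sum_distrib_right sum_distrib_left mult_ac)
    also have "\<dots> \<le> 2 * M * ((\<Sum>p\<in>?B. \<bar>d s p\<bar>\<^sup>2) * card ?B)"
      by (intro mult_left_mono sum_squared_le_sum_of_squares) (auto simp: M_def intro!: sum_nonneg L)
    finally show "\<bar>\<Sum>p\<in>?B. 2 * d s p * d' s p\<bar> \<le> 2 * M * card ?B * u s"
      by (simp add: u_def mult_ac)
  qed (simp add: u_def d_def 0)
  moreover have "finite ?B" by simp
  ultimately have "\<forall>p\<in>?B. (d t p)\<^sup>2 = 0"
    unfolding u_def by (simp only: sum_nonneg_eq_0_iff[OF _ zero_le_power2])
  then have "d t p = 0" if "p \<in> ?B" for p using that by (metis power_eq_0_iff)
  then have "metric_dist (?g t) (?g' t) = 0" unfolding dist by simp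
  then have "?g t x y = ?g' t x y" for x y
    using metric_dist_bound[OF bilinear_K[OF K(1)] bilinear_K[OF K(2)], of t t x y] S' by simp
  then have "?g t = ?g' t" by blast
  then show ?thesis
    using solution_metric(2)[OF sol t(1)] solution_metric(2)[OF sol' t(2)] by metis
qed

end

section \<open>The scalar flow\<close>

lemma antiderivative_greaterThan:
  fixes f :: "real \<Rightarrow> real"
  assumes "continuous_on {a<..} f" "a < y0"
  obtains F where "F y0 = 0" "\<And>y. a < y \<Longrightarrow> (F has_real_derivative f y) (at y)"
proof -
  have "isCont f x" if "a < x" for x
    using assms(1) that continuous_on_eq_continuous_at[of "{a<..}" f] by auto
  then obtain F where F: "\<And>x. a < x \<Longrightarrow> (F has_vector_derivative f x) (at x)"
    using einterval_antiderivative[of "ereal a" \<infinity> f] by auto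
  show thesis
    by (rule that[of "\<lambda>x. F x - F y0"])
      (use F in \<open>auto intro!: derivative_eq_intros simp: has_real_derivative_iff_has_vector_derivative[symmetric]\<close>)
qed

lemma continuous_on_greaterThan_DERIV:
  fixes f :: "real \<Rightarrow> real"
  assumes "\<And>y. a < y \<Longrightarrow> (f has_real_derivative f' y) (at y)"
  shows "continuous_on {a<..} f"
  by (rule DERIV_continuous_on[of _ _ f']) (auto intro: has_field_derivative_at_within assms)

lemma DERIV_ln_add:
  fixes a y :: real
  assumes "0 < y + a"
  shows "((\<lambda>y. ln (y + a)) has_real_derivative 1 / (y + a)) (at y)"
  using DERIV_chain2[OF DERIV_ln_divide[OF assms] DERIV_add[OF DERIV_ident DERIV_const]] by simp

text \<open>This is \<open>H0\<close> as a function of |b|^2 and k = |a|^2; the real part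
  \<open>al\<close> of the eigenvalue enters separately.\<close>

definition growth :: "real \<Rightarrow> real \<Rightarrow> real \<Rightarrow> real" where
  "growth al k \<beta> = (2 * al\<^sup>2 + \<beta> / 2)\<^sup>2 + \<beta>\<^sup>2 / 4 + k * \<beta>"

text \<open>\<open>\<tau>\<close> is the time as a decreasing function of the unknown. Being
  unbounded above, it can be inverted for all large times; \<open>T\<close> is its infimum,
  approached as the unknown tends to infinity.\<close>

lemma inverse_time_change:
  fixes \<tau> d :: "real \<Rightarrow> real"
  assumes \<tau>: "\<And>y. a < y \<Longrightarrow> (\<tau> has_real_derivative d y) (at y)" and d: "\<And>y. a < y \<Longrightarrow> d y < 0"
    and y0: "a < y0" "\<tau> y0 = 0" and unbounded: "\<And>t. \<exists>y>a. t < \<tau> y"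
  obtains z and T :: ereal where "T < 0" "z 0 = y0" "\<And>t. T < ereal t \<Longrightarrow> a < z t"
    "\<And>t. T < ereal t \<Longrightarrow> (z has_real_derivative 1 / d (z t)) (at t)"
    "\<And>t. T = ereal t \<Longrightarrow> filterlim z at_top (at_right t)"
proof -
  let ?S = "{a<..}"
  have decr: "\<tau> y' < \<tau> y" if "a < y" "y < y'" for y y'
    by (rule DERIV_neg_imp_decreasing[OF that(2)]) (use \<tau> d that in \<open>meson less_le_trans\<close>)
  have inj: "inj_on \<tau> ?S"
    by (rule inj_onI) (metis decr greaterThan_iff less_irrefl linorder_neqE_linordered_idom)
  have cont: "continuous_on ?S \<tau>"
    by (rule continuous_on_greaterThan_DERIV[OF \<tau>])
  define z where "z = inv_into ?S \<tau>"
  have z: "z (\<tau> y) = y" if "a < y" for y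
    unfolding z_def by (rule inv_into_f_f[OF inj]) (use that in simp)
  define T :: ereal where "T = (INF y\<in>?S. ereal (\<tau> y))"
  have image: "\<exists>y>a. t = \<tau> y" if "T < ereal t" for t
  proof -
    from that obtain y1 where y1: "a < y1" "\<tau> y1 < t"
      unfolding T_def INF_less_iff by auto
    obtain y2 where y2: "a < y2" "t < \<tau> y2" using unbounded by blast
    have "y2 < y1" using decr[of y1 y2] y1 y2 by (metis less_asym less_trans linorder_neqE_linordered_idom)
    have "\<exists>x\<ge>y2. x \<le> y1 \<and> \<tau> x = t"
      by (rule IVT2') (use y1 y2 \<open>y2 < y1\<close> in \<open>auto intro: continuous_on_subset[OF cont]\<close>)
    then show ?thesis using y2(1) less_le_trans by blast
  qed
  have T_less: "T < ereal (\<tau> y)" if "a < y" for y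
  proof -
    have "T \<le> ereal (\<tau> (y + 1))" unfolding T_def by (rule INF_lower) (use that in simp)
    also have "\<dots> < ereal (\<tau> y)" using decr[of y "y + 1"] that by simp
    finally show ?thesis .
  qed
  show thesis
  proof (rule that)
    show "T < 0" using T_less[OF y0(1)] y0 by (simp add: zero_ereal_def)
    show "z 0 = y0" using z[OF y0(1)] y0 by simp
    fix t
    {
      assume "T < ereal t"
      then obtain y where y: "a < y" "t = \<tau> y" using image by blast
      then show "a < z t" using z by simp
      have "(z has_derivative (*) (1 / d y)) (at (\<tau> y))"
      proof (rule has_derivative_inverse_strong[of ?S y \<tau> z "\<lambda>h. h * d y"])
        show "(\<tau> has_derivative (\<lambda>h. h * d y)) (at y)"
          using \<tau>[OF y(1)] unfolding has_field_derivative_def mult_commute_abs[of "d y"] .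
      qed (use y z cont d[OF y(1)] in \<open>auto simp: fun_eq_iff\<close>)
      then show "(z has_real_derivative 1 / d (z t)) (at t)"
        unfolding has_field_derivative_def by (simp add: y z[OF y(1)])
    }
    assume Tt: "T = ereal t"
    show "filterlim z at_top (at_right t)"
      unfolding filterlim_at_top
    proof
      fix N
      let ?y = "max N (a + 1)"
      have y: "a < ?y" by simp
      have "t < \<tau> ?y" using T_less[OF y] Tt by simp
      moreover have "N \<le> z s" if s: "t < s" "s < \<tau> ?y" for s
      proof -
        obtain x where x: "a < x" "s = \<tau> x" using image[of s] s Tt by auto
        have "\<not> x < ?y" using decr[OF x(1), of ?y] s x by auto
        then show ?thesis using x z by simp
      qed
      ultimately show "\<forall>\<^sub>F s in at_right t. N \<le> z s"
        unfolding eventually_at_right_field by blast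
    qed
  qed
qed

text \<open>
  Here \<open>\<beta> = |b|\<^sup>2\<close> and \<open>k = |a|\<^sup>2\<close> for the triangular form of \<open>D\<close> in the evolving frame.  The quantity
  \<open>z = \<beta> + 2 k\<close> satisfies \<open>z' = - z (z\<^sup>2 - 4 k\<^sup>2) / c\<^sup>2\<close>; taking it as independent variable on
  \<open>(2 k, \<infinity>)\<close>, the time and all the other unknowns are obtained by quadratures.
\<close>

lemma scalar_flow:
  assumes k: "0 \<le> k" and b: "0 < b"
  defines "\<beta> \<equiv> \<lambda>p s. p ^ 4 * (1 - 2 * k * s)\<^sup>2 * b"
  obtains T :: ereal and c p s :: "real \<Rightarrow> real"
  where "T < 0" "c 0 = 1" "p 0 = 1" "s 0 = 0" "\<And>t. T < ereal t \<Longrightarrow> 0 < c t" "\<And>t. T < ereal t \<Longrightarrow> 0 < p t"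
    "\<And>t. T < ereal t \<Longrightarrow> (c has_real_derivative growth al k (\<beta> (p t) (s t)) / c t) (at t)"
    "\<And>t. T < ereal t \<Longrightarrow> (p has_real_derivative
      - ((2 * k + \<beta> (p t) (s t)) / (c t)\<^sup>2) * \<beta> (p t) (s t) * p t / 4) (at t)"
    "\<And>t. T < ereal t \<Longrightarrow> b \<noteq> 0 \<Longrightarrow> (s has_real_derivative ((2 * k + \<beta> (p t) (s t)) / (c t)\<^sup>2) * (1 - 2 * k * s t)) (at t)"
    "\<And>t. T = ereal t \<Longrightarrow> filterlim p at_top (at_right t) \<or> (c \<longlongrightarrow> 0) (at_right t)"
proof -
  let ?a = "2 * k" and ?z0 = "b + 2 * k"
  have z0: "?a < ?z0" using b by simp
  \<comment> \<open>With \<beta> = |b|^2 in the evolved frame, \<beta>'/\<beta> = 4 p'/p - 4 k s'/(1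
    - 2 k s) = - z (z + 2 k) / c^2. As z = \<beta> + 2 k, this gives c^2 z' = - w(z), and
    \<open>?a\<close> is the equilibrium \<beta> = 0.\<close>
  define w where "w y = y * (y - ?a) * (y + ?a)" for y
  have w: "0 < w y" "0 < y" "0 < y + ?a" "0 < y - ?a" if "?a < y" for y
  proof -
    show "0 < y" "0 < y + ?a" "0 < y - ?a" using k that by auto
    then show "0 < w y" by (simp add: w_def)
  qed
  have w0: "w y \<noteq> 0" "y \<noteq> 0" "y + ?a \<noteq> 0" "y - ?a \<noteq> 0" if "?a < y" for y
    using w[OF that] by auto
  have H: "0 \<le> growth al k (y - ?a)" if "?a < y" for y
    unfolding growth_def using k that by (intro add_nonneg_nonneg) auto
  have cw: "continuous_on {?a<..} w" unfolding w_def by (intro continuous_intros)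
  \<comment> \<open>\<open>M\<close> is the logarithm of c^2 as a function of z; its derivative is 2
    c'/c divided by z'.\<close>
  have "continuous_on {?a<..} (\<lambda>y. - 2 * growth al k (y - ?a) / w y)"
    unfolding growth_def by (intro continuous_intros cw) (use w0 in auto)
  then obtain M where M: "M ?z0 = 0" "\<And>y. ?a < y \<Longrightarrow> (M has_real_derivative - 2 * growth al k (y - ?a) / w y) (at y)"
    using antiderivative_greaterThan[OF _ z0] by blast
  have cM: "continuous_on {?a<..} M"
    by (rule continuous_on_greaterThan_DERIV[OF M(2)])
  \<comment> \<open>Time as a function of z: dt/dz = - c^2 / w.\<close>
  have "continuous_on {?a<..} (\<lambda>y. - exp (M y) / w y)"
    by (intro continuous_intros cw cM) (use w0 in auto)
  then obtain \<tau> where \<tau>: "\<tau> ?z0 = 0" "\<And>y. ?a < y \<Longrightarrow> (\<tau> has_real_derivative - exp (M y) / w y) (at y)"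
    using antiderivative_greaterThan[OF _ z0] by blast
  have unbounded: "\<exists>y>?a. t < \<tau> y" for t
  proof -
    let ?C = "?z0 * (?z0 + ?a)"
    have C: "0 < ?C" using w[OF z0] by simp
    \<comment> \<open>Between \<open>?a\<close> and \<open>?z0\<close>, w(r) is at most (r - ?a) ?C
      and exp (M r) is at least 1, so \<open>\<tau> y\<close> is at least (ln b - ln (y - ?a)) / ?C.
      At this \<open>y\<close> the bound equals |t| + 1 / ?C.\<close>
    define y where "y = ?a + b * exp (- ?C * \<bar>t\<bar> - 1)"
    have "0 \<le> ?C * \<bar>t\<bar>" using k b by (intro mult_nonneg_nonneg) auto
    then have "exp (- ?C * \<bar>t\<bar> - 1) < 1" unfolding exp_less_one_iff minus_mult_left[symmetric] by linarith
    then have y: "?a < y" "y < ?z0" using b by (simp_all add: y_def)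
    have "0 \<le> M x" if "?a < x" "x \<le> ?z0" for x
    proof -
      have "M ?z0 \<le> M x"
      proof (rule DERIV_nonpos_imp_nonincreasing[OF that(2)])
        fix r assume "x \<le> r" "r \<le> ?z0"
        then have r: "?a < r" using that by simp
        have "- 2 * growth al k (r - ?a) / w r \<le> 0" using H[OF r] w(1)[OF r] by (simp add: divide_nonpos_pos)
        then show "\<exists>D. (M has_real_derivative D) (at r) \<and> D \<le> 0" using M(2)[OF r] by blast
      qed
      then show ?thesis using M(1) by simp
    qed
    note M_nonneg = this
    let ?f = "\<lambda>x. \<tau> x + ln (x - ?a) / ?C"
    have "?f ?z0 \<le> ?f y"
    proof (rule DERIV_nonpos_imp_nonincreasing[where f = ?f])
      show "y \<le> ?z0" using y by simp
      fix r assume "y \<le> r" "r \<le> ?z0"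
      then have r: "?a < r" "r \<le> ?z0" using y by auto
      have "((\<lambda>x. ln (x - ?a) * (1 / ?C)) has_real_derivative (1 / (r - ?a)) * (1 / ?C)) (at r)"
        by (rule derivative_eq_intros refl | use r in \<open>simp\<close>)+
      from DERIV_add[OF \<tau>(2)[OF r(1)] this]
      have "(?f has_real_derivative - exp (M r) / w r + (1 / (r - ?a)) / ?C) (at r)"
        by (simp only: times_divide_eq_right mult_1_right)
      moreover have "- exp (M r) / w r + (1 / (r - ?a)) / ?C \<le> 0"
      proof -
        have "w r \<le> (r - ?a) * ?C"
        proof -
          have "r * (r + ?a) \<le> ?C" using r k w(2,3)[OF r(1)] by (intro mult_mono) auto
          then have "(r - ?a) * (r * (r + ?a)) \<le> (r - ?a) * ?C" using r by (intro mult_left_mono) auto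
          then show ?thesis by (simp add: w_def mult_ac)
        qed
        then have "1 / ((r - ?a) * ?C) \<le> 1 / w r" using w(1)[OF r(1)] by (intro divide_left_mono) (use r C in auto)
        also have "\<dots> \<le> exp (M r) / w r" using M_nonneg[OF r] w(1)[OF r(1)] by (intro divide_right_mono) auto
        finally show ?thesis by simp
      qed
      ultimately show "\<exists>D. (?f has_real_derivative D) (at r) \<and> D \<le> 0" by blast
    qed
    then have "(ln b - ln (y - ?a)) / ?C \<le> \<tau> y" using \<tau>(1) by (simp add: diff_divide_distrib)
    moreover have "ln (y - ?a) = ln b - ?C * \<bar>t\<bar> - 1" using b by (simp add: y_def ln_mult)
    ultimately have "(?C * \<bar>t\<bar> + 1) / ?C \<le> \<tau> y" by simp
    moreover have "t < (?C * \<bar>t\<bar> + 1) / ?C" unfolding pos_less_divide_eq[OF C] using C by (smt (verit) mult.commute mult_left_mono)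
    ultimately show ?thesis using y by (intro exI[of _ y]) auto
  qed
  \<comment> \<open>p as a function of z: d(ln p)/dz = 1 / (4 (z + 2 k)).\<close>
  define P where "P y = exp ((ln (y + ?a) - ln (?z0 + ?a)) / 4)" for y
  \<comment> \<open>The value of 1 - 2 k s as a function of z. It does not determine s when k = 0,
    so \<open>Q\<close>, which stands for s, is obtained by a separate integration and compared with
    \<open>R\<close> in \<open>RQ\<close>.\<close>
  define R where "R y = exp ((ln (y - ?a) - ln (y + ?a) + ln (?z0 + ?a) - ln b) / 2)" for y
  have P': "(P has_real_derivative P y / (4 * (y + ?a))) (at y)" if "?a < y" for y
  proof -
    have "((\<lambda>y. (ln (y + ?a) - ln (?z0 + ?a)) / 4) has_real_derivative 1 / (y + ?a) / 4) (at y)"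
      using DERIV_cdivide[OF DERIV_diff[OF DERIV_ln_add[OF w(3)[OF that]] DERIV_const]] by (simp only: diff_zero)
    from DERIV_chain2[OF DERIV_exp this] show ?thesis unfolding P_def by (simp add: mult.commute)
  qed
  have R': "(R has_real_derivative R y * (?a / ((y - ?a) * (y + ?a)))) (at y)" if "?a < y" for y
  proof -
    have "((\<lambda>y. (ln (y - ?a) - ln (y + ?a) + ln (?z0 + ?a) - ln b) / 2) has_real_derivative
        (1 / (y - ?a) - 1 / (y + ?a)) / 2) (at y)"
      using DERIV_cdivide[OF DERIV_diff[OF DERIV_add[OF DERIV_diff[OF DERIV_ln_add[of y "- ?a"] DERIV_ln_add[OF w(3)[OF that]]] DERIV_const] DERIV_const]]
        w(4)[OF that] by (simp only: diff_zero add_0_right uminus_add_conv_diff add_uminus_conv_diff)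
    moreover have "(1 / (y - ?a) - 1 / (y + ?a)) / 2 = ?a / ((y - ?a) * (y + ?a))"
      using w0[OF that] by (simp add: diff_frac_eq)
    ultimately have "((\<lambda>y. (ln (y - ?a) - ln (y + ?a) + ln (?z0 + ?a) - ln b) / 2) has_real_derivative
        ?a / ((y - ?a) * (y + ?a))) (at y)" by (simp only:)
    from DERIV_chain2[OF DERIV_exp this] show ?thesis unfolding R_def .
  qed
  have cR: "continuous_on {?a<..} R"
    by (rule continuous_on_greaterThan_DERIV[OF R'])
  have "continuous_on {?a<..} (\<lambda>y. - R y / ((y - ?a) * (y + ?a)))"
    by (intro continuous_intros cR) (use w0 in auto)
  then obtain Q where Q: "Q ?z0 = 0" "\<And>y. ?a < y \<Longrightarrow> (Q has_real_derivative - R y / ((y - ?a) * (y + ?a))) (at y)"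
    using antiderivative_greaterThan[OF _ z0] by blast
  have RQ: "1 - ?a * Q y = R y" if "?a < y" for y
  proof -
    have "((\<lambda>y. R y + ?a * Q y) has_field_derivative 0) (at y within {?a<..})" if "y \<in> {?a<..}" for y
    proof -
      have y: "?a < y" using that by simp
      have "R y * (?a / ((y - ?a) * (y + ?a))) + ?a * (- R y / ((y - ?a) * (y + ?a))) = 0" by simp
      then show ?thesis
        using DERIV_add[OF R'[OF y] DERIV_cmult[OF Q(2)[OF y], of ?a]] by (simp only: has_field_derivative_at_within)
    qed
    then obtain C where "\<And>y. y \<in> {?a<..} \<Longrightarrow> R y + ?a * Q y = C"
      using has_field_derivative_zero_constant[of "{?a<..}" "\<lambda>y. R y + ?a * Q y"] by auto
    moreover have "R ?z0 = 1" by (simp add: R_def)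
    ultimately show ?thesis using Q(1) that z0 by (metis add.right_neutral add_diff_cancel_right' greaterThan_iff mult_zero_right)
  qed
  \<comment> \<open>Consistency of the substitution: computed from p and s, |b|^2 is indeed z - 2
    k.\<close>
  have \<beta>: "\<beta> (P y) (Q y) = y - ?a" if "?a < y" for y
  proof -
    have e: "exp (x / 4) ^ 4 = exp x" "exp (x / 2) ^ 2 = exp x" for x :: real
      by (simp_all flip: exp_of_nat_mult)
    have 1: "P y ^ 4 = (y + ?a) / (?z0 + ?a)"
      unfolding P_def e using w[OF that] w[OF z0] by (simp only: exp_diff exp_ln)
    have 2: "R y ^ 2 = (y - ?a) / (y + ?a) * (?z0 + ?a) / b"
      unfolding R_def e using w[OF that] w[OF z0] b by (simp only: exp_diff exp_add exp_ln)
    show ?thesis unfolding \<beta>_def RQ[OF that] 1 2 using w0[OF that] w0[OF z0] b by simp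
  qed
  have neg: "- exp (M y) / w y < 0" if "?a < y" for y
    using w(1)[OF that] by (simp add: divide_neg_pos)
  obtain z T where T: "T < (0::ereal)" "z 0 = ?z0" "\<And>t. T < ereal t \<Longrightarrow> ?a < z t"
    and z': "\<And>t. T < ereal t \<Longrightarrow> (z has_real_derivative 1 / (- exp (M (z t)) / w (z t))) (at t)"
    and lim: "\<And>t. T = ereal t \<Longrightarrow> filterlim z at_top (at_right t)"
    by (rule inverse_time_change[OF \<tau>(2) neg z0 \<tau>(1) unbounded], assumption, assumption) (rule that)
  have comp: "((\<lambda>t. F (z t)) has_real_derivative D * (1 / (- exp (M (z t)) / w (z t)))) (at t)"
    if "T < ereal t" "(F has_real_derivative D) (at (z t))" for F D t
    using DERIV_chain2[OF that(2) z'[OF that(1)]] .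
  show thesis
  proof (rule that[of T "\<lambda>t. exp (M (z t) / 2)" "\<lambda>t. P (z t)" "\<lambda>t. Q (z t)"])
    fix t assume t: "T < ereal t"
    note zt = T(3)[OF t]
    have sq: "(exp (M (z t) / 2))\<^sup>2 = exp (M (z t))" by (simp add: power2_eq_square flip: exp_add)
    have "((\<lambda>y. exp (M y / 2)) has_real_derivative exp (M (z t) / 2) * (- 2 * growth al k (z t - ?a) / w (z t) / 2)) (at (z t))"
      by (rule DERIV_chain2[OF DERIV_exp DERIV_cdivide[OF M(2)[OF zt]]])
    from comp[OF t this] have "((\<lambda>t. exp (M (z t) / 2)) has_real_derivative
      growth al k (z t - ?a) * exp (M (z t) / 2) / exp (M (z t))) (at t)"
      using w0[OF zt] by (simp add: field_simps)
    then show "((\<lambda>t. exp (M (z t) / 2)) has_real_derivative growth al k (\<beta> (P (z t)) (Q (z t))) / exp (M (z t) / 2)) (at t)"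
      unfolding \<beta>[OF zt] sq[symmetric] by (simp add: power2_eq_square)
    show "((\<lambda>t. P (z t)) has_real_derivative - ((2 * k + \<beta> (P (z t)) (Q (z t))) / (exp (M (z t) / 2))\<^sup>2)
        * \<beta> (P (z t)) (Q (z t)) * P (z t) / 4) (at t)"
    proof -
      have "x / (4 * (y + a)) * (1 / (- m / (y * (y - a) * (y + a)))) = - ((a + (y - a)) / m) * (y - a) * x / 4"
        if "y + a \<noteq> 0" "y - a \<noteq> 0" "y \<noteq> 0" "m \<noteq> 0" for x y a m :: real
        using that by (simp add: divide_simps)
      from this[OF w0(3,4,2)[OF zt], of "exp (M (z t))" "P (z t)"]
      show ?thesis unfolding \<beta>[OF zt] sq using comp[OF t P'[OF zt]] by (simp add: w_def)
    qed
    show "((\<lambda>t. Q (z t)) has_real_derivative ((2 * k + \<beta> (P (z t)) (Q (z t))) / (exp (M (z t) / 2))\<^sup>2)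
        * (1 - 2 * k * Q (z t))) (at t)"
    proof -
      have "- x / ((y - a) * (y + a)) * (1 / (- m / (y * (y - a) * (y + a)))) = ((a + (y - a)) / m) * x"
        if "y + a \<noteq> 0" "y - a \<noteq> 0" "y \<noteq> 0" "m \<noteq> 0" for x y a m :: real
        using that by (simp add: divide_simps)
      from this[OF w0(3,4,2)[OF zt], of "exp (M (z t))" "R (z t)"]
      show ?thesis unfolding \<beta>[OF zt] sq RQ[OF zt] using comp[OF t Q(2)[OF zt]] by (simp add: w_def)
    qed
  next
    fix t assume "T = ereal t"
    have "filterlim P at_top at_top"
    proof -
      have "filterlim (\<lambda>y. - ln (?z0 + ?a) + ln (?a + y)) at_top at_top"
        by (intro filterlim_tendsto_add_at_top[OF tendsto_const] filterlim_compose[OF ln_at_top] filterlim_ident)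
      then have "filterlim (\<lambda>y. (1/4) * (- ln (?z0 + ?a) + ln (?a + y))) at_top at_top"
        by (rule filterlim_tendsto_pos_mult_at_top[OF tendsto_const, rotated]) simp
      then show ?thesis
        using filterlim_compose[OF exp_at_top] unfolding P_def by (simp add: add_ac)
    qed
    then show "filterlim (\<lambda>t. P (z t)) at_top (at_right t) \<or> ((\<lambda>t. exp (M (z t) / 2)) \<longlongrightarrow> 0) (at_right t)"
      using filterlim_compose lim[OF \<open>T = ereal t\<close>] by blast
  qed (use T M Q in \<open>auto simp: P_def\<close>)
qed


text \<open>c^2 is affine in time; \<open>T\<close> is its zero, or minus infinity if it is
  constant.\<close>

lemma scalar_flow_degenerate:
  obtains T :: ereal and c :: "real \<Rightarrow> real"
  where "T < 0" "c 0 = 1" "\<And>t. T < ereal t \<Longrightarrow> 0 < c t"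
    "\<And>t. T < ereal t \<Longrightarrow> (c has_real_derivative growth al k 0 / c t) (at t)"
    "\<And>t. T = ereal t \<Longrightarrow> (c \<longlongrightarrow> 0) (at_right t)"
proof -
  define h where "h = growth al k 0"
  have h: "0 \<le> h" by (simp add: h_def growth_def)
  define T where "T = (if h = 0 then - \<infinity> else ereal (- 1 / (2 * h)))"
  define c where "c t = sqrt (1 + 2 * h * t)" for t
  have pos: "0 < 1 + 2 * h * t" if "T < ereal t" for t
    using that h by (auto simp: T_def field_simps split: if_splits)
  show thesis
  proof (rule that[of T c])
    show "T < 0" using h by (auto simp: T_def zero_ereal_def)
    fix t
    {
      assume t: "T < ereal t"
      then show "0 < c t" using pos by (simp add: c_def)
      show "(c has_real_derivative growth al k 0 / c t) (at t)"
        unfolding c_def h_def[symmetric]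
        using DERIV_chain2[OF DERIV_real_sqrt[OF pos[OF t]] DERIV_add[OF DERIV_const DERIV_cmult[OF DERIV_ident]]]
        by (simp add: field_simps)
    }
    assume "T = ereal t"
    then have "t = - 1 / (2 * h)" "h \<noteq> 0" by (auto simp: T_def split: if_splits)
    then have "1 + 2 * h * t = 0" by simp
    then have "c t = 0" by (simp add: c_def)
    moreover have "isCont c t" unfolding c_def by (intro continuous_intros)
    ultimately show "(c \<longlongrightarrow> 0) (at_right t)"
      by (metis continuous_at_imp_continuous_within continuous_within)
  qed (simp add: c_def)
qed


text \<open>The equation for s is claimed only for nonzero b. Otherwise s is kept at 0; its
  coefficient in the shift of the frame vanishes with b.\<close>

lemma scalar_flow_exists:
  assumes k: "0 \<le> k" and b: "0 \<le> b"
  defines "\<beta> \<equiv> \<lambda>p s. p ^ 4 * (1 - 2 * k * s)\<^sup>2 * b"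
  obtains T :: ereal and c p s :: "real \<Rightarrow> real"
  where "T < 0" "c 0 = 1" "p 0 = 1" "s 0 = 0" "\<And>t. T < ereal t \<Longrightarrow> 0 < c t" "\<And>t. T < ereal t \<Longrightarrow> 0 < p t"
    "\<And>t. T < ereal t \<Longrightarrow> (c has_real_derivative growth al k (\<beta> (p t) (s t)) / c t) (at t)"
    "\<And>t. T < ereal t \<Longrightarrow> (p has_real_derivative
      - ((2 * k + \<beta> (p t) (s t)) / (c t)\<^sup>2) * \<beta> (p t) (s t) * p t / 4) (at t)"
    "\<And>t. T < ereal t \<Longrightarrow> b \<noteq> 0 \<Longrightarrow>
      (s has_real_derivative ((2 * k + \<beta> (p t) (s t)) / (c t)\<^sup>2) * (1 - 2 * k * s t)) (at t)"
    "\<And>t. T = ereal t \<Longrightarrow> filterlim p at_top (at_right t) \<or> (c \<longlongrightarrow> 0) (at_right t)"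
proof (cases "b = 0")
  case True
  then have \<beta>: "\<beta> p s = 0" for p s by (simp add: \<beta>_def)
  obtain T c where T: "T < 0" "c 0 = 1" "\<And>t. T < ereal t \<Longrightarrow> 0 < c t"
      "\<And>t. T < ereal t \<Longrightarrow> (c has_real_derivative growth al k 0 / c t) (at t)"
      "\<And>t. T = ereal t \<Longrightarrow> (c \<longlongrightarrow> 0) (at_right t)"
    by (rule scalar_flow_degenerate, rule that)
  show thesis
    by (rule that[of T c "\<lambda>_. 1" "\<lambda>_. 0"]) (use T True in \<open>simp_all add: \<beta>\<close>)
next
  case False
  then have "0 < b" using b by simp
  show thesis
    by (rule scalar_flow[OF k \<open>0 < b\<close>, where al = al]) (rule that[unfolded \<beta>_def])
qed

section \<open>The explicit solution\<close>

lemma has_vector_derivative_of_real_mult: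
  "(f has_real_derivative f') (at t) \<Longrightarrow>
    ((\<lambda>t. complex_of_real (f t) * z) has_vector_derivative complex_of_real f' * z) (at t)"
  by (intro has_vector_derivative_mult_left has_vector_derivative_of_real)
    (simp add: has_real_derivative_iff_has_vector_derivative)

context balanced_frame
begin

text \<open>
  The metric with unitary frame \<open>x\<^sub>1 / sqrt c\<close>, \<open>x\<^sub>2 / p\<close>, \<open>p (x\<^sub>3 - s x\<^sub>2)\<close> for \<open>s = sr + i si\<close>.  The
  flow preserves this family because the trace of \<open>eta\<close> in its right-hand side vanishes.
\<close>

definition evolved_metric :: "real \<Rightarrow> real \<Rightarrow> real \<Rightarrow> real \<Rightarrow> 'a \<Rightarrow> 'a \<Rightarrow> real" where
  "evolved_metric c p sr si x y =
     c * (g x1 x * g x1 y + g (J x1) x * g (J x1) y)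
   + p\<^sup>2 * ((g x2 x + sr * g x3 x - si * g (J x3) x) * (g x2 y + sr * g x3 y - si * g (J x3) y)
         + (g (J x2) x + si * g x3 x + sr * g (J x3) x) * (g (J x2) y + si * g x3 y + sr * g (J x3) y))
   + 1 / p\<^sup>2 * (g x3 x * g x3 y + g (J x3) x * g (J x3) y)"

lemma frame_coordinates_eq_0:
  assumes "g x1 x = 0" "g (J x1) x = 0" "g x2 x = 0" "g (J x2) x = 0" "g x3 x = 0" "g (J x3) x = 0"
  shows "x = 0"
  using frame_expansion[of x] assms by (simp add: g_commute[of x])

lemma g_J_right: "g v (J x) = - g (J v) x"
  by (simp add: g_J_left)

lemma hermitian_evolved_metric:
  assumes "0 < c" "0 < p"
  shows "hermitian_metric J (evolved_metric c p sr si)"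
  unfolding hermitian_metric_def
proof (intro conjI allI impI)
  show "bilinear (evolved_metric c p sr si)"
    unfolding bilinear_def linear_iff by (auto simp: evolved_metric_def g_simps algebra_simps)
  show "evolved_metric c p sr si X Y = evolved_metric c p sr si Y X" for X Y
    by (simp add: evolved_metric_def mult_ac)
  show "evolved_metric c p sr si (J X) (J Y) = evolved_metric c p sr si X Y" for X Y
    by (simp add: evolved_metric_def g_J_right g_simps J_simps) (simp add: algebra_simps)
  fix X :: 'a assume "X \<noteq> 0"
  let ?u = "g x2 X + sr * g x3 X - si * g (J x3) X" and ?v = "g (J x2) X + si * g x3 X + sr * g (J x3) X"
  have eq: "evolved_metric c p sr si X X = c * ((g x1 X)\<^sup>2 + (g (J x1) X)\<^sup>2) + p\<^sup>2 * (?u\<^sup>2 + ?v\<^sup>2)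
    + 1 / p\<^sup>2 * ((g x3 X)\<^sup>2 + (g (J x3) X)\<^sup>2)"
    by (simp add: evolved_metric_def power2_eq_square)
  have nonneg: "0 \<le> c * ((g x1 X)\<^sup>2 + (g (J x1) X)\<^sup>2)" "0 \<le> p\<^sup>2 * (?u\<^sup>2 + ?v\<^sup>2)"
    "0 \<le> 1 / p\<^sup>2 * ((g x3 X)\<^sup>2 + (g (J x3) X)\<^sup>2)"
    using assms by (auto intro!: mult_nonneg_nonneg)
  show "0 < evolved_metric c p sr si X X"
  proof (rule ccontr)
    assume "\<not> ?thesis"
    then have 0: "c * ((g x1 X)\<^sup>2 + (g (J x1) X)\<^sup>2) = 0" "p\<^sup>2 * (?u\<^sup>2 + ?v\<^sup>2) = 0"
      "1 / p\<^sup>2 * ((g x3 X)\<^sup>2 + (g (J x3) X)\<^sup>2) = 0"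
      using nonneg eq by linarith+
    then have "g x1 X = 0" "g (J x1) X = 0" "?u = 0" "?v = 0" "g x3 X = 0" "g (J x3) X = 0"
      using assms by (auto simp: sum_power2_eq_zero_iff)
    then have "X = 0" by (intro frame_coordinates_eq_0) auto
    then show False using \<open>X \<noteq> 0\<close> by simp
  qed
qed

text \<open>With \<open>a = (\<lambda>\<^sub>1 - \<lambda>\<^sub>2) / 2\<close>, these are \<open>|a|\<^sup>2\<close> and \<open>|b|\<^sup>2\<close>.\<close>

definition "sp = al\<^sup>2 + dn\<^sup>2 / 4"
definition "bb = br\<^sup>2 + bi\<^sup>2"

text \<open>In the new frame \<open>D\<close> is triangular with the same eigenvalues and with b
  replaced by p^2 (b - 2 a s), where a = (l1 - l2) / 2. This makes
  \<open>balanced_flow_rhs_frame\<close> available at every metric of the family.\<close>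

lemma evolved_frame:
  assumes "0 < c" "0 < p"
  shows "balanced_frame \<mu> J D \<epsilon> (evolved_metric c p sr si) ((1 / sqrt c) *\<^sub>R x1) ((1 / p) *\<^sub>R x2)
    (p *\<^sub>R (x3 - sr *\<^sub>R x2 - si *\<^sub>R J x2)) al nu nu' (p\<^sup>2 * (br - 2 * al * sr + dn * si))
    (p\<^sup>2 * (bi - 2 * al * si - dn * sr)) (\<delta> / sqrt c)"
proof
  have c: "sqrt c \<noteq> 0" "sqrt c * sqrt c = c" "c \<noteq> 0" using assms by auto
  have p: "p \<noteq> 0" using assms by auto
  let ?g = "evolved_metric c p sr si"
  show "hermitian_metric J ?g" by (rule hermitian_evolved_metric[OF assms])
  show "?g ((1 / sqrt c) *\<^sub>R x1) ((1 / sqrt c) *\<^sub>R x1) = 1" "?g ((1 / p) *\<^sub>R x2) ((1 / p) *\<^sub>R x2) = 1"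
    "?g (p *\<^sub>R (x3 - sr *\<^sub>R x2 - si *\<^sub>R J x2)) (p *\<^sub>R (x3 - sr *\<^sub>R x2 - si *\<^sub>R J x2)) = 1"
    "?g ((1 / sqrt c) *\<^sub>R x1) ((1 / p) *\<^sub>R x2) = 0" "?g ((1 / sqrt c) *\<^sub>R x1) (J ((1 / p) *\<^sub>R x2)) = 0"
    "?g ((1 / sqrt c) *\<^sub>R x1) (p *\<^sub>R (x3 - sr *\<^sub>R x2 - si *\<^sub>R J x2)) = 0"
    "?g ((1 / sqrt c) *\<^sub>R x1) (J (p *\<^sub>R (x3 - sr *\<^sub>R x2 - si *\<^sub>R J x2))) = 0"
    "?g ((1 / p) *\<^sub>R x2) (p *\<^sub>R (x3 - sr *\<^sub>R x2 - si *\<^sub>R J x2)) = 0"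
    "?g ((1 / p) *\<^sub>R x2) (J (p *\<^sub>R (x3 - sr *\<^sub>R x2 - si *\<^sub>R J x2))) = 0"
    unfolding evolved_metric_def using c p
    by (simp_all add: g_simps J_simps power2_eq_square)
  show "D ((1 / p) *\<^sub>R x2) = al *\<^sub>R ((1 / p) *\<^sub>R x2) + nu *\<^sub>R J ((1 / p) *\<^sub>R x2)"
    by (simp add: D_simps J_simps D2 scaleR_add_right mult.commute)
  show "D (p *\<^sub>R (x3 - sr *\<^sub>R x2 - si *\<^sub>R J x2)) = (p\<^sup>2 * (br - 2 * al * sr + dn * si)) *\<^sub>R (1 / p) *\<^sub>R x2
    + (p\<^sup>2 * (bi - 2 * al * si - dn * sr)) *\<^sub>R J ((1 / p) *\<^sub>R x2)
    - al *\<^sub>R p *\<^sub>R (x3 - sr *\<^sub>R x2 - si *\<^sub>R J x2) + nu' *\<^sub>R J (p *\<^sub>R (x3 - sr *\<^sub>R x2 - si *\<^sub>R J x2))"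
  proof -
    have pp: "p\<^sup>2 * y * (1 / p) = p * y" for y using p by (simp add: power2_eq_square)
    have two: "(al * (p * (y * 2))) *\<^sub>R v = (al * (p * y)) *\<^sub>R v + (al * (p * y)) *\<^sub>R v" for y and v :: 'a
      unfolding scaleR_add_left[symmetric] by (simp only: mult_2_right distrib_left)
    show ?thesis
      by (simp only: D_simps J_simps D2 D3 D_frame scaleR_scaleR pp)
        (simp add: J_simps algebra_simps, simp only: two add_ac)
  qed
  show "\<epsilon> ((1 / sqrt c) *\<^sub>R x1) = 0" "\<epsilon> ((1 / p) *\<^sub>R x2) = 0" "\<epsilon> (J ((1 / p) *\<^sub>R x2)) = 0"
    "\<epsilon> (p *\<^sub>R (x3 - sr *\<^sub>R x2 - si *\<^sub>R J x2)) = 0" "\<epsilon> (J (p *\<^sub>R (x3 - sr *\<^sub>R x2 - si *\<^sub>R J x2))) = 0"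
    "\<epsilon> (J ((1 / sqrt c) *\<^sub>R x1)) = \<delta> / sqrt c"
    by (simp_all add: \<epsilon>_simps J_simps \<epsilon>_frame)
  show "\<delta> / sqrt c \<noteq> 0" using \<delta> c by simp
  show "D ((1 / sqrt c) *\<^sub>R x1) = 0" by (simp add: D_simps D1)
qed (simp_all add: J_simps dim)

lemma eta_apply: "eta k1 k2 kr ki xs = complex_of_real k1 * (X2 \<^bold>\<and> Y2) xs + complex_of_real k2 * (X3 \<^bold>\<and> Y3) xs
    + complex_of_real kr * (X2 \<^bold>\<and> Y3 + X3 \<^bold>\<and> Y2) xs + complex_of_real ki * (X2 \<^bold>\<and> X3 + Y2 \<^bold>\<and> Y3) xs"
  by (simp add: eta_def fscale_apply distrib_left)

text \<open>Everything is expressed in the fixed 1-forms of the initial frame, so that the flow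
  equation can be compared coefficient by coefficient. The factor \<delta>^4 of the new frame is 1 /
  c^2.\<close>

lemma evolved_forms:
  fixes c p sr si :: real
  assumes "0 < c" "0 < p"
  defines "\<beta> \<equiv> p ^ 4 * ((br - 2 * al * sr + dn * si)\<^sup>2 + (bi - 2 * al * si - dn * sr)\<^sup>2)"
  defines "N \<equiv> (2 * sp + \<beta>) / c\<^sup>2"
  defines "kr \<equiv> N * p\<^sup>2 * (al * (br - 2 * al * sr + dn * si) + dn / 2 * (bi - 2 * al * si - dn * sr))"
    and "ki \<equiv> N * p\<^sup>2 * (al * (bi - 2 * al * si - dn * sr) - dn / 2 * (br - 2 * al * sr + dn * si))"
  assumes \<delta>1: "\<delta> = 1"
  shows "fundamental_form J (evolved_metric c p sr si) =
      complex_of_real c \<cdot> (X1 \<^bold>\<and> Y1) + eta (p\<^sup>2) (p\<^sup>2 * (sr\<^sup>2 + si\<^sup>2) + 1 / p\<^sup>2) (p\<^sup>2 * sr) (p\<^sup>2 * si)"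
    and "balanced_flow_rhs \<mu> J (fundamental_form J (evolved_metric c p sr si)) =
      complex_of_real (growth al sp \<beta> / c) \<cdot> (X1 \<^bold>\<and> Y1)
      + eta (- p\<^sup>2 * N * \<beta> / 2) (- p\<^sup>2 * (sr\<^sup>2 + si\<^sup>2) * N * \<beta> / 2 + N * \<beta> / 2 / p\<^sup>2 + 2 * sr * kr + 2 * si * ki)
          (- p\<^sup>2 * sr * N * \<beta> / 2 + kr) (- p\<^sup>2 * si * N * \<beta> / 2 + ki)"
proof -
  let ?y1 = "(1 / sqrt c) *\<^sub>R x1" and ?y2 = "(1 / p) *\<^sub>R x2" and ?y3 = "p *\<^sub>R (x3 - sr *\<^sub>R x2 - si *\<^sub>R J x2)"
  interpret n: balanced_frame \<mu> J D \<epsilon> "evolved_metric c p sr si" ?y1 ?y2 ?y3 al nu nu'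
    "p\<^sup>2 * (br - 2 * al * sr + dn * si)" "p\<^sup>2 * (bi - 2 * al * si - dn * sr)" "\<delta> / sqrt c"
    by (rule evolved_frame[OF assms(1,2)])
  have c: "c / sqrt c = sqrt c" "sqrt c * sqrt c = c" "(sqrt c)\<^sup>2 = c" "c \<noteq> 0"
    using assms(1) by (auto simp: real_div_sqrt)
  have p: "p \<noteq> 0" using assms(2) by auto
  have f: "n.flat v = one_form (\<lambda>x. complex_of_real (evolved_metric c p sr si v x))" for v
    by (simp add: n.flat_def)
  have lin: "linear (evolved_metric c p sr si v)" for v by (rule n.linear_g(1))
  have flats: "n.flat ?y1 = flat (sqrt c *\<^sub>R x1)" "n.flat (J ?y1) = flat (sqrt c *\<^sub>R J x1)"
    "n.flat ?y2 = flat (p *\<^sub>R (x2 + sr *\<^sub>R x3 - si *\<^sub>R J x3))"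
    "n.flat (J ?y2) = flat (p *\<^sub>R (J x2 + si *\<^sub>R x3 + sr *\<^sub>R J x3))"
    "n.flat ?y3 = flat ((1 / p) *\<^sub>R x3)" "n.flat (J ?y3) = flat ((1 / p) *\<^sub>R J x3)"
  proof -
    have *: "n.flat v = flat w" if "\<forall>u\<in>set frame_list. evolved_metric c p sr si v u = g w u" for v w
      unfolding f using that by (intro flat_eqI[OF lin]) blast
    show "n.flat ?y1 = flat (sqrt c *\<^sub>R x1)" "n.flat (J ?y1) = flat (sqrt c *\<^sub>R J x1)"
      "n.flat ?y2 = flat (p *\<^sub>R (x2 + sr *\<^sub>R x3 - si *\<^sub>R J x3))"
      "n.flat (J ?y2) = flat (p *\<^sub>R (J x2 + si *\<^sub>R x3 + sr *\<^sub>R J x3))"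
      "n.flat ?y3 = flat ((1 / p) *\<^sub>R x3)" "n.flat (J ?y3) = flat ((1 / p) *\<^sub>R J x3)"
      by (rule *, simp add: evolved_metric_def g_simps J_simps power2_eq_square c(1) p)+
  qed
  have X1Y1: "n.X1 \<^bold>\<and> n.Y1 = complex_of_real c \<cdot> (X1 \<^bold>\<and> Y1)"
    unfolding flats using c by (simp add: flat_linear flip: of_real_mult)
  have eta: "n.eta k1 k2 kr ki = eta (p\<^sup>2 * k1) (p\<^sup>2 * (sr\<^sup>2 + si\<^sup>2) * k1 + k2 / p\<^sup>2 + 2 * sr * kr + 2 * si * ki)
    (p\<^sup>2 * sr * k1 + kr) (p\<^sup>2 * si * k1 + ki)" for k1 k2 kr ki
    unfolding n.eta_def eta_def flats
    by (simp add: flat_linear flat_sort)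
      (simp add: fun_eq_iff fscale_apply p power2_eq_square algebra_simps)
  show "fundamental_form J (evolved_metric c p sr si) =
      complex_of_real c \<cdot> (X1 \<^bold>\<and> Y1) + eta (p\<^sup>2) (p\<^sup>2 * (sr\<^sup>2 + si\<^sup>2) + 1 / p\<^sup>2) (p\<^sup>2 * sr) (p\<^sup>2 * si)"
    using n.\<omega>_eq_eta unfolding n.\<omega>_def X1Y1 eta by simp
  have b: "(p\<^sup>2 * (br - 2 * al * sr + dn * si))\<^sup>2 + (p\<^sup>2 * (bi - 2 * al * si - dn * sr))\<^sup>2 = \<beta>"
  proof -
    have "(p\<^sup>2 * x)\<^sup>2 + (p\<^sup>2 * y)\<^sup>2 = p ^ 4 * (x\<^sup>2 + y\<^sup>2)" for x y
      by (simp add: power_mult_distrib distrib_left)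
    then show ?thesis unfolding \<beta>_def .
  qed
  have H: "n.H0 = growth al sp \<beta>" "n.nA = N * c\<^sup>2"
  proof -
    show "n.H0 = growth al sp \<beta>" unfolding n.H0_def b growth_def sp_def ..
    have "x / c\<^sup>2 * c\<^sup>2 = x" for x using c by simp
    then show "n.nA = N * c\<^sup>2" unfolding n.nA_def b N_def sp_def by simp
  qed
  have d: "(\<delta> / sqrt c) ^ 4 = 1 / c\<^sup>2"
    using c \<delta>1 by (simp add: power_divide power4_eq_xxxx power2_eq_square)
  show "balanced_flow_rhs \<mu> J (fundamental_form J (evolved_metric c p sr si)) =
      complex_of_real (growth al sp \<beta> / c) \<cdot> (X1 \<^bold>\<and> Y1)
      + eta (- p\<^sup>2 * N * \<beta> / 2) (- p\<^sup>2 * (sr\<^sup>2 + si\<^sup>2) * N * \<beta> / 2 + N * \<beta> / 2 / p\<^sup>2 + 2 * sr * kr + 2 * si * ki)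
          (- p\<^sup>2 * sr * N * \<beta> / 2 + kr) (- p\<^sup>2 * si * N * \<beta> / 2 + ki)"
  proof -
    define Br Bi where "Br = br - 2 * al * sr + dn * si" and "Bi = bi - 2 * al * si - dn * sr"
    have N: "1 / c\<^sup>2 * (- (N * c\<^sup>2) * \<beta> / 2) = - (N * \<beta> / 2)" "1 / c\<^sup>2 * (N * c\<^sup>2 * \<beta> / 2) = N * \<beta> / 2"
      "1 / c\<^sup>2 * (N * c\<^sup>2 * y) = N * y" for y
      using c by simp_all
    have HX: "complex_of_real (1 / c\<^sup>2) \<cdot> complex_of_real (growth al sp \<beta>) \<cdot> complex_of_real c \<cdot> (X1 \<^bold>\<and> Y1)
      = complex_of_real (growth al sp \<beta> / c) \<cdot> (X1 \<^bold>\<and> Y1)"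
      unfolding fscale_simps(7) of_real_mult[symmetric] using c by (simp add: power2_eq_square)
    have kri: "kr = N * (al * (p\<^sup>2 * Br) + dn / 2 * (p\<^sup>2 * Bi))" "ki = N * (al * (p\<^sup>2 * Bi) - dn / 2 * (p\<^sup>2 * Br))"
      unfolding kr_def ki_def Br_def[symmetric] Bi_def[symmetric] by (simp_all add: algebra_simps)
    note folds = Br_def[symmetric] Bi_def[symmetric]
    have "balanced_flow_rhs \<mu> J (fundamental_form J (evolved_metric c p sr si)) =
        complex_of_real (growth al sp \<beta> / c) \<cdot> (X1 \<^bold>\<and> Y1) + n.eta (- (N * \<beta> / 2)) (N * \<beta> / 2) kr ki"
      using n.balanced_flow_rhs_frame
      unfolding n.\<omega>_def X1Y1 folds b[unfolded folds] H[unfolded folds] d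
        fscale_simps(1)[where c = "complex_of_real (1 / c\<^sup>2)"] HX n.eta_scale N kri .
    then show ?thesis
      unfolding eta by (simp add: algebra_simps diff_divide_distrib add_divide_distrib)
  qed
qed

end

section \<open>The maximal solution and the fixed points\<close>

context balanced_frame
begin

sublocale almost_abelian_complex \<mu> J D \<epsilon>
  by unfold_locales (simp_all add: dim J_simps)

text \<open>These values recover c and p from the metric, so that their limits can be confronted
  with a metric at the endpoint.\<close>

lemma evolved_metric_diagonal:
  "evolved_metric c p sr si x1 x1 = c" "evolved_metric c p sr si x2 x2 = p\<^sup>2"
  by (simp_all add: evolved_metric_def g_simps power2_eq_square)

lemma evolved_metric_1: "evolved_metric 1 1 0 0 = g"
proof (intro ext)
  fix x y
  have "g x y = g x (g y x1 *\<^sub>R x1 + g y (J x1) *\<^sub>R J x1 + g y x2 *\<^sub>R x2 + g y (J x2) *\<^sub>R J x2 + g y x3 *\<^sub>R x3 + g y (J x3) *\<^sub>R J x3)"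
    unfolding frame_expansion ..
  also have "\<dots> = evolved_metric 1 1 0 0 x y"
    unfolding evolved_metric_def g_simps(2,4)
      g_commute[of x x1] g_commute[of x "J x1"] g_commute[of x x2] g_commute[of x "J x2"] g_commute[of x x3] g_commute[of x "J x3"]
      g_commute[of y x1] g_commute[of y "J x1"] g_commute[of y x2] g_commute[of y "J x2"] g_commute[of y x3] g_commute[of y "J x3"]
    by simp
  finally show "evolved_metric 1 1 0 0 x y = g x y" ..
qed

theorem maximal_solution_exists:
  assumes \<delta>1: "\<delta> = 1"
  shows "\<exists>T::ereal. T < 0 \<and> (\<exists>\<omega>'. maximal_balanced_flow_solution \<mu> J \<omega> {t::real. T < ereal t} \<omega>')"
proof -
  have "0 \<le> sp" "0 \<le> bb" by (simp_all add: sp_def bb_def)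
  then obtain T c p s where T: "T < (0::ereal)" and init: "c 0 = (1::real)" "p 0 = (1::real)" "s 0 = (0::real)"
    and pos: "\<And>t. T < ereal t \<Longrightarrow> 0 < c t" "\<And>t. T < ereal t \<Longrightarrow> 0 < p t"
    and c': "\<And>t. T < ereal t \<Longrightarrow>
      (c has_real_derivative growth al sp (p t ^ 4 * (1 - 2 * sp * s t)\<^sup>2 * bb) / c t) (at t)"
    and p': "\<And>t. T < ereal t \<Longrightarrow> (p has_real_derivative
      - ((2 * sp + p t ^ 4 * (1 - 2 * sp * s t)\<^sup>2 * bb) / (c t)\<^sup>2) * (p t ^ 4 * (1 - 2 * sp * s t)\<^sup>2 * bb) * p t / 4) (at t)"
    and s': "\<And>t. T < ereal t \<Longrightarrow> bb \<noteq> 0 \<Longrightarrow>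
      (s has_real_derivative ((2 * sp + p t ^ 4 * (1 - 2 * sp * s t)\<^sup>2 * bb) / (c t)\<^sup>2) * (1 - 2 * sp * s t)) (at t)"
    and blowup: "\<And>t. T = ereal t \<Longrightarrow> filterlim p at_top (at_right t) \<or> (c \<longlongrightarrow> 0) (at_right t)"
    by (rule scalar_flow_exists[where al = al]) (rule that)
  \<comment> \<open>The complex shift is \<open>s t\<close> times conj(a) b, the direction of the
    off-diagonal entry of the flow. Then b - 2 a conj(a) b s = b (1 - 2 |a|^2 s), which leaves a
    single real unknown.\<close>
  define sr where "sr t = s t * (al * br + dn / 2 * bi)" for t
  define si where "si t = s t * (al * bi - dn / 2 * br)" for t
  have B: "br - 2 * al * sr t + dn * si t = br * (1 - 2 * sp * s t)"
    "bi - 2 * al * si t - dn * sr t = bi * (1 - 2 * sp * s t)" for t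
    by (simp_all add: sr_def si_def sp_def power2_eq_square field_simps)
  define \<beta> where "\<beta> t = p t ^ 4 * (1 - 2 * sp * s t)\<^sup>2 * bb" for t
  define N where "N t = (2 * sp + \<beta> t) / (c t)\<^sup>2" for t
  have \<beta>_alt: "p t ^ 4 * ((br * (1 - 2 * sp * s t))\<^sup>2 + (bi * (1 - 2 * sp * s t))\<^sup>2) = \<beta> t" for t
    unfolding \<beta>_def bb_def power_mult_distrib by (simp only: distrib_left distrib_right mult_ac)
  note c'' = c'[folded \<beta>_def] and p'' = p'[folded \<beta>_def, folded N_def] and s'' = s'[folded \<beta>_def, folded N_def]
  define vr where "vr t = N t * (al * (br * (1 - 2 * sp * s t)) + dn / 2 * (bi * (1 - 2 * sp * s t)))" for t
  define vi where "vi t = N t * (al * (bi * (1 - 2 * sp * s t)) - dn / 2 * (br * (1 - 2 * sp * s t)))" for t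
  have sr': "(sr has_real_derivative vr t) (at t)" and si': "(si has_real_derivative vi t) (at t)"
    if t: "T < ereal t" for t
  proof -
    show "(sr has_real_derivative vr t) (at t)"
    proof (cases "bb = 0")
      \<comment> \<open>No equation for s is available here, but the coefficient of
        \<open>s t\<close> is 0.\<close>
      case True
      then have "br = 0" "bi = 0" by (auto simp: bb_def sum_power2_eq_zero_iff)
      then show ?thesis by (simp add: sr_def[abs_def] vr_def)
    next
      case False
      have "sr = (\<lambda>t. s t * (al * br + dn / 2 * bi))" by (simp add: sr_def fun_eq_iff)
      moreover have "vr t = N t * (1 - 2 * sp * s t) * (al * br + dn / 2 * bi)" by (simp add: vr_def algebra_simps)
      ultimately show ?thesis using DERIV_cmult_right[OF s''[OF t False]] by simp
    qed
    show "(si has_real_derivative vi t) (at t)"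
    proof (cases "bb = 0")
      case True
      then have "br = 0" "bi = 0" by (auto simp: bb_def sum_power2_eq_zero_iff)
      then show ?thesis by (simp add: si_def[abs_def] vi_def)
    next
      case False
      have "si = (\<lambda>t. s t * (al * bi - dn / 2 * br))" by (simp add: si_def fun_eq_iff)
      moreover have "vi t = N t * (1 - 2 * sp * s t) * (al * bi - dn / 2 * br)" by (simp add: vi_def algebra_simps)
      ultimately show ?thesis using DERIV_cmult_right[OF s''[OF t False]] by simp
    qed
  qed
  define h where "h t = evolved_metric (c t) (p t) (sr t) (si t)" for t
  define w where "w t = fundamental_form J (h t)" for t
  let ?I = "{t::real. T < ereal t}"
  have "?I = {t. T < ereal t \<and> ereal t < \<infinity>}" by auto
  then have I: "open ?I" "is_interval ?I" "0 \<in> ?I"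
    using open_einterval[of T \<infinity>] T
    by (auto simp: einterval_def is_interval_1 zero_ereal_def intro: less_le_trans)
  have herm: "hermitian_metric J (h t)" if "T < ereal t" for t
    unfolding h_def by (rule hermitian_evolved_metric[OF pos[OF that]])
  have w_eq: "w t xs = complex_of_real (c t) * (X1 \<^bold>\<and> Y1) xs + eta ((p t)\<^sup>2) ((p t)\<^sup>2 * ((sr t)\<^sup>2 + (si t)\<^sup>2) + 1 / (p t)\<^sup>2)
    ((p t)\<^sup>2 * sr t) ((p t)\<^sup>2 * si t) xs" if "T < ereal t" for t xs
    unfolding w_def h_def evolved_forms(1)[OF pos[OF that] \<delta>1] by (simp add: fscale_apply)
  have w': "((\<lambda>t. w t xs) has_vector_derivative balanced_flow_rhs \<mu> J (w t) xs) (at t)" if t: "T < ereal t" for t xs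
  proof -
    have pt: "p t \<noteq> 0" using pos(2)[OF t] by simp
    let ?P = "- N t * \<beta> t * p t / 4"
    have k1: "((\<lambda>t. (p t)\<^sup>2) has_real_derivative - (p t)\<^sup>2 * N t * \<beta> t / 2) (at t)"
      using DERIV_power[OF p''[OF t], of 2] by (simp add: power2_eq_square algebra_simps)
    have kr: "((\<lambda>t. (p t)\<^sup>2 * sr t) has_real_derivative - (p t)\<^sup>2 * sr t * N t * \<beta> t / 2 + (p t)\<^sup>2 * vr t) (at t)"
      using DERIV_mult[OF k1 sr'[OF t]] by (simp add: algebra_simps)
    have ki: "((\<lambda>t. (p t)\<^sup>2 * si t) has_real_derivative - (p t)\<^sup>2 * si t * N t * \<beta> t / 2 + (p t)\<^sup>2 * vi t) (at t)"
      using DERIV_mult[OF k1 si'[OF t]] by (simp add: algebra_simps)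
    have "((\<lambda>t. (p t)\<^sup>2 * sr t * sr t + (p t)\<^sup>2 * si t * si t + inverse ((p t)\<^sup>2)) has_real_derivative
        (- (p t)\<^sup>2 * sr t * N t * \<beta> t / 2 + (p t)\<^sup>2 * vr t) * sr t + vr t * ((p t)\<^sup>2 * sr t)
      + ((- (p t)\<^sup>2 * si t * N t * \<beta> t / 2 + (p t)\<^sup>2 * vi t) * si t + vi t * ((p t)\<^sup>2 * si t))
      + - (inverse ((p t)\<^sup>2) * (- (p t)\<^sup>2 * N t * \<beta> t / 2) * inverse ((p t)\<^sup>2))) (at t)"
      by (rule DERIV_add[OF DERIV_add[OF DERIV_mult[OF kr sr'[OF t]] DERIV_mult[OF ki si'[OF t]]] DERIV_inverse'[OF k1]])
        (use pt in simp)
    moreover have "(\<lambda>t. (p t)\<^sup>2 * sr t * sr t + (p t)\<^sup>2 * si t * si t + inverse ((p t)\<^sup>2))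
      = (\<lambda>t. (p t)\<^sup>2 * ((sr t)\<^sup>2 + (si t)\<^sup>2) + 1 / (p t)\<^sup>2)"
      by (simp add: fun_eq_iff power2_eq_square[of "sr _"] power2_eq_square[of "si _"] algebra_simps inverse_eq_divide)
    moreover have "(- (p t)\<^sup>2 * sr t * N t * \<beta> t / 2 + (p t)\<^sup>2 * vr t) * sr t + vr t * ((p t)\<^sup>2 * sr t)
      + ((- (p t)\<^sup>2 * si t * N t * \<beta> t / 2 + (p t)\<^sup>2 * vi t) * si t + vi t * ((p t)\<^sup>2 * si t))
      + - (inverse ((p t)\<^sup>2) * (- (p t)\<^sup>2 * N t * \<beta> t / 2) * inverse ((p t)\<^sup>2))
      = - (p t)\<^sup>2 * ((sr t)\<^sup>2 + (si t)\<^sup>2) * N t * \<beta> t / 2 + N t * \<beta> t / 2 / (p t)\<^sup>2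
        + 2 * sr t * ((p t)\<^sup>2 * vr t) + 2 * si t * ((p t)\<^sup>2 * vi t)"
      using pt by (simp add: field_simps power2_eq_square)
    ultimately have k2: "((\<lambda>t. (p t)\<^sup>2 * ((sr t)\<^sup>2 + (si t)\<^sup>2) + 1 / (p t)\<^sup>2) has_real_derivative
      - (p t)\<^sup>2 * ((sr t)\<^sup>2 + (si t)\<^sup>2) * N t * \<beta> t / 2 + N t * \<beta> t / 2 / (p t)\<^sup>2
        + 2 * sr t * ((p t)\<^sup>2 * vr t) + 2 * si t * ((p t)\<^sup>2 * vi t)) (at t)" by (simp only:)
    have v: "N t * (p t)\<^sup>2 * (al * (br * (1 - 2 * sp * s t)) + dn / 2 * (bi * (1 - 2 * sp * s t))) = (p t)\<^sup>2 * vr t"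
      "N t * (p t)\<^sup>2 * (al * (bi * (1 - 2 * sp * s t)) - dn / 2 * (br * (1 - 2 * sp * s t))) = (p t)\<^sup>2 * vi t"
      by (simp_all add: vr_def vi_def)
    have rhs: "balanced_flow_rhs \<mu> J (w t) xs = complex_of_real (growth al sp (\<beta> t) / c t) * (X1 \<^bold>\<and> Y1) xs
      + eta (- (p t)\<^sup>2 * N t * \<beta> t / 2) (- (p t)\<^sup>2 * ((sr t)\<^sup>2 + (si t)\<^sup>2) * N t * \<beta> t / 2 + N t * \<beta> t / 2 / (p t)\<^sup>2
        + 2 * sr t * ((p t)\<^sup>2 * vr t) + 2 * si t * ((p t)\<^sup>2 * vi t))
          (- (p t)\<^sup>2 * sr t * N t * \<beta> t / 2 + (p t)\<^sup>2 * vr t) (- (p t)\<^sup>2 * si t * N t * \<beta> t / 2 + (p t)\<^sup>2 * vi t) xs"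
      unfolding w_def h_def evolved_forms(2)[OF pos[OF t] \<delta>1] B \<beta>_alt N_def[symmetric] v
      by (simp only: plus_fun_apply fscale_apply)
    have "((\<lambda>t. complex_of_real (c t) * (X1 \<^bold>\<and> Y1) xs + eta ((p t)\<^sup>2) ((p t)\<^sup>2 * ((sr t)\<^sup>2 + (si t)\<^sup>2) + 1 / (p t)\<^sup>2)
      ((p t)\<^sup>2 * sr t) ((p t)\<^sup>2 * si t) xs) has_vector_derivative balanced_flow_rhs \<mu> J (w t) xs) (at t)"
      unfolding rhs eta_apply
      by (intro has_vector_derivative_add has_vector_derivative_of_real_mult c''[OF t] k1 k2 kr ki)
    then show ?thesis
      by (rule has_vector_derivative_transform_within_open[OF _ I(1)]) (use t w_eq in auto)
  qed
  have "w 0 = \<omega>"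
    unfolding w_def h_def \<omega>_def using init by (simp add: sr_def si_def evolved_metric_1)
  moreover have "\<exists>g. hermitian_metric J g \<and> w t = fundamental_form J g" if "T < ereal t" for t
    using herm[OF that] w_def by blast
  ultimately have sol: "balanced_flow_solution \<mu> J \<omega> ?I w"
    unfolding balanced_flow_solution_def using I w' by blast
  have "maximal_balanced_flow_solution \<mu> J \<omega> ?I w"
    unfolding maximal_balanced_flow_solution_def
  proof (intro conjI allI impI sol)
    fix I' w1 assume sol': "balanced_flow_solution \<mu> J \<omega> I' w1"
    have I': "open I'" "is_interval I'" "0 \<in> I'" using sol' unfolding balanced_flow_solution_def by auto
    show "I' \<subseteq> ?I"
    proof (rule ccontr)
      assume "\<not> I' \<subseteq> ?I"
      then obtain t where t: "t \<in> I'" "ereal t \<le> T" by (metis mem_Collect_eq not_less subsetI)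
      \<comment> \<open>An interval reaching beyond the family contains the finite endpoint
        \<open>t0\<close>. The metric there is positive definite and is the limit from the right of
        the evolved metrics.\<close>
      then obtain t0 where t0: "T = ereal t0" using T by (cases T) auto
      then have "t \<le> t0" "t0 \<le> 0" using t T by (auto simp: zero_ereal_def)
      then have t0I: "t0 \<in> I'" using I'(2,3) t(1) unfolding is_interval_1 by blast
      let ?h = "\<lambda>s. metric_of J (w1 s)"
      have ev: "eventually (\<lambda>s. s \<in> I' \<and> T < ereal s) (at_right t0)"
        using filter_leD[OF at_within_le_nhds eventually_nhds_in_open[OF I'(1) t0I]] eventually_at_right_less[of t0]
        unfolding t0 by (intro eventually_conj) auto
      have eq: "?h s x x = evolved_metric (c s) (p s) (sr s) (si s) x x" if "s \<in> I' \<and> T < ereal s" for s x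
      proof -
        have "w1 s = w s" using solution_unique[OF sol' sol] that by simp
        then show ?thesis
          using fundamental_form_metric_of(3)[OF herm[of s], of "w s" x x] that
            hermitian_space.metric_of_fundamental_form[of J "h s"]
          by (simp add: w_def h_def hermitian_space_def linear_J herm[unfolded h_def])
      qed
      have lim: "((\<lambda>s. ?h s x x) \<longlongrightarrow> ?h t0 x x) (at_right t0)" for x
        using DERIV_isCont[OF solution_metric(3)[OF sol' t0I, of x x]]
        by (metis continuous_at_imp_continuous_within continuous_within)
      have pos': "0 < ?h t0 x x" if "x \<noteq> 0" for x
        using solution_metric(1)[OF sol' t0I] that unfolding hermitian_metric_def by blast
      have x: "x1 \<noteq> 0" "x2 \<noteq> 0" by (metis frame_g(1,2) g_eq_0_iff zero_neq_one)+
      have c_lim: "(c \<longlongrightarrow> ?h t0 x1 x1) (at_right t0)"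
        using lim by (rule Lim_transform_eventually)
          (use ev in \<open>auto elim!: eventually_mono simp: eq evolved_metric_diagonal\<close>)
      have p_lim: "((\<lambda>s. (p s)\<^sup>2) \<longlongrightarrow> ?h t0 x2 x2) (at_right t0)"
        using lim by (rule Lim_transform_eventually)
          (use ev in \<open>auto elim!: eventually_mono simp: eq evolved_metric_diagonal\<close>)
      from blowup[OF t0] show False
      proof
        assume "(c \<longlongrightarrow> 0) (at_right t0)"
        then have "?h t0 x1 x1 = 0" using c_lim tendsto_unique[OF trivial_limit_at_right_real] by blast
        then show False using pos'[OF x(1)] by simp
      next
        assume "filterlim p at_top (at_right t0)"
        then have "filterlim (\<lambda>s. (p s)\<^sup>2) at_top (at_right t0)"
          by (rule filterlim_pow_at_top[rotated]) simp
        then have "filterlim (\<lambda>s. (p s)\<^sup>2) at_infinity (at_right t0)"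
          by (rule filterlim_at_top_imp_at_infinity)
        then show False
          using p_lim not_tendsto_and_filterlim_at_infinity[OF trivial_limit_at_right_real] by blast
      qed
    qed
    then show "\<forall>t\<in>I'. w1 t = w t"
      using solution_unique[OF sol' sol] by blast
  qed
  then show ?thesis using T by blast
qed

lemma balanced_flow_rhs_eq_0_iff: "balanced_flow_rhs \<mu> J \<omega> = 0 \<longleftrightarrow> al = 0 \<and> br = 0 \<and> bi = 0"
proof
  assume "balanced_flow_rhs \<mu> J \<omega> = 0"
  \<comment> \<open>The component on the first complex line is a nonzero multiple of
    \<open>H0\<close>, a sum of nonnegative terms the first of which controls \<open>al\<close> and
    b.\<close>
  then have "balanced_flow_rhs \<mu> J \<omega> [x1, J x1] = 0" by simp
  then have "H0 = 0"
    unfolding balanced_flow_rhs_frame using \<delta>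
    by (simp add: fscale_apply eta_apply wedge_Cons flat_Cons unit_form_apply)
  moreover have "0 \<le> (br\<^sup>2 + bi\<^sup>2)\<^sup>2 / 4" "0 \<le> (al\<^sup>2 + dn\<^sup>2 / 4) * (br\<^sup>2 + bi\<^sup>2)"
    by simp_all
  ultimately have "(2 * al\<^sup>2 + (br\<^sup>2 + bi\<^sup>2) / 2)\<^sup>2 \<le> 0"
    unfolding H0_def by linarith
  then have "2 * al\<^sup>2 + (br\<^sup>2 + bi\<^sup>2) / 2 = 0" by simp
  moreover have "0 \<le> al\<^sup>2" "0 \<le> br\<^sup>2" "0 \<le> bi\<^sup>2" by simp_all
  ultimately have "al\<^sup>2 = 0 \<and> br\<^sup>2 = 0 \<and> bi\<^sup>2 = 0"
    by (intro conjI) (simp_all add: add_nonneg_eq_0_iff)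
  then show "al = 0 \<and> br = 0 \<and> bi = 0" by simp
next
  assume 0: "al = 0 \<and> br = 0 \<and> bi = 0"
  then have H: "H0 = 0" unfolding H0_def by simp
  show "balanced_flow_rhs \<mu> J \<omega> = 0"
    unfolding balanced_flow_rhs_frame H using 0 by (simp add: eta_def)
qed

lemma kaehler_iff: "kaehler \<mu> \<omega> \<longleftrightarrow> al = 0 \<and> br = 0 \<and> bi = 0"
proof -
  have d: "ext_d \<mu> \<omega> = - (one_form (\<lambda>x. complex_of_real (\<epsilon> x)) \<^bold>\<and> eta (2 * al) (- 2 * al) br bi)"
    using ext_d_eq[of \<omega> \<mu> \<epsilon> D, OF altm_\<omega> \<mu>] by (simp add: \<omega>_eq_eta dact_eta)
  show ?thesis
  proof
    assume "kaehler \<mu> \<omega>"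
    then have "ext_d \<mu> \<omega> xs = 0" for xs unfolding kaehler_def by (rule fun_cong)
    then have 0: "(one_form (\<lambda>x. complex_of_real (\<epsilon> x)) \<^bold>\<and> eta (2 * al) (- 2 * al) br bi) xs = 0" for xs
      unfolding d uminus_apply neg_equal_0_iff_equal .
    \<comment> \<open>Up to nonzero factors the three triples read off \<open>al\<close>,
      \<open>br\<close> and \<open>bi\<close>.\<close>
    show "al = 0 \<and> br = 0 \<and> bi = 0"
      using 0[of "[J x1, x2, J x2]"] 0[of "[J x1, x2, J x3]"] 0[of "[J x1, x2, x3]"] \<delta>
      by (simp add: wedge_Cons fscale_apply \<epsilon>_frame eta_apply contr_apply) (simp add: flat_Cons unit_form_apply)
  next
    assume "al = 0 \<and> br = 0 \<and> bi = 0"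
    then show "kaehler \<mu> \<omega>" unfolding kaehler_def d by (simp add: eta_def fun_eq_iff)
  qed
qed

theorem fixed_iff_kaehler:
  "balanced_flow_solution \<mu> J \<omega> UNIV (\<lambda>_. \<omega>) \<longleftrightarrow> kaehler \<mu> \<omega>"
proof -
  have "((\<lambda>_. \<omega> xs) has_vector_derivative balanced_flow_rhs \<mu> J \<omega> xs) (at t) \<longleftrightarrow> balanced_flow_rhs \<mu> J \<omega> xs = 0"
    for xs and t :: real
    using vector_derivative_unique_at has_vector_derivative_const by metis
  then have "balanced_flow_solution \<mu> J \<omega> UNIV (\<lambda>_. \<omega>) \<longleftrightarrow> balanced_flow_rhs \<mu> J \<omega> = 0"
    unfolding balanced_flow_solution_def using herm by (auto simp: \<omega>_def fun_eq_iff)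
  then show ?thesis unfolding balanced_flow_rhs_eq_0_iff kaehler_iff .
qed

end

section \<open>Adapted frames\<close>

lemma complex_eigenvector:
  fixes a b c d :: complex
  obtains l v w where "a * v + b * w = l * v" "c * v + d * w = l * w" "(cmod v)\<^sup>2 + (cmod w)\<^sup>2 = 1"
proof -
  obtain l v w where *: "a * v + b * w = l * v" "c * v + d * w = l * w" "v \<noteq> 0 \<or> w \<noteq> 0"
  proof (cases "c = 0")
    case True
    then show thesis by (intro that[of 1 0 a]) auto
  next
    case False
    \<comment> \<open>A root of the characteristic polynomial. The vector (l - d, c) satisfies the
      second row by construction and the first by the equation for \<open>l\<close>.\<close>
    define l where "l = (a + d) / 2 + csqrt (((a - d) / 2)\<^sup>2 + b * c)"
    have "(l - (a + d) / 2)\<^sup>2 = ((a - d) / 2)\<^sup>2 + b * c"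
      by (simp add: l_def)
    moreover have "a * (l - d) + b * c - l * (l - d) = ((a - d) / 2)\<^sup>2 + b * c - (l - (a + d) / 2)\<^sup>2"
      by (simp add: power2_eq_square field_simps)
    ultimately have "a * (l - d) + b * c = l * (l - d)"
      by simp
    then show thesis
      by (intro that[of "l - d" c l]) (use False in \<open>auto simp: algebra_simps\<close>)
  qed
  define n where "n = sqrt ((cmod v)\<^sup>2 + (cmod w)\<^sup>2)"
  have n: "0 < n" using *(3) by (auto simp: n_def add_pos_nonneg add_nonneg_pos)
  show thesis
  proof (rule that[of "v / n" "w / n" l])
    show "a * (v / n) + b * (w / n) = l * (v / n)" "c * (v / n) + d * (w / n) = l * (w / n)"
      using * by (simp_all add: add_divide_distrib[symmetric])
    have "(cmod (v / n))\<^sup>2 + (cmod (w / n))\<^sup>2 = ((cmod v)\<^sup>2 + (cmod w)\<^sup>2) / n\<^sup>2"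
      using n by (simp add: norm_divide power_divide add_divide_distrib)
    also have "n\<^sup>2 = (cmod v)\<^sup>2 + (cmod w)\<^sup>2" by (simp add: n_def)
    finally show "(cmod (v / n))\<^sup>2 + (cmod (w / n))\<^sup>2 = 1" using *(3) by (auto simp: sum_power2_eq_zero_iff)
  qed
qed

context hermitian_space
begin

definition cscale :: "complex \<Rightarrow> 'g \<Rightarrow> 'g" where
  "cscale z v = Re z *\<^sub>R v + Im z *\<^sub>R J v"

lemma cscale_mult: "cscale z (cscale w v) = cscale (z * w) v"
  by (simp add: cscale_def J_simps algebra_simps)

lemma cscale_add: "cscale z (v + w) = cscale z v + cscale z w" "cscale (z + z') v = cscale z v + cscale z' v"
  by (simp_all add: cscale_def J_simps algebra_simps)

end

text \<open>Schur triangularisation on the complex plane of \<open>x2\<close> and \<open>x3\<close>: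
  a unit eigenvector is completed to a unitary frame.\<close>

lemma (in unitary_frame) triangular_frame_exists:
  assumes D: "linear D" "\<And>x. D (J x) = J (D x)"
    and orth: "g x1 (D x2) = 0" "g (J x1) (D x2) = 0" "g x1 (D x3) = 0" "g (J x1) (D x3) = 0"
    and D1: "D x1 = 0" and trace: "lin_trace D = 0"
  obtains y2 y3 al nu nu' br bi where "unitary_frame J g x1 y2 y3"
    "D y2 = al *\<^sub>R y2 + nu *\<^sub>R J y2" "D y3 = br *\<^sub>R y2 + bi *\<^sub>R J y2 - al *\<^sub>R y3 + nu' *\<^sub>R J y3"
proof -
  note D_simps = linear_add[OF D(1)] linear_diff[OF D(1)] linear_neg[OF D(1)] linear_0[OF D(1)] linear_cmul[OF D(1)]
  have D_cscale: "D (cscale z v) = cscale z (D v)" for z v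
    by (simp add: cscale_def D_simps D(2))
  have expand: "u = cscale (Complex (g u x2) (g u (J x2))) x2 + cscale (Complex (g u x3) (g u (J x3))) x3"
    if "g x1 u = 0" "g (J x1) u = 0" for u
    using frame_expansion[of u] that by (simp add: cscale_def g_commute[of u x1] g_commute[of u "J x1"] add_ac)
  let ?a = "Complex (g (D x2) x2) (g (D x2) (J x2))" and ?c = "Complex (g (D x2) x3) (g (D x2) (J x3))"
  let ?b = "Complex (g (D x3) x2) (g (D x3) (J x2))" and ?d = "Complex (g (D x3) x3) (g (D x3) (J x3))"
  obtain l v w where eig: "?a * v + ?b * w = l * v" "?c * v + ?d * w = l * w" and unit: "(cmod v)\<^sup>2 + (cmod w)\<^sup>2 = 1"
    by (rule complex_eigenvector)
  define y2 where "y2 = cscale v x2 + cscale w x3"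
  \<comment> \<open>(- cnj w, cnj v) is a unit vector Hermitian-orthogonal to (v, w).\<close>
  define y3 where "y3 = cscale (- cnj w) x2 + cscale (cnj v) x3"
  have unit': "Re v * Re v + Im v * Im v + (Re w * Re w + Im w * Im w) = 1"
    using unit by (simp only: cmod_power2) (simp only: power2_eq_square)
  have "unitary_frame J g x1 y2 y3"
  proof
    show "g y2 y2 = 1" "g y3 y3 = 1"
      using unit' by (simp_all add: y2_def y3_def cscale_def J_simps g_simps algebra_simps)
    show "g x1 y2 = 0" "g x1 (J y2) = 0" "g x1 y3 = 0" "g x1 (J y3) = 0" "g y2 y3 = 0" "g y2 (J y3) = 0"
      by (simp_all add: y2_def y3_def cscale_def J_simps g_simps algebra_simps)
  qed (simp_all add: dim)
  then interpret y: unitary_frame J g x1 y2 y3 .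
  have "D x2 = cscale ?a x2 + cscale ?c x3" "D x3 = cscale ?b x2 + cscale ?d x3"
    by (rule expand[OF orth(1,2)], rule expand[OF orth(3,4)])
  then have "D y2 = cscale v (cscale ?a x2 + cscale ?c x3) + cscale w (cscale ?b x2 + cscale ?d x3)"
    by (simp add: y2_def D_simps(1) D_cscale)
  also have "\<dots> = cscale (?a * v + ?b * w) x2 + cscale (?c * v + ?d * w) x3"
    by (simp only: cscale_add cscale_mult mult.commute[of v] mult.commute[of w] add_ac)
  also have "\<dots> = cscale l y2"
    unfolding eig y2_def by (simp only: cscale_add cscale_mult)
  finally have D2: "D y2 = Re l *\<^sub>R y2 + Im l *\<^sub>R J y2" by (simp add: cscale_def)
  have orth3: "g (D y3) x1 = 0" "g (D y3) (J x1) = 0"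
  proof -
    have "g x1 (D y3) = 0" "g (J x1) (D y3) = 0"
      using orth by (simp_all add: y3_def cscale_def D_simps D(2) J_simps g_simps g_J_left)
    then show "g (D y3) x1 = 0" "g (D y3) (J x1) = 0" by (simp_all add: g_commute[of "D y3"])
  qed
  define a3 nu' br bi where "a3 = g (D y3) y3" and "nu' = g (D y3) (J y3)" and "br = g (D y3) y2" and "bi = g (D y3) (J y2)"
  have D3: "D y3 = br *\<^sub>R y2 + bi *\<^sub>R J y2 + a3 *\<^sub>R y3 + nu' *\<^sub>R J y3"
    using y.frame_expansion[of "D y3"] orth3 by (simp add: a3_def nu'_def br_def bi_def)
  interpret o: hermitian_basis J g "\<lambda>i. y.frame_list ! (i - 1)"
    by unfold_locales (rule y.orthonormal_frame)
  have I: "{1..DIM('g)} = {1, 2, 3, 4, 5, 6}" unfolding dim by auto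
  \<comment> \<open>The real trace is twice the real part of the complex trace, so the second
    eigenvalue has real part - Re l.\<close>
  have "(\<Sum>i = 1..DIM('g). g (D (y.frame_list ! (i - 1))) (y.frame_list ! (i - 1))) = 2 * Re l + 2 * a3"
    unfolding I by (simp add: D1 D2 D3 D(2) D_simps J_simps g_simps)
  then have "a3 = - Re l"
    using o.lin_trace_onb[OF D(1)] trace by simp
  then have D3': "D y3 = br *\<^sub>R y2 + bi *\<^sub>R J y2 - Re l *\<^sub>R y3 + nu' *\<^sub>R J y3"
    using D3 by simp
  show thesis by (rule that[OF y.unitary_frame_axioms D2 D3'])
qed

theorem adapted_balanced_frame:
  fixes \<mu> :: "'g::euclidean_space \<Rightarrow> 'g \<Rightarrow> 'g"
  assumes dim: "DIM('g) = 6" and lie: "lie_bracket \<mu>" and uni: "unimodular \<mu>"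
    and ideal: "codim_one_abelian_ideal \<mu> \<nn>" and cplx: "complex_structure \<mu> J"
    and herm: "hermitian_metric J g" and adapted: "adapted_unitary_basis J g \<nn> e"
    and data: "bracket_data \<mu> J \<nn> e 0 0 A"
  obtains D \<epsilon> x2 x3 al nu nu' br bi where "balanced_frame \<mu> J D \<epsilon> g (e 1) x2 x3 al nu nu' br bi 1"
proof -
  interpret hermitian_space J g
    using cplx herm by unfold_locales (auto simp: complex_structure_def linear_iff)
  interpret hermitian_basis J g e
    by unfold_locales (use adapted in \<open>simp add: adapted_unitary_basis_def\<close>)
  have ons: "g (e i) (e j) = (if i = j then 1 else 0)" if "i \<in> {1..6}" "j \<in> {1..6}" for i j
    using g_onb[of i j] that dim by simp
  have \<nn>: "\<nn> = span (e ` {1..5})" "\<nn> \<inter> J ` \<nn> = span (e ` {2..5})"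
  proof -
    have "DIM('g) - 1 = 5" using dim by simp
    then show "\<nn> = span (e ` {1..5})" "\<nn> \<inter> J ` \<nn> = span (e ` {2..5})"
      using adapted unfolding adapted_unitary_basis_def by metis+
  qed
  have "J (e i) = e (7 - i)" if "i \<in> {1..3}" for i
    using adapted dim that by (simp add: adapted_unitary_basis_def)
  from this[of 1] this[of 2] this[of 3] have Je: "J (e 1) = e 6" "J (e 2) = e 5" "J (e 3) = e 4" by simp_all
  define D where "D = \<mu> (e 6)"
  define \<epsilon> where "\<epsilon> = g (e 6)"
  have bil: "bilinear \<mu>" and alt: "\<mu> x x = 0" for x
    using lie unfolding lie_bracket_def by blast+
  have linD: "linear D" using bil unfolding D_def bilinear_def by blast
  have lin\<epsilon>: "linear \<epsilon>" unfolding \<epsilon>_def by (rule linear_g)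
  have anti: "\<mu> x y = - \<mu> y x" for x y
  proof -
    have "0 = \<mu> (x + y) (x + y)" by (rule alt[symmetric])
    also have "\<dots> = \<mu> x y + \<mu> y x"
      by (simp only: bilinear_ladd[OF bil] bilinear_radd[OF bil]) (simp add: alt)
    finally show ?thesis by (simp add: eq_neg_iff_add_eq_0)
  qed
  have De6: "D (e 6) = 0" by (simp add: D_def alt)
  have n1: "D X = A X" "D X \<in> \<nn> \<inter> J ` \<nn>" "D (J X) = J (D X)" if X: "X \<in> \<nn> \<inter> J ` \<nn>" for X
  proof -
    have d: "\<mu> (e 6) Y = A Y \<and> A Y \<in> \<nn> \<inter> J ` \<nn> \<and> A (J Y) = J (A Y)" if "Y \<in> \<nn> \<inter> J ` \<nn>" for Y
      using data that dim unfolding bracket_data_def Let_def by simp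
    have "\<nn> \<subseteq> UNIV" "subspace \<nn>" using ideal unfolding codim_one_abelian_ideal_def by auto
    then have "J X \<in> \<nn> \<inter> J ` \<nn>"
      using X by (auto simp: image_iff) (metis subspace_neg)
    then show "D X = A X" "D X \<in> \<nn> \<inter> J ` \<nn>" "D (J X) = J (D X)"
      using d[OF X] d[of "J X"] by (simp_all add: D_def)
  qed
  have De1: "D (e 1) = 0"
    using data dim by (simp add: bracket_data_def D_def Let_def)
  have e_n1: "e i \<in> \<nn> \<inter> J ` \<nn>" if "i \<in> {2..5}" for i
    unfolding \<nn>(2) using that by (intro span_base) auto
  have I6: "e ` {1..DIM('g)} = {e 1, e 2, e 3, e 4, e 5, e 6}"
  proof -
    have "{1..DIM('g)} = {1, 2, 3, 4, 5, 6}" unfolding dim by auto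
    then show ?thesis by auto
  qed
  \<comment> \<open>On e_1 and e_6 both sides vanish: a = 0 and v = 0 give D e_1 = 0, and D e_6 = 0
    by alternation. On the other basis vectors A commutes with \<open>J\<close>.\<close>
  have DJ: "D (J x) = J (D x)" for x
  proof -
    have lin: "linear (\<lambda>x. D (J x))" "linear (\<lambda>x. J (D x))"
      using linear_compose[OF linear_J linD] linear_compose[OF linD linear_J] by (simp_all add: comp_def)
    have "J (e 6) = - e 1" unfolding Je(1)[symmetric] by (rule J_J)
    then have "D (J (e 1)) = J (D (e 1))" "D (J (e 6)) = J (D (e 6))"
      using De1 De6 Je(1) linear_neg[OF linD] J_simps(4) by simp_all
    then have "D (J b) = J (D b)" if "b \<in> e ` {1..DIM('g)}" for b
      using that n1(3)[OF e_n1] unfolding I6 by auto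
    moreover have "x \<in> span (e ` {1..DIM('g)})" unfolding span_onb by simp
    ultimately show ?thesis by (rule linear_eq_on_span[OF lin])
  qed
  have \<epsilon>_\<nn>: "\<epsilon> x = 0" if "x \<in> \<nn>" for x
  proof (rule linear_eq_0_on_span[OF lin\<epsilon>])
    show "x \<in> span (e ` {1..5})" using that \<nn>(1) by simp
    show "\<epsilon> y = 0" if "y \<in> e ` {1..5}" for y using that ons by (auto simp: \<epsilon>_def)
  qed
  have proj: "x - \<epsilon> x *\<^sub>R e 6 \<in> \<nn>" for x
  proof -
    have "x = (\<Sum>i = 1..6. g x (e i) *\<^sub>R e i)" using onb_expansion[of x] dim by simp
    also have "\<dots> = (\<Sum>i = 1..5. g x (e i) *\<^sub>R e i) + g x (e 6) *\<^sub>R e 6" by (simp add: eval_nat_numeral)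
    finally have "x - \<epsilon> x *\<^sub>R e 6 = (\<Sum>i = 1..5. g x (e i) *\<^sub>R e i)"
      by (simp add: \<epsilon>_def g_commute[of "e 6"] algebra_simps)
    also have "\<dots> \<in> \<nn>" unfolding \<nn>(1) by (intro span_sum span_scale span_base) auto
    finally show ?thesis .
  qed
  have D_proj: "D x = D (x - \<epsilon> x *\<^sub>R e 6)" for x
    using De6 by (simp add: linear_diff[OF linD] linear_cmul[OF linD])
  \<comment> \<open>Without their e_6 components, both vectors lie in the abelian ideal; expanding
    their vanishing bracket gives the formula.\<close>
  have \<mu>: "\<mu> x y = \<epsilon> x *\<^sub>R D y - \<epsilon> y *\<^sub>R D x" for x y
  proof -
    let ?u = "x - \<epsilon> x *\<^sub>R e 6" and ?v = "y - \<epsilon> y *\<^sub>R e 6"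
    have "0 = \<mu> ?u ?v" using ideal proj unfolding codim_one_abelian_ideal_def by metis
    also have "\<dots> = \<mu> x y - \<epsilon> x *\<^sub>R D y - \<epsilon> y *\<^sub>R \<mu> x (e 6)"
      by (simp add: bilinear_lsub[OF bil] bilinear_rsub[OF bil] bilinear_lmul[OF bil] bilinear_rmul[OF bil] alt D_def)
    also have "\<mu> x (e 6) = - D x" unfolding D_def by (rule anti)
    finally show ?thesis by (simp add: algebra_simps)
  qed
  have \<epsilon>D: "\<epsilon> (D x) = 0" for x
  proof -
    have "D (x - \<epsilon> x *\<^sub>R e 6) \<in> \<nn>" using ideal proj unfolding codim_one_abelian_ideal_def D_def by blast
    then show ?thesis using D_proj \<epsilon>_\<nn> by metis
  qed
  interpret aa: almost_abelian \<mu> J D \<epsilon>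
    by (rule almost_abelian.intro[OF linear_J J_J linD DJ lin\<epsilon> \<epsilon>D \<mu>])
  have uf: "unitary_frame J g (e 1) (e 2) (e 3)"
    by unfold_locales (use dim ons Je in simp_all)
  then interpret f: unitary_frame J g "e 1" "e 2" "e 3" .
  have orth_n1: "g (e 1) x = 0" "g (e 6) x = 0" if "x \<in> \<nn> \<inter> J ` \<nn>" for x
  proof -
    have "x \<in> span (e ` {2..5})" using that \<nn>(2) by simp
    then show "g (e 1) x = 0" "g (e 6) x = 0"
      by (rule linear_eq_0_on_span[OF linear_g(1), rotated]; use ons in auto)+
  qed
  have tr: "lin_trace D = 0" using uni unfolding unimodular_def D_def by blast
  have "g (e 1) (D (e i)) = 0" "g (J (e 1)) (D (e i)) = 0" if "i \<in> {2..5}" for i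
    unfolding Je(1) using orth_n1[OF n1(2)[OF e_n1[OF that]]] by blast+
  from this[of 2] this[of 3] have orth: "g (e 1) (D (e 2)) = 0" "g (J (e 1)) (D (e 2)) = 0"
    "g (e 1) (D (e 3)) = 0" "g (J (e 1)) (D (e 3)) = 0" by simp_all
  obtain x2 x3 al nu nu' br bi where x: "unitary_frame J g (e 1) x2 x3"
    "D x2 = al *\<^sub>R x2 + nu *\<^sub>R J x2" "D x3 = br *\<^sub>R x2 + bi *\<^sub>R J x2 - al *\<^sub>R x3 + nu' *\<^sub>R J x3"
    by (rule f.triangular_frame_exists[OF linD DJ orth De1 tr]) (rule that)
  interpret x: unitary_frame J g "e 1" x2 x3 by (rule x(1))
  have "balanced_frame \<mu> J D \<epsilon> g (e 1) x2 x3 al nu nu' br bi 1"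
  proof
    \<comment> \<open>Since J e_1 = e_6, the initial frame has \<delta> = 1.\<close>
    show "\<epsilon> (e 1) = 0" "\<epsilon> x2 = 0" "\<epsilon> x3 = 0" "\<epsilon> (J x2) = 0" "\<epsilon> (J x3) = 0" "\<epsilon> (J (e 1)) = 1"
      using x.frame_g x.frame_g_J ons unfolding \<epsilon>_def Je(1)[symmetric] by simp_all
  qed (use x De1 in simp_all)
  then show thesis by (rule that)
qed

theorem theorem5p6:
  fixes \<mu> :: "'g::euclidean_space \<Rightarrow> 'g \<Rightarrow> 'g"
    and J :: "'g \<Rightarrow> 'g"
    and g\<^sub>0 :: "'g \<Rightarrow> 'g \<Rightarrow> real"
    and \<omega>\<^sub>0 :: "'g form"
    and \<nn> :: "'g set"
    and e :: "nat \<Rightarrow> 'g"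
    and A\<^sub>0 :: "'g \<Rightarrow> 'g"
  assumes "DIM('g) = 6"
    and "lie_bracket \<mu>"
    and "unimodular \<mu>"
    and "codim_one_abelian_ideal \<mu> \<nn>"
    and "complex_structure \<mu> J"
    and "hermitian_metric J g\<^sub>0"
    and "\<omega>\<^sub>0 = fundamental_form J g\<^sub>0"
    and "balanced \<mu> \<omega>\<^sub>0"
    and "adapted_unitary_basis J g\<^sub>0 \<nn> e"
    and "bracket_data \<mu> J \<nn> e 0 0 A\<^sub>0"
    and "trace_n1 g\<^sub>0 e A\<^sub>0 = 0"
  shows "(\<exists>T\<^sub>m\<^sub>i\<^sub>n::ereal. T\<^sub>m\<^sub>i\<^sub>n < 0 \<and>
            (\<exists>\<omega>. maximal_balanced_flow_solution \<mu> J \<omega>\<^sub>0 {t::real. T\<^sub>m\<^sub>i\<^sub>n < ereal t} \<omega>))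
       \<and> (balanced_flow_solution \<mu> J \<omega>\<^sub>0 UNIV (\<lambda>_. \<omega>\<^sub>0) \<longleftrightarrow> kaehler \<mu> \<omega>\<^sub>0)"
proof -
  obtain D \<epsilon> x2 x3 al nu nu' br bi where "balanced_frame \<mu> J D \<epsilon> g\<^sub>0 (e 1) x2 x3 al nu nu' br bi 1"
    using adapted_balanced_frame assms(1-6,9,10) by blast
  then interpret balanced_frame \<mu> J D \<epsilon> g\<^sub>0 "e 1" x2 x3 al nu nu' br bi 1 .
  have "\<omega> = \<omega>\<^sub>0" unfolding \<omega>_def assms(7) ..
  then show ?thesis
    using maximal_solution_exists fixed_iff_kaehler by simp
qed

end
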